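(* Let $\Gamma$ be a finite, compact, connected metric graph containing only independent cycles. Assume that for each cycle $C$ of $\Gamma$ and each edge $\hat e\in\mathcal E(C)$ there exist numbers $\nu_{\hat e}(e)\in\{-1,1\}$, $e\in\mathcal E(C)$, such that $$\frac{1}{L(\hat e)}\sum_{e\in\mathcal E(C)}\nu_{\hat e}(e)L(e)$$ is an even integer. Then $$\lambda_{n+1}\big(L^{\rm st}(\Gamma)\big)\le\lambda_n\big(L^{\rm D}(\Gamma)\big)\qquad\text{for all }n\in\mathbb N.$$
   Context: A finite compact metric graph $\Gamma$ consists of finitely many edges $e_n=[x_{2n-1},x_{2n}]\subset\mathbb R$ of positive lengths $L(e_n)$ and a vertex set $\mathcal V$ which is a partition of the set of all edge endpoints (loops and multiple edges allowed). A cycle is a closed non-self-intersecting path in the graph; $\mathcal E(C)$ is the set of edges forming the cycle $C$. $\Gamma$ contains only independent cycles if no edge belongs to two different cycles. $f(x_j)$ denotes the limit of $f$ at endpoint $x_j$, and $\partial f(x_j)=f'(x_j)$ if $x_j$ is a left endpoint, $-f'(x_j)$ if a right endpoint. The standard Laplacian $L^{\rm st}(\Gamma)$ acts as $-f''$ on each edge with domain all $f\in W^2_2(\Gamma\setminus\mathcal V)=\bigoplus_nW^2_2(e_n)$ with, at every vertex $v$, $f(x_i)=f(x_j)$ for $x_i,x_j\in v$ and $\sum_{x_j\in v}\partial f(x_j)=0$. The Dirichlet Laplacian $L^{\rm D}(\Gamma)$ acts as $-f''$ with domain all $f\in W^2_2(\Gamma\setminus\mathcal V)$ with $f(x_j)=0$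 at every endpoint $x_j$. Eigenvalues $\lambda_1\le\lambda_2\le\dots$ are counted with multiplicities. *)

theory Defs
  imports "HOL-Analysis.Analysis" "HOL-Library.Disjoint_Sets"
begin

(* A finite compact metric graph with N edges e_n = [a n, b n], n < N.
   An edge endpoint is encoded as (n, False) = left endpoint a n,
   (n, True) = right endpoint b n.  The vertex set V is a partition
   of the set of all endpoints. *)

type_synonym endpoint = "nat \<times> bool"

definition endpoints :: "nat \<Rightarrow> endpoint set" where
  "endpoints N = {..<N} \<times> UNIV"

definition metric_graph ::
  "nat \<Rightarrow> (nat \<Rightarrow> real) \<Rightarrow> (nat \<Rightarrow> real) \<Rightarrow> endpoint set set \<Rightarrow> bool" where
  "metric_graph N a b V \<longleftrightarrow> 0 < N \<and> (\<forall>n<N. a n < b n) \<and> partition_on (endpoints N) V"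

(* length L(e_n) *)
definition edge_len :: "(nat \<Rightarrow> real) \<Rightarrow> (nat \<Rightarrow> real) \<Rightarrow> nat \<Rightarrow> real" where
  "edge_len a b n = b n - a n"

(* edge n joins vertices u and w *)
definition joins :: "endpoint set set \<Rightarrow> nat \<Rightarrow> endpoint set \<Rightarrow> endpoint set \<Rightarrow> bool" where
  "joins V n u w \<longleftrightarrow> u \<in> V \<and> w \<in> V \<and>
     (((n, False) \<in> u \<and> (n, True) \<in> w) \<or> ((n, False) \<in> w \<and> (n, True) \<in> u))"

definition mg_connected :: "nat \<Rightarrow> endpoint set set \<Rightarrow> bool" where
  "mg_connected N V \<longleftrightarrow>
     (\<forall>u\<in>V. \<forall>w\<in>V. (u, w) \<in> {(u, w). \<exists>n<N. joins V n u w}\<^sup>*)"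

(* S is the edge set E(C) of a cycle C: a closed path through k >= 1 distinct
   edges es 0, ..., es (k-1) and k distinct vertices vs 0, ..., vs (k-1),
   edge es i joining vs i and vs (i+1 mod k). *)
definition is_cycle :: "nat \<Rightarrow> endpoint set set \<Rightarrow> nat set \<Rightarrow> bool" where
  "is_cycle N V S \<longleftrightarrow> (\<exists>k es vs. 1 \<le> k \<and> inj_on es {..<k} \<and> inj_on vs {..<k} \<and>
      (\<forall>i<k. es i < N \<and> joins V (es i) (vs i) (vs (Suc i mod k))) \<and> S = es ` {..<k})"

definition only_independent_cycles :: "nat \<Rightarrow> endpoint set set \<Rightarrow> bool" where
  "only_independent_cycles N V \<longleftrightarrow>
     (\<forall>S T e. is_cycle N V S \<and> is_cycle N V T \<and> e \<in> S \<and> e \<in> T \<longrightarrow> S = T)"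

(* functions on the graph: f n is the function on edge e_n = [a n, b n] *)

definition edge_deriv ::
  "(nat \<Rightarrow> real) \<Rightarrow> (nat \<Rightarrow> real) \<Rightarrow> (nat \<Rightarrow> real \<Rightarrow> real) \<Rightarrow> nat \<Rightarrow> real \<Rightarrow> real" where
  "edge_deriv a b f n x = vector_derivative (f n) (at x within {a n..b n})"

(* f(x_j) *)
definition end_val ::
  "(nat \<Rightarrow> real) \<Rightarrow> (nat \<Rightarrow> real) \<Rightarrow> (nat \<Rightarrow> real \<Rightarrow> real) \<Rightarrow> endpoint \<Rightarrow> real" where
  "end_val a b f p = (if snd p then f (fst p) (b (fst p)) else f (fst p) (a (fst p)))"

(* \<partial>f(x_j) *)
definition normal_der ::
  "(nat \<Rightarrow> real) \<Rightarrow> (nat \<Rightarrow> real) \<Rightarrow> (nat \<Rightarrow> real \<Rightarrow> real) \<Rightarrow> endpoint \<Rightarrow> real" where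
  "normal_der a b f p = (if snd p then - edge_deriv a b f (fst p) (b (fst p))
                         else edge_deriv a b f (fst p) (a (fst p)))"

(* -f'' = lam f on every edge (f twice differentiable up to the endpoints) *)
definition edge_ode ::
  "nat \<Rightarrow> (nat \<Rightarrow> real) \<Rightarrow> (nat \<Rightarrow> real) \<Rightarrow> real \<Rightarrow> (nat \<Rightarrow> real \<Rightarrow> real) \<Rightarrow> bool" where
  "edge_ode N a b lam f \<longleftrightarrow> (\<forall>n<N. \<forall>x\<in>{a n..b n}.
      (f n has_vector_derivative edge_deriv a b f n x) (at x within {a n..b n}) \<and>
      (edge_deriv a b f n has_vector_derivative (- lam * f n x)) (at x within {a n..b n}))"

(* solutions of the eigenvalue equation L^st f = lam f *)
definition std_sol ::
  "nat \<Rightarrow> (nat \<Rightarrow> real) \<Rightarrow> (nat \<Rightarrow> real) \<Rightarrow> endpoint set set \<Rightarrow> real \<Rightarrow> (nat \<Rightarrow> real \<Rightarrow> real) \<Rightarrow> bool" where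
  "std_sol N a b V lam f \<longleftrightarrow> edge_ode N a b lam f \<and>
     (\<forall>v\<in>V. \<forall>p\<in>v. \<forall>q\<in>v. end_val a b f p = end_val a b f q) \<and>
     (\<forall>v\<in>V. (\<Sum>p\<in>v. normal_der a b f p) = 0)"

(* solutions of the eigenvalue equation L^D f = lam f *)
definition dir_sol ::
  "nat \<Rightarrow> (nat \<Rightarrow> real) \<Rightarrow> (nat \<Rightarrow> real) \<Rightarrow> real \<Rightarrow> (nat \<Rightarrow> real \<Rightarrow> real) \<Rightarrow> bool" where
  "dir_sol N a b lam f \<longleftrightarrow> edge_ode N a b lam f \<and> (\<forall>p\<in>endpoints N. end_val a b f p = 0)"

(* g 0, ..., g (k-1) are linearly independent as functions on the graph *)
definition lin_indep_on ::
  "nat \<Rightarrow> (nat \<Rightarrow> real) \<Rightarrow> (nat \<Rightarrow> real) \<Rightarrow> nat \<Rightarrow> (nat \<Rightarrow> nat \<Rightarrow> real \<Rightarrow> real) \<Rightarrow> bool" where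
  "lin_indep_on N a b k g \<longleftrightarrow> (\<forall>c :: nat \<Rightarrow> real.
      (\<forall>n<N. \<forall>x\<in>{a n..b n}. (\<Sum>i<k. c i * g i n x) = 0) \<longrightarrow> (\<forall>i<k. c i = 0))"

(* multiplicity of lam = dimension of the eigenspace {f. sol lam f} (0 if not an eigenvalue) *)
definition multiplicity ::
  "nat \<Rightarrow> (nat \<Rightarrow> real) \<Rightarrow> (nat \<Rightarrow> real) \<Rightarrow> (real \<Rightarrow> (nat \<Rightarrow> real \<Rightarrow> real) \<Rightarrow> bool) \<Rightarrow> real \<Rightarrow> nat" where
  "multiplicity N a b sol lam =
     Sup {k. \<exists>g. (\<forall>i<k. sol lam (g i)) \<and> lin_indep_on N a b k g}"

(* eigenvalue counting function: number of eigenvalues <= mu, with multiplicities *)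
definition eig_count ::
  "nat \<Rightarrow> (nat \<Rightarrow> real) \<Rightarrow> (nat \<Rightarrow> real) \<Rightarrow> (real \<Rightarrow> (nat \<Rightarrow> real \<Rightarrow> real) \<Rightarrow> bool) \<Rightarrow> real \<Rightarrow> nat" where
  "eig_count N a b sol mu =
     (\<Sum>lam\<in>{lam. lam \<le> mu \<and> 0 < multiplicity N a b sol lam}. multiplicity N a b sol lam)"

(* n-th eigenvalue (n >= 1), counted with multiplicities, in nondecreasing order *)
definition eigval ::
  "nat \<Rightarrow> (nat \<Rightarrow> real) \<Rightarrow> (nat \<Rightarrow> real) \<Rightarrow> (real \<Rightarrow> (nat \<Rightarrow> real \<Rightarrow> real) \<Rightarrow> bool) \<Rightarrow> nat \<Rightarrow> real" where
  "eigval N a b sol n = Inf {mu. n \<le> eig_count N a b sol mu}"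

end

(*
  Write mu = K^2. Counting functions reduce the claim to
    eig_count(L^st)(K^2) >= eig_count(L^D)(K^2) + 1   for all K >= 0,
  where eig_count(L^D)(K^2) is the sum of floor(K L(e) / pi) over the edges e.

  Lower bound for L^st. Cut the graph along a cycle basis: the fundamental cycles of a spanning
  tree are edge disjoint since cycles are independent, and every remaining edge is a block of its
  own. On a single edge take the Neumann functions cos (j pi x / L) with j <= K L / pi, on a cycle
  of length c take the trigonometric polynomials of degree <= K c / (2 pi). All of these are
  eigenfunctions of the cut graph with eigenvalue <= K^2, so int f'^2 - K^2 f^2 <= 0 on their span.
  Continuity at the vertices of the original graph costs (number of blocks) - 1 linear conditions,
  while the parity hypothesis gives 2 floor(K c / (2 pi)) >= sum of floor(K L(e) / pi) on each cycle.
  Hence a space of continuous functions of dimension 1 + sum of floor(K L(e) / pi) remains.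

  From this space to eigenvalues without functional analysis. Divide every edge into pieces so
  short that K * (length) < pi. For 0 <= t <= K the minimum of int f'^2 - t^2 f^2 over functions with
  prescribed values at the division points is a quadratic form q_t in these values whose coefficients
  are continuous in t, whose kernel is the eigenspace of L^st at t^2, and q_0 >= 0. Whenever the
  maximal dimension of a subspace with q_t <= 0 jumps as t grows from 0 to K, the jump is at most
  dim ker q_t.
*)
theory Submission
  imports Defs
begin

section \<open>Families of vectors indexed by a finite set\<close>


text \<open>\<open>eigval\<close> counts solutions of a differential equation, with no operator or
  min-max principle behind it, so a large space of test functions has to be turned into actual
  solutions. The form q_t does this. It has poles where t^2 is a Dirichlet eigenvalue of a piece,
  and short pieces push these poles beyond K. Since q_0 has no negative directions, every
  nonpositive dimension at K must have been produced by kernels on the way. Test functions enter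
  through one inequality: the energy of a function bounds q_K at its node values from above. The
  gain of 1 is a balance: each block carries one function, its constant, beyond those matched with
  Dirichlet eigenvalues, and the constants outnumber the gluing conditions by one. That gluing is
  this cheap rests on Euler's count \<open>N + 1 \<le> card F + card V\<close>. Parity matters
  because the nonconstant functions on a cycle come in pairs of cosine and sine, and an even number
  2 floor(K c / (2 pi)) could otherwise fall below the sum of the floors of the edges.\<close>

definition indep_on :: "'i set \<Rightarrow> 'j set \<Rightarrow> ('j \<Rightarrow> 'i \<Rightarrow> real) \<Rightarrow> bool" where
  "indep_on X J v \<longleftrightarrow> (\<forall>c. (\<forall>x\<in>X. (\<Sum>j\<in>J. c j * v j x) = 0) \<longrightarrow> (\<forall>j\<in>J. c j = 0))"

definition lincomb :: "'j set \<Rightarrow> ('j \<Rightarrow> 'i \<Rightarrow> real) \<Rightarrow> ('j \<Rightarrow> real) \<Rightarrow> 'i \<Rightarrow> real" where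
  "lincomb J v c x = (\<Sum>j\<in>J. c j * v j x)"

lemma indep_onD: "indep_on X J v \<Longrightarrow> (\<And>x. x \<in> X \<Longrightarrow> lincomb J v c x = 0) \<Longrightarrow> j \<in> J \<Longrightarrow> c j = 0"
  unfolding indep_on_def lincomb_def by blast

lemma indep_onI:
  "(\<And>c j. (\<And>x. x \<in> X \<Longrightarrow> lincomb J v c x = 0) \<Longrightarrow> j \<in> J \<Longrightarrow> c j = 0) \<Longrightarrow> indep_on X J v"
  unfolding indep_on_def lincomb_def by blast

lemma indep_on_reindex:
  assumes "indep_on X J v" "bij_betw h H J"
  shows "indep_on X H (v \<circ> h)"
proof (rule indep_onI)
  fix c i assume z: "\<And>x. x \<in> X \<Longrightarrow> lincomb H (v \<circ> h) c x = 0" and i: "i \<in> H"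
  let ?k = "inv_into H h"
  have inv: "?k (h i) = i" if "i \<in> H" for i
    using that assms(2) by (simp add: bij_betw_def)
  have "lincomb J v (c \<circ> ?k) x = lincomb H (v \<circ> h) c x" for x
    using sum.reindex_bij_betw[OF assms(2), of "\<lambda>j. c (?k j) * v j x"]
    by (simp add: lincomb_def inv cong: sum.cong)
  then have "(c \<circ> ?k) (h i) = 0"
    using z assms(2) i by (intro indep_onD[OF assms(1), of "c \<circ> ?k" "h i"]) (auto simp: bij_betw_def)
  then show "c i = 0" using inv i by simp
qed

lemma lincomb_mono_neutral:
  assumes "finite J" "H \<subseteq> J"
  shows "lincomb H v c x = lincomb J v (\<lambda>j. if j \<in> H then c j else 0) x"
  unfolding lincomb_def
  by (rule sum.mono_neutral_cong_left[OF assms]) auto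

lemma indep_on_subset:
  assumes "indep_on X J v" "finite J" "H \<subseteq> J"
  shows "indep_on X H v"
proof (rule indep_onI)
  fix c j assume z: "\<And>x. x \<in> X \<Longrightarrow> lincomb H v c x = 0" and j: "j \<in> H"
  have "(\<lambda>j. if j \<in> H then c j else 0) j = 0"
    using z j assms by (intro indep_onD[OF assms(1), of "\<lambda>j. if j \<in> H then c j else 0" j]) (auto simp: lincomb_mono_neutral[symmetric])
  then show "c j = 0" using j by simp
qed

lemma lincomb_unit:
  assumes "finite J" "j \<in> J"
  shows "lincomb J v (\<lambda>i. if i = j then 1 else 0) x = v j x"
proof -
  have "lincomb J v (\<lambda>i. if i = j then 1 else 0) x = (\<Sum>i\<in>J. if i = j then v i x else 0)"
    unfolding lincomb_def by (intro sum.cong) auto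
  then show ?thesis using assms by simp
qed

text \<open>Gaussian elimination, one equation at a time: if the new functional
  \<open>\<phi>\<close> vanishes on the family, nothing is lost; otherwise a pivot \<open>k\<close>
  is removed and multiples of it correct the remaining vectors.\<close>

lemma kernel_family:
  fixes A :: "'p \<Rightarrow> 'i \<Rightarrow> real"
  assumes I: "finite I" and P: "finite P"
  shows "\<exists>J C. J \<subseteq> I \<and> card I \<le> card J + card P \<and> indep_on I J (C :: 'i \<Rightarrow> 'i \<Rightarrow> real) \<and>
           (\<forall>j\<in>J. \<forall>p\<in>P. (\<Sum>i\<in>I. A p i * C j i) = 0)"
  using P
proof induction
  case empty
  have "indep_on I I (\<lambda>j x. if x = j then 1 else 0)"
  proof (rule indep_onI)
    fix c j assume z: "\<And>x. x \<in> I \<Longrightarrow> lincomb I (\<lambda>j x. if x = j then 1 else 0) c x = 0" and j: "j \<in> I"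
    have "lincomb I (\<lambda>j x. if x = j then 1 else 0) c j = (\<Sum>i\<in>I. if i = j then c i else 0)"
      unfolding lincomb_def by (intro sum.cong) auto
    then show "c j = 0" using z[OF j] j I by simp
  qed
  then show ?case by (intro exI[of _ I]) auto
next
  case (insert p P)
  then obtain J and C :: "'i \<Rightarrow> 'i \<Rightarrow> real" where J: "J \<subseteq> I" "card I \<le> card J + card P" "indep_on I J C"
    and z: "\<And>j p. j \<in> J \<Longrightarrow> p \<in> P \<Longrightarrow> (\<Sum>i\<in>I. A p i * C j i) = 0" by blast
  have fJ: "finite J" using J(1) I finite_subset by blast
  define \<phi> where "\<phi> j = (\<Sum>i\<in>I. A p i * C j i)" for j
  show ?case
  proof (cases "\<forall>j\<in>J. \<phi> j = 0")
    case True
    then show ?thesis using J z insert.hyps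
      by (intro exI[of _ J] exI[of _ C]) (auto simp: \<phi>_def)
  next
    case False
    then obtain k where k: "k \<in> J" "\<phi> k \<noteq> 0" by auto
    define C' where "C' j i = C j i - \<phi> j / \<phi> k * C k i" for j i
    have "indep_on I (J - {k}) C'"
    proof (rule indep_onI)
      fix c j assume c0: "\<And>x. x \<in> I \<Longrightarrow> lincomb (J - {k}) C' c x = 0" and j: "j \<in> J - {k}"
      \<comment> \<open>The multiples of the pivot that were subtracted in \<open>C'\<close>,
        collected into the coefficient of \<open>k\<close>.\<close>
      define c' where "c' = c(k := - (\<Sum>j\<in>J - {k}. c j * \<phi> j / \<phi> k))"
      have "lincomb J C c' x = lincomb (J - {k}) C' c x" for x
      proof -
        have "lincomb J C c' x = c' k * C k x + (\<Sum>j\<in>J - {k}. c' j * C j x)"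
          unfolding lincomb_def by (rule sum.remove[OF fJ k(1)])
        also have "(\<Sum>j\<in>J - {k}. c' j * C j x) = (\<Sum>j\<in>J - {k}. c j * C j x)"
          by (intro sum.cong) (auto simp: c'_def)
        also have "c' k * C k x = (\<Sum>j\<in>J - {k}. - (c j * \<phi> j / \<phi> k * C k x))"
          by (simp add: c'_def sum_distrib_right sum_negf)
        finally show ?thesis
          by (simp add: lincomb_def C'_def sum.distrib[symmetric] algebra_simps)
      qed
      then have "c' j = 0" using c0 j by (intro indep_onD[OF J(3), of c' j]) auto
      then show "c j = 0" using j by (simp add: c'_def)
    qed
    moreover have "(\<Sum>i\<in>I. A q i * C' j i) = 0" if "j \<in> J - {k}" "q \<in> insert p P" for j q
    proof -
      have "(\<Sum>i\<in>I. A q i * C' j i) = (\<Sum>i\<in>I. A q i * C j i) - \<phi> j / \<phi> k * (\<Sum>i\<in>I. A q i * C k i)"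
        unfolding C'_def by (simp add: algebra_simps sum_subtractf sum_distrib_left)
      also have "\<dots> = 0" using z[of j q] z[of k q] that k by (auto simp: \<phi>_def[symmetric])
      finally show ?thesis .
    qed
    moreover have "card I \<le> card (J - {k}) + card (insert p P)"
      using J(2) k(1) fJ insert.hyps by (simp add: card.insert_remove card_Diff_singleton)
    ultimately show ?thesis using J(1) by (intro exI[of _ "J - {k}"] exI[of _ C']) blast
  qed
qed

lemma kernel_vector:
  fixes A :: "'p \<Rightarrow> 'i \<Rightarrow> real"
  assumes "finite I" "finite P" "card P < card I"
  shows "\<exists>c. (\<exists>i\<in>I. c i \<noteq> 0) \<and> (\<forall>p\<in>P. (\<Sum>i\<in>I. A p i * c i) = 0)"
proof -
  obtain J and C :: "'i \<Rightarrow> 'i \<Rightarrow> real" where J: "J \<subseteq> I" "card I \<le> card J + card P" "indep_on I J C"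
    "\<And>j p. j \<in> J \<Longrightarrow> p \<in> P \<Longrightarrow> (\<Sum>i\<in>I. A p i * C j i) = 0"
    using kernel_family[OF assms(1,2), of A] by blast
  have "J \<noteq> {}" using J(2) assms(3) by auto
  then obtain j where j: "j \<in> J" by auto
  have fJ: "finite J" using J(1) assms(1) finite_subset by blast
  have "\<exists>i\<in>I. C j i \<noteq> 0"
  proof (rule ccontr)
    assume "\<not> (\<exists>i\<in>I. C j i \<noteq> 0)"
    then have "(\<lambda>i. if i = j then 1 else 0 :: real) j = 0"
      using j fJ by (intro indep_onD[OF J(3), of "\<lambda>i. if i = j then 1 else 0" j]) (auto simp: lincomb_unit)
    then show False by simp
  qed
  then show ?thesis using J(4) j by blast
qed

lemma indep_on_card_le:
  assumes "indep_on X J v" "finite J" "finite X"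
  shows "card J \<le> card X"
proof (rule ccontr)
  assume "\<not> card J \<le> card X"
  then obtain c where c: "\<exists>j\<in>J. c j \<noteq> 0" "\<forall>x\<in>X. (\<Sum>j\<in>J. v j x * c j) = 0"
    using kernel_vector[OF assms(2,3), of "\<lambda>x j. v j x"] by auto
  then show False using assms(1) unfolding indep_on_def by (metis (no_types, lifting) mult.commute sum.cong)
qed

lemma lincomb_lincomb:
  "lincomb J (\<lambda>j. lincomb H v (C j)) c x = lincomb H v (lincomb J C c) x"
  unfolding lincomb_def sum_distrib_left sum_distrib_right
  by (subst sum.swap) (simp add: mult.assoc)

lemma indep_on_lincomb:
  assumes "indep_on X H v" "indep_on H J C"
  shows "indep_on X J (\<lambda>j. lincomb H v (C j))"
proof (rule indep_onI)
  fix c j assume z: "\<And>x. x \<in> X \<Longrightarrow> lincomb J (\<lambda>j. lincomb H v (C j)) c x = 0" and j: "j \<in> J"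
  show "c j = 0"
  proof (rule indep_onD[OF assms(2) _ j])
    fix i assume "i \<in> H"
    then show "lincomb J C c i = 0"
      using z by (intro indep_onD[OF assms(1), of "lincomb J C c" i]) (auto simp: lincomb_lincomb)
  qed
qed

text \<open>Gram-Schmidt, with the next vector found as a solution of \<open>j\<close> orthogonality
  equations in \<open>d\<close> unknowns. The purpose is compactness: the entries of orthonormal
  vectors are bounded by 1.\<close>

lemma orthonormal_frame:
  assumes X: "finite X" and v: "indep_on X {..<d} v"
  shows "\<exists>C :: nat \<Rightarrow> nat \<Rightarrow> real. \<forall>i<d. \<forall>k<d.
    (\<Sum>x\<in>X. lincomb {..<d} v (C i) x * lincomb {..<d} v (C k) x) = (if i = k then 1 else 0)"
proof -
  have "\<exists>C :: nat \<Rightarrow> nat \<Rightarrow> real. \<forall>i<j. \<forall>k<j.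
    (\<Sum>x\<in>X. lincomb {..<d} v (C i) x * lincomb {..<d} v (C k) x) = (if i = k then 1 else 0)"
    if "j \<le> d" for j
    using that
  proof (induction j)
    case 0
    then show ?case by simp
  next
    case (Suc j)
    then obtain C :: "nat \<Rightarrow> nat \<Rightarrow> real" where C: "\<And>i k. i < j \<Longrightarrow> k < j \<Longrightarrow>
      (\<Sum>x\<in>X. lincomb {..<d} v (C i) x * lincomb {..<d} v (C k) x) = (if i = k then 1 else 0)" by auto
    obtain c where c: "\<exists>i\<in>{..<d}. c i \<noteq> 0"
      "\<forall>p\<in>{..<j}. (\<Sum>i\<in>{..<d}. (\<Sum>x\<in>X. lincomb {..<d} v (C p) x * v i x) * c i) = 0"
      using kernel_vector[of "{..<d}" "{..<j}" "\<lambda>p i. \<Sum>x\<in>X. lincomb {..<d} v (C p) x * v i x"] Suc.prems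
      by auto
    define u where "u = lincomb {..<d} v c"
    have orth: "(\<Sum>x\<in>X. lincomb {..<d} v (C p) x * u x) = 0" if "p < j" for p
    proof -
      have "(\<Sum>x\<in>X. lincomb {..<d} v (C p) x * u x) = (\<Sum>x\<in>X. \<Sum>i<d. lincomb {..<d} v (C p) x * v i x * c i)"
        unfolding u_def lincomb_def[of _ _ c] by (simp add: sum_distrib_left mult_ac)
      also have "\<dots> = (\<Sum>i\<in>{..<d}. (\<Sum>x\<in>X. lincomb {..<d} v (C p) x * v i x) * c i)"
        by (subst sum.swap) (simp add: sum_distrib_right)
      also have "\<dots> = 0" using c(2) that by auto
      finally show ?thesis .
    qed
    define s where "s = (\<Sum>x\<in>X. u x * u x)"
    have "s \<noteq> 0"
    proof
      assume "s = 0"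
      then have "\<forall>x\<in>X. u x = 0" unfolding s_def using X by (simp add: sum_nonneg_eq_0_iff)
      then show False using c(1) indep_onD[OF v, of c] by (auto simp: u_def)
    qed
    moreover have "s \<ge> 0" unfolding s_def by (intro sum_nonneg) auto
    ultimately have s: "s > 0" by simp
    define c' where "c' i = c i / sqrt s" for i
    have u': "lincomb {..<d} v c' x = u x / sqrt s" for x
      unfolding c'_def u_def lincomb_def by (simp add: sum_divide_distrib)
    have norm: "(\<Sum>x\<in>X. u x / sqrt s * (u x / sqrt s)) = 1"
      using s by (simp add: sum_divide_distrib[symmetric] s_def[symmetric])
    have o: "(\<Sum>x\<in>X. lincomb {..<d} v (C p) x * (u x / sqrt s)) = 0" 
            "(\<Sum>x\<in>X. (u x / sqrt s) * lincomb {..<d} v (C p) x) = 0" if "p < j" for p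
      using orth[OF that] by (simp_all add: sum_divide_distrib[symmetric] mult.commute)
    show ?case
    proof (intro exI[of _ "C(j := c')"] allI impI)
      fix i k assume "i < Suc j" "k < Suc j"
      then show "(\<Sum>x\<in>X. lincomb {..<d} v ((C(j := c')) i) x * lincomb {..<d} v ((C(j := c')) k) x) = (if i = k then 1 else 0)"
        using C[of i k] norm o by (cases "i = j"; cases "k = j") (simp_all add: u')
    qed
  qed
  then show ?thesis by blast
qed

text \<open>Bolzano-Weierstrass, passing to a further subsequence for each index.\<close>

lemma bounded_family_convergent_subsequence:
  fixes f :: "nat \<Rightarrow> 'i \<Rightarrow> real"
  assumes "finite I" "\<And>n i. i \<in> I \<Longrightarrow> \<bar>f n i\<bar> \<le> B"
  shows "\<exists>r l. strict_mono (r :: nat \<Rightarrow> nat) \<and> (\<forall>i\<in>I. (\<lambda>n. f (r n) i) \<longlonglongrightarrow> l i)"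
  using assms
proof (induction I)
  case empty
  then show ?case by (auto intro: exI[of _ id] strict_mono_id)
next
  case (insert k I)
  have "\<exists>r l. strict_mono (r :: nat \<Rightarrow> nat) \<and> (\<forall>i\<in>I. (\<lambda>n. f (r n) i) \<longlonglongrightarrow> l i)"
    using insert.IH insert.prems by auto
  then obtain r l where r: "strict_mono (r :: nat \<Rightarrow> nat)" "\<And>i. i \<in> I \<Longrightarrow> (\<lambda>n. f (r n) i) \<longlonglongrightarrow> l i"
    by blast
  have "bounded (range (\<lambda>n. f (r n) k))"
    unfolding bounded_iff using insert.prems by auto
  then obtain l' s where s: "strict_mono (s :: nat \<Rightarrow> nat)" "((\<lambda>n. f (r n) k) \<circ> s) \<longlonglongrightarrow> l'"
    using bounded_imp_convergent_subsequence by blast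
  have "(\<lambda>n. f ((r \<circ> s) n) i) \<longlonglongrightarrow> l i" if "i \<in> I" for i
    using LIMSEQ_subseq_LIMSEQ[OF r(2)[OF that] s(1)] by (simp add: o_def)
  then show ?case using s r insert.hyps
    by (intro exI[of _ "r \<circ> s"] exI[of _ "l(k := l')"]) (auto simp: o_def strict_mono_def)
qed

section \<open>Quadratic forms depending continuously on a parameter\<close>

locale symmetric_family =
  fixes X :: "'i set" and M :: "real \<Rightarrow> 'i \<Rightarrow> 'i \<Rightarrow> real" and K :: real
  assumes finite_X: "finite X"
    and sym: "\<And>t x y. x \<in> X \<Longrightarrow> y \<in> X \<Longrightarrow> M t x y = M t y x"
    and cont: "\<And>x y. x \<in> X \<Longrightarrow> y \<in> X \<Longrightarrow> continuous_on {0..K} (\<lambda>t. M t x y)"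
    and psd0: "\<And>u. 0 \<le> (\<Sum>x\<in>X. \<Sum>y\<in>X. M 0 x y * u x * u y)"
begin

definition bil :: "real \<Rightarrow> ('i \<Rightarrow> real) \<Rightarrow> ('i \<Rightarrow> real) \<Rightarrow> real" where
  "bil t u v = (\<Sum>x\<in>X. \<Sum>y\<in>X. M t x y * u x * v y)"

definition app :: "real \<Rightarrow> ('i \<Rightarrow> real) \<Rightarrow> 'i \<Rightarrow> real" where
  "app t u x = (\<Sum>y\<in>X. M t x y * u y)"

text \<open>For the symmetric matrix \<open>M t\<close> this says that at least \<open>d\<close> of
  its eigenvalues, with multiplicity, are nonpositive. It is stated with frames so that limits can
  be taken vector by vector.\<close>

definition nonpos :: "nat \<Rightarrow> real \<Rightarrow> bool" where
  "nonpos d t \<longleftrightarrow> (\<exists>v. indep_on X {..<d} v \<and>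
     (\<forall>c. bil t (lincomb {..<d} v c) (lincomb {..<d} v c) \<le> 0))"

lemma bil_app: "bil t u v = (\<Sum>x\<in>X. u x * app t v x)"
  unfolding bil_def app_def by (simp add: sum_distrib_left mult_ac)

lemma bil_sym: "bil t u v = bil t v u"
  unfolding bil_def by (subst sum.swap) (simp add: sym mult_ac cong: sum.cong)

lemma bil_perturb:
  "bil t (\<lambda>x. u x - e * w x) (\<lambda>x. u x - e * w x) = bil t u u - 2 * e * bil t w u + e\<^sup>2 * bil t w w"
proof -
  have "bil t (\<lambda>x. u x - e * w x) (\<lambda>x. u x - e * w x) = bil t u u - e * bil t u w - e * bil t w u + e\<^sup>2 * bil t w w"
    unfolding bil_def
    by (simp add: algebra_simps sum.distrib sum_subtractf sum_distrib_left power2_eq_square)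
  then show ?thesis by (simp add: bil_sym[of t u w])
qed

lemma bil_bound: "bil t u u \<le> (\<Sum>x\<in>X. \<Sum>y\<in>X. \<bar>M t x y\<bar>) * (\<Sum>x\<in>X. u x * u x)"
proof -
  let ?s = "\<Sum>x\<in>X. u x * u x"
  have le: "u x * u x \<le> ?s" if "x \<in> X" for x
    using member_le_sum[OF that, of "\<lambda>x. u x * u x"] finite_X by auto
  have "M t x y * u x * u y \<le> \<bar>M t x y\<bar> * ?s" if "x \<in> X" "y \<in> X" for x y
  proof -
    have "\<bar>u x * u y\<bar> \<le> ?s"
    proof -
      have "2 * \<bar>u x * u y\<bar> \<le> u x * u x + u y * u y"
        using zero_le_power2[of "\<bar>u x\<bar> - \<bar>u y\<bar>"] by (simp add: power2_eq_square algebra_simps abs_mult)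
      then show ?thesis using le that by (smt (verit))
    qed
    then have "\<bar>M t x y\<bar> * \<bar>u x * u y\<bar> \<le> \<bar>M t x y\<bar> * ?s" by (intro mult_left_mono) auto
    then show ?thesis by (metis abs_le_iff abs_mult mult.assoc)
  qed
  then show ?thesis unfolding bil_def sum_distrib_right by (intro sum_mono) auto
qed

lemma app_lincomb: "app t (lincomb J v c) x = lincomb J (\<lambda>j. app t (v j)) c x"
  unfolding app_def lincomb_def sum_distrib_left by (subst sum.swap) (simp add: mult_ac)

lemma bil_cong: "(\<And>x. x \<in> X \<Longrightarrow> u x = u' x) \<Longrightarrow> (\<And>x. x \<in> X \<Longrightarrow> v x = v' x) \<Longrightarrow> bil t u v = bil t u' v'"
  unfolding bil_def by simp

lemma bil_scale: "bil t (\<lambda>x. e * u x) (\<lambda>x. e * u x) = e\<^sup>2 * bil t u u"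
  unfolding bil_def by (simp add: sum_distrib_left power2_eq_square mult_ac)

lemma tendsto_bil:
  assumes "tn \<longlonglongrightarrow> t" "\<And>n. tn n \<in> {0..K}" "t \<in> {0..K}"
    and "\<And>x. x \<in> X \<Longrightarrow> (\<lambda>n. un n x) \<longlonglongrightarrow> u x"
  shows "(\<lambda>n. bil (tn n) (un n) (un n)) \<longlonglongrightarrow> bil t u u"
  unfolding bil_def
proof (intro tendsto_sum tendsto_mult assms(4))
  fix x y assume "x \<in> X" "y \<in> X"
  then show "(\<lambda>n. M (tn n) x y) \<longlonglongrightarrow> M t x y"
    by (intro continuous_on_tendsto_compose[OF cont assms(1,3)]) (use assms(2) in auto)
qed

text \<open>Compactness: orthonormal frames of the subspaces at \<open>tn n\<close> have a
  convergent subsequence. Orthonormality survives the limit, so the dimension does not drop, and the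
  inequality passes by continuity in \<open>t\<close>.\<close>

lemma nonpos_closed:
  assumes lim: "tn \<longlonglongrightarrow> t" and tn: "\<And>n. tn n \<in> {0..K}" "\<And>n. nonpos d (tn n)"
  shows "nonpos d t"
proof -
  have t: "t \<in> {0..K}" using closed_sequentially[OF closed_atLeastAtMost tn(1) lim] .
  have "\<exists>w. (\<forall>i<d. \<forall>k<d. (\<Sum>x\<in>X. w i x * w k x) = (if i = k then 1 else 0)) \<and>
      (\<forall>c. bil (tn n) (lincomb {..<d} w c) (lincomb {..<d} w c) \<le> 0)" for n
  proof -
    obtain v where v: "indep_on X {..<d} v" "\<And>c. bil (tn n) (lincomb {..<d} v c) (lincomb {..<d} v c) \<le> 0"
      using tn(2)[of n] unfolding nonpos_def by auto
    obtain C :: "nat \<Rightarrow> nat \<Rightarrow> real" where C: "\<forall>i<d. \<forall>k<d.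
      (\<Sum>x\<in>X. lincomb {..<d} v (C i) x * lincomb {..<d} v (C k) x) = (if i = k then 1 else 0)"
      using orthonormal_frame[OF finite_X v(1)] by auto
    have "bil (tn n) (lincomb {..<d} (\<lambda>i. lincomb {..<d} v (C i)) c) (lincomb {..<d} (\<lambda>i. lincomb {..<d} v (C i)) c) \<le> 0" for c
      using v(2) by (simp add: lincomb_lincomb cong: bil_cong)
    with C show ?thesis by (intro exI[of _ "\<lambda>i. lincomb {..<d} v (C i)"]) blast
  qed
  then obtain w where w: "\<And>n i k. i < d \<Longrightarrow> k < d \<Longrightarrow> (\<Sum>x\<in>X. w n i x * w n k x) = (if i = k then 1 else 0)"
    and neg: "\<And>n c. bil (tn n) (lincomb {..<d} (w n) c) (lincomb {..<d} (w n) c) \<le> 0"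
    by metis
  have "\<bar>(case p of (i, x) \<Rightarrow> w n i x)\<bar> \<le> 1" if "p \<in> {..<d} \<times> X" for p n
  proof -
    obtain i x where p: "p = (i, x)" "i < d" "x \<in> X" using \<open>p \<in> {..<d} \<times> X\<close> by auto
    have "w n i x * w n i x \<le> (\<Sum>x\<in>X. w n i x * w n i x)"
      using member_le_sum[OF p(3), of "\<lambda>x. w n i x * w n i x"] finite_X by auto
    also have "\<dots> = 1" using w p by simp
    finally show ?thesis using p by (simp add: power2_eq_square[symmetric] abs_square_le_1)
  qed
  then have "\<exists>r l. strict_mono (r :: nat \<Rightarrow> nat) \<and>
      (\<forall>p\<in>{..<d} \<times> X. (\<lambda>n. case p of (i, x) \<Rightarrow> w (r n) i x) \<longlonglongrightarrow> l p)"
    by (intro bounded_family_convergent_subsequence[of "{..<d} \<times> X" "\<lambda>n p. case p of (i, x) \<Rightarrow> w n i x" 1])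
      (use finite_X in auto)
  then obtain r l where r: "strict_mono (r :: nat \<Rightarrow> nat)"
    and l: "\<And>p. p \<in> {..<d} \<times> X \<Longrightarrow> (\<lambda>n. case p of (i, x) \<Rightarrow> w (r n) i x) \<longlonglongrightarrow> l p"
    by blast
  define z where "z i x = l (i, x)" for i x
  have z: "(\<lambda>n. w (r n) i x) \<longlonglongrightarrow> z i x" if "i < d" "x \<in> X" for i x
    using l[of "(i, x)"] that by (simp add: z_def)
  have on: "(\<Sum>x\<in>X. z i x * z k x) = (if i = k then 1 else 0)" if "i < d" "k < d" for i k
  proof (rule LIMSEQ_unique)
    show "(\<lambda>n. \<Sum>x\<in>X. w (r n) i x * w (r n) k x) \<longlonglongrightarrow> (\<Sum>x\<in>X. z i x * z k x)"
      using that by (intro tendsto_sum tendsto_mult z) auto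
    show "(\<lambda>n. \<Sum>x\<in>X. w (r n) i x * w (r n) k x) \<longlonglongrightarrow> (if i = k then 1 else 0)"
      using w that by simp
  qed
  have "indep_on X {..<d} z"
  proof (rule indep_onI)
    fix c i assume c: "\<And>x. x \<in> X \<Longrightarrow> lincomb {..<d} z c x = 0" and i: "i \<in> {..<d}"
    have "0 = (\<Sum>x\<in>X. z i x * lincomb {..<d} z c x)" using c by simp
    also have "\<dots> = (\<Sum>x\<in>X. \<Sum>j<d. c j * (z i x * z j x))"
      by (simp add: lincomb_def sum_distrib_left mult_ac)
    also have "\<dots> = (\<Sum>j<d. c j * (\<Sum>x\<in>X. z i x * z j x))"
      by (subst sum.swap) (simp add: sum_distrib_left)
    also have "\<dots> = (\<Sum>j<d. c j * (if i = j then 1 else 0))"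
      using i on by (intro sum.cong) auto
    also have "\<dots> = (\<Sum>j<d. if j = i then c j else 0)" by (intro sum.cong) auto
    also have "\<dots> = c i" using i by simp
    finally show "c i = 0" by simp
  qed
  moreover have "bil t (lincomb {..<d} z c) (lincomb {..<d} z c) \<le> 0" for c
  proof (rule LIMSEQ_le_const2)
    show "(\<lambda>n. bil ((tn \<circ> r) n) (lincomb {..<d} (w (r n)) c) (lincomb {..<d} (w (r n)) c)) \<longlonglongrightarrow>
        bil t (lincomb {..<d} z c) (lincomb {..<d} z c)"
    proof (rule tendsto_bil)
      show "(tn \<circ> r) \<longlonglongrightarrow> t" using LIMSEQ_subseq_LIMSEQ[OF lim r] .
      show "(tn \<circ> r) n \<in> {0..K}" for n using tn(1) by simp
      show "(\<lambda>n. lincomb {..<d} (w (r n)) c x) \<longlonglongrightarrow> lincomb {..<d} z c x" if "x \<in> X" for x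
        unfolding lincomb_def using that by (intro tendsto_sum tendsto_mult z) auto
    qed (rule t)
    show "\<exists>n0. \<forall>n\<ge>n0. bil ((tn \<circ> r) n) (lincomb {..<d} (w (r n)) c) (lincomb {..<d} (w (r n)) c) \<le> 0"
      using neg by auto
  qed
  ultimately show ?thesis unfolding nonpos_def by blast
qed

lemma nonpos_mono:
  assumes "nonpos d t" "e \<le> d"
  shows "nonpos e t"
proof -
  obtain v where v: "indep_on X {..<d} v" "\<And>c. bil t (lincomb {..<d} v c) (lincomb {..<d} v c) \<le> 0"
    using assms(1) unfolding nonpos_def by auto
  have "indep_on X {..<e} v" using indep_on_subset[OF v(1)] assms(2) by auto
  moreover have "bil t (lincomb {..<e} v c) (lincomb {..<e} v c) \<le> 0" for c
    using v(2)[of "\<lambda>j. if j \<in> {..<e} then c j else 0"] lincomb_mono_neutral[of "{..<d}" "{..<e}" v c] assms(2)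
    by (simp cong: bil_cong)
  ultimately show ?thesis unfolding nonpos_def by blast
qed

text \<open>If the form took a positive value on the span for every parameter below
  \<open>t\<close>, a limit of unit coefficient vectors would be a nonzero vector with a nonnegative
  value at \<open>t\<close>. Strict negativity on the compact unit sphere excludes this.\<close>

lemma negative_frame_open:
  assumes t: "0 < t" "t \<le> K"
    and neg: "\<And>c. (\<exists>i<r. c i \<noteq> 0) \<Longrightarrow> bil t (lincomb {..<r} v c) (lincomb {..<r} v c) < 0"
  shows "\<exists>t'. 0 \<le> t' \<and> t' < t \<and> nonpos r t'"
proof (rule ccontr)
  assume no: "\<not> ?thesis"
  have "indep_on X {..<r} v"
  proof (rule indep_onI)
    fix c i assume c: "\<And>x. x \<in> X \<Longrightarrow> lincomb {..<r} v c x = 0" and i: "i \<in> {..<r}"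
    have "bil t (lincomb {..<r} v c) (lincomb {..<r} v c) = 0" unfolding bil_def using c by simp
    then show "c i = 0" using neg[of c] i by force
  qed
  then have pos: "\<exists>c. bil t' (lincomb {..<r} v c) (lincomb {..<r} v c) > 0" if "0 \<le> t'" "t' < t" for t'
    using no that unfolding nonpos_def by (metis not_le)
  have ex: "\<exists>c. (\<Sum>i<r. c i * c i) = 1 \<and> bil t' (lincomb {..<r} v c) (lincomb {..<r} v c) > 0"
    if t': "0 \<le> t'" "t' < t" for t'
  proof -
    obtain c where c: "bil t' (lincomb {..<r} v c) (lincomb {..<r} v c) > 0" using pos t' by blast
    define s where "s = (\<Sum>i<r. c i * c i)"
    have "s \<noteq> 0"
    proof
      assume "s = 0"
      then have "\<forall>i\<in>{..<r}. c i = 0" unfolding s_def by (simp add: sum_nonneg_eq_0_iff)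
      then have "lincomb {..<r} v c x = 0" for x by (simp add: lincomb_def)
      then show False using c by (simp add: bil_def)
    qed
    moreover have "s \<ge> 0" unfolding s_def by (intro sum_nonneg) auto
    ultimately have s: "s > 0" by simp
    have "lincomb {..<r} v (\<lambda>i. c i / sqrt s) x = 1 / sqrt s * lincomb {..<r} v c x" for x
      by (simp add: lincomb_def sum_divide_distrib)
    then have "bil t' (lincomb {..<r} v (\<lambda>i. c i / sqrt s)) (lincomb {..<r} v (\<lambda>i. c i / sqrt s)) =
      (1 / sqrt s)\<^sup>2 * bil t' (lincomb {..<r} v c) (lincomb {..<r} v c)"
      by (simp add: bil_scale[symmetric] cong: bil_cong)
    moreover have "(\<Sum>i<r. c i / sqrt s * (c i / sqrt s)) = 1"
      using s by (simp add: sum_divide_distrib[symmetric] s_def[symmetric])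
    ultimately show ?thesis using c s by (intro exI[of _ "\<lambda>i. c i / sqrt s"]) simp
  qed
  \<comment> \<open>Starts at 0 and approaches \<open>t\<close> strictly from below, so
    \<open>ex\<close> applies to every term.\<close>
  define tn where "tn n = t * (1 - inverse (real (Suc n)))" for n
  have tn: "0 \<le> tn n" "tn n < t" for n
    unfolding tn_def using t by (auto simp: field_simps)
  have "tn \<longlonglongrightarrow> t * (1 - 0)" unfolding tn_def
    by (intro tendsto_mult tendsto_diff tendsto_const LIMSEQ_inverse_real_of_nat)
  then have lim: "tn \<longlonglongrightarrow> t" by simp
  obtain c where c: "\<And>n. (\<Sum>i<r. c n i * c n i) = 1"
      "\<And>n. bil (tn n) (lincomb {..<r} v (c n)) (lincomb {..<r} v (c n)) > 0"
    using ex[OF tn] by metis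
  have "\<bar>c n i\<bar> \<le> 1" if "i \<in> {..<r}" for n i
    using member_le_sum[OF that, of "\<lambda>i. c n i * c n i"] c(1)[of n]
    by (simp add: power2_eq_square[symmetric] abs_square_le_1)
  then have "\<exists>\<rho> l. strict_mono (\<rho> :: nat \<Rightarrow> nat) \<and> (\<forall>i\<in>{..<r}. (\<lambda>n. c (\<rho> n) i) \<longlonglongrightarrow> l i)"
    by (intro bounded_family_convergent_subsequence[of "{..<r}" c 1]) auto
  then obtain \<rho> l where \<rho>: "strict_mono (\<rho> :: nat \<Rightarrow> nat)"
    and l: "\<And>i. i \<in> {..<r} \<Longrightarrow> (\<lambda>n. c (\<rho> n) i) \<longlonglongrightarrow> l i"
    by blast
  have "(\<Sum>i<r. l i * l i) = 1"
  proof (rule LIMSEQ_unique)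
    show "(\<lambda>n. \<Sum>i<r. c (\<rho> n) i * c (\<rho> n) i) \<longlonglongrightarrow> (\<Sum>i<r. l i * l i)"
      by (intro tendsto_sum tendsto_mult l) auto
  qed (simp add: c)
  then have "\<exists>i<r. l i \<noteq> 0" by (metis (no_types, lifting) lessThan_iff mult_zero_left sum.neutral zero_neq_one)
  moreover have "0 \<le> bil t (lincomb {..<r} v l) (lincomb {..<r} v l)"
  proof (rule LIMSEQ_le_const)
    show "(\<lambda>n. bil ((tn \<circ> \<rho>) n) (lincomb {..<r} v (c (\<rho> n))) (lincomb {..<r} v (c (\<rho> n)))) \<longlonglongrightarrow>
        bil t (lincomb {..<r} v l) (lincomb {..<r} v l)"
    proof (rule tendsto_bil)
      show "(tn \<circ> \<rho>) \<longlonglongrightarrow> t" using LIMSEQ_subseq_LIMSEQ[OF lim \<rho>] .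
      show "(tn \<circ> \<rho>) n \<in> {0..K}" for n using tn[of "\<rho> n"] t by auto
      show "(\<lambda>n. lincomb {..<r} v (c (\<rho> n)) x) \<longlonglongrightarrow> lincomb {..<r} v l x" if "x \<in> X" for x
        unfolding lincomb_def using that by (intro tendsto_sum tendsto_mult l tendsto_const) auto
    qed (use t in auto)
    show "\<exists>n0. \<forall>n\<ge>n0. 0 \<le> bil ((tn \<circ> \<rho>) n) (lincomb {..<r} v (c (\<rho> n))) (lincomb {..<r} v (c (\<rho> n)))"
      using c(2) by (auto intro: less_imp_le)
  qed
  ultimately show False using neg[of l] by force
qed

text \<open>Take as many independent kernel vectors as possible inside the nonpositive subspace; a
  complement in coefficient space then meets the kernel only in 0 and can be made strictly negative.
  The vectors \<open>w\<close> may leave the given subspace, but only their number is used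
  later.\<close>

lemma nonpos_split:
  assumes "nonpos d t"
  shows "\<exists>m g r w. d \<le> r + m \<and> indep_on X {..<m::nat} g \<and> (\<forall>i<m. \<forall>x\<in>X. app t (g i) x = 0) \<and>
    (\<forall>c. (\<exists>i<r. c i \<noteq> 0) \<longrightarrow> bil t (lincomb {..<r::nat} w c) (lincomb {..<r} w c) < 0)"
proof -
  obtain v where v: "indep_on X {..<d} v" "\<And>c. bil t (lincomb {..<d} v c) (lincomb {..<d} v c) \<le> 0"
    using assms unfolding nonpos_def by auto
  define S where "S = {m. \<exists>C :: nat \<Rightarrow> nat \<Rightarrow> real. indep_on {..<d} {..<m} C \<and>
     (\<forall>i<m. \<forall>x\<in>X. app t (lincomb {..<d} v (C i)) x = 0)}"
  have bound: "m \<le> d" if "m \<in> S" for m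
    using that indep_on_card_le[of "{..<d}" "{..<m}"] by (auto simp: S_def)
  have "0 \<in> S" by (auto simp: S_def indep_on_def)
  have fS: "finite S" using bound by (meson finite_nat_set_iff_bounded_le)
  define m where "m = Max S"
  have mS: "m \<in> S" using Max_in[OF fS] \<open>0 \<in> S\<close> by (auto simp: m_def)
  then obtain C :: "nat \<Rightarrow> nat \<Rightarrow> real" where C: "indep_on {..<d} {..<m} C"
    "\<And>i x. i < m \<Longrightarrow> x \<in> X \<Longrightarrow> app t (lincomb {..<d} v (C i)) x = 0"
    by (auto simp: S_def)
  \<comment> \<open>Coefficient vectors orthogonal to all \<open>C p\<close>; at least
    \<open>d - m\<close> independent ones exist.\<close>
  obtain J and E0 :: "nat \<Rightarrow> nat \<Rightarrow> real" where J: "J \<subseteq> {..<d}" "d \<le> card J + m" "indep_on {..<d} J E0"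
    and orth0: "\<And>j p. j \<in> J \<Longrightarrow> p < m \<Longrightarrow> (\<Sum>i<d. C p i * E0 j i) = 0"
    using kernel_family[of "{..<d}" "{..<m}" C] by auto
  define r where "r = card J"
  have fJ: "finite J" using J(1) finite_subset by blast
  obtain h where h: "bij_betw h {..<r} J" using ex_bij_betw_nat_finite[OF fJ] by (auto simp: r_def atLeast0LessThan)
  define E where "E = E0 \<circ> h"
  have E: "indep_on {..<d} {..<r} E" unfolding E_def by (rule indep_on_reindex[OF J(3) h])
  have orth: "(\<Sum>i<d. C p i * E j i) = 0" if "j < r" "p < m" for j p
    using orth0[of "h j" p] that h by (auto simp: E_def bij_betw_def)
  have notker: "\<exists>x\<in>X. app t (lincomb {..<d} v (lincomb {..<r} E c)) x \<noteq> 0" if c: "\<exists>i<r. c i \<noteq> 0" for c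
  proof (rule ccontr)
    assume ker: "\<not> ?thesis"
    define e where "e = lincomb {..<r} E c"
    have e0: "\<exists>i<d. e i \<noteq> 0"
    proof (rule ccontr)
      assume "\<not> (\<exists>i<d. e i \<noteq> 0)"
      then have "c i = 0" if "i < r" for i using indep_onD[OF E, of c i] that by (auto simp: e_def)
      then show False using c by auto
    qed
    have oe: "(\<Sum>i<d. C p i * e i) = 0" if "p < m" for p
    proof -
      have "(\<Sum>i<d. C p i * e i) = (\<Sum>i<d. \<Sum>j<r. c j * (C p i * E j i))"
        unfolding e_def lincomb_def by (simp add: sum_distrib_left mult_ac)
      also have "\<dots> = (\<Sum>j<r. c j * (\<Sum>i<d. C p i * E j i))"
        by (subst sum.swap) (simp add: sum_distrib_left)
      also have "\<dots> = 0" using orth that by simp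
      finally show ?thesis .
    qed
    \<comment> \<open>Appending \<open>e\<close>, which is nonzero and orthogonal to every
      \<open>C p\<close>, would give a longer kernel family and contradict the maximality of
      \<open>m\<close>.\<close>
    define C' where "C' = C(m := e)"
    have lc: "lincomb {..<Suc m} C' b x = lincomb {..<m} C b x + b m * e x" for b x
      unfolding lincomb_def C'_def by simp
    have "indep_on {..<d} {..<Suc m} C'"
    proof (rule indep_onI)
      fix b j assume b: "\<And>x. x \<in> {..<d} \<Longrightarrow> lincomb {..<Suc m} C' b x = 0" and j: "j \<in> {..<Suc m}"
      have "0 = (\<Sum>x<d. e x * lincomb {..<Suc m} C' b x)" using b by simp
      also have "\<dots> = (\<Sum>x<d. \<Sum>i<m. b i * (C i x * e x)) + b m * (\<Sum>x<d. e x * e x)"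
        unfolding lc unfolding lincomb_def by (simp add: algebra_simps sum.distrib sum_distrib_left)
      also have "(\<Sum>x<d. \<Sum>i<m. b i * (C i x * e x)) = (\<Sum>i<m. b i * (\<Sum>x<d. C i x * e x))"
        by (subst sum.swap) (simp add: sum_distrib_left)
      also have "\<dots> = 0" using oe by simp
      finally have "b m * (\<Sum>x<d. e x * e x) = 0" by simp
      moreover have "(\<Sum>x<d. e x * e x) \<noteq> 0" using e0 by (subst sum_nonneg_eq_0_iff) auto
      ultimately have bm: "b m = 0" by simp
      then have "b i = 0" if "i < m" for i
        using b that by (intro indep_onD[OF C(1), of b i]) (auto simp: lc)
      then show "b j = 0" using bm j by (cases "j = m") auto
    qed
    moreover have "\<forall>i<Suc m. \<forall>x\<in>X. app t (lincomb {..<d} v (C' i)) x = 0"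
      using C(2) ker by (auto simp: C'_def e_def less_Suc_eq)
    ultimately have "Suc m \<in> S" by (auto simp: S_def)
    then have "Suc m \<le> m" using Max_ge[OF fS] by (simp add: m_def)
    then show False by simp
  qed
  (* Moving u to u - e (M u) with small e makes the form strictly negative unless M u = 0:
     it is then at most -2 e |M u|^2 + e^2 B |M u|^2. *)
  define B where "B = (\<Sum>x\<in>X. \<Sum>y\<in>X. \<bar>M t x y\<bar>)"
  have B: "B \<ge> 0" unfolding B_def by (intro sum_nonneg) auto
  define \<epsilon> where "\<epsilon> = 1 / (B + 1)"
  have \<epsilon>: "\<epsilon> > 0" "\<epsilon> * B < 1" using B by (auto simp: \<epsilon>_def)
  define w where "w j x = lincomb {..<d} v (E j) x - \<epsilon> * app t (lincomb {..<d} v (E j)) x" for j x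
  have "bil t (lincomb {..<r} w c) (lincomb {..<r} w c) < 0" if c: "\<exists>i<r. c i \<noteq> 0" for c
  proof -
    define u where "u = lincomb {..<d} v (lincomb {..<r} E c)"
    have u2: "u = lincomb {..<r} (\<lambda>j. lincomb {..<d} v (E j)) c"
      by (rule ext) (simp add: u_def lincomb_lincomb)
    have "lincomb {..<r} w c x = u x - \<epsilon> * app t u x" for x
    proof -
      have "app t u x = lincomb {..<r} (\<lambda>j. app t (lincomb {..<d} v (E j))) c x"
        unfolding u2 by (rule app_lincomb)
      then show ?thesis
        unfolding u2 lincomb_def[of "{..<r}"] w_def
        by (simp add: algebra_simps sum_subtractf sum_distrib_left)
    qed
    then have "bil t (lincomb {..<r} w c) (lincomb {..<r} w c)
        = bil t (\<lambda>x. u x - \<epsilon> * app t u x) (\<lambda>x. u x - \<epsilon> * app t u x)"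
      by (intro bil_cong) auto
    also have "\<dots> = bil t u u - 2 * \<epsilon> * bil t (app t u) u + \<epsilon>\<^sup>2 * bil t (app t u) (app t u)"
      by (rule bil_perturb)
    also have "bil t (app t u) u = (\<Sum>x\<in>X. app t u x * app t u x)" by (simp add: bil_app)
    also have "bil t u u - 2 * \<epsilon> * (\<Sum>x\<in>X. app t u x * app t u x) + \<epsilon>\<^sup>2 * bil t (app t u) (app t u) < 0"
    proof -
      define s where "s = (\<Sum>x\<in>X. app t u x * app t u x)"
      have "s \<noteq> 0" unfolding s_def using notker[OF c] finite_X
        by (subst sum_nonneg_eq_0_iff) (auto simp: u_def)
      moreover have "s \<ge> 0" unfolding s_def by (intro sum_nonneg) auto
      ultimately have s: "s > 0" by simp
      have "\<epsilon>\<^sup>2 * bil t (app t u) (app t u) \<le> \<epsilon>\<^sup>2 * (B * s)"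
        unfolding B_def s_def by (intro mult_left_mono bil_bound) auto
      also have "\<dots> = \<epsilon> * s * (\<epsilon> * B)" by (simp add: power2_eq_square)
      also have "\<dots> < \<epsilon> * s * 1" using \<epsilon> s by (intro mult_strict_left_mono) auto
      finally have "\<epsilon>\<^sup>2 * bil t (app t u) (app t u) < \<epsilon> * s" by simp
      moreover have "bil t u u \<le> 0" using v(2) by (simp add: u_def)
      moreover have "0 < \<epsilon> * s" using \<epsilon> s by simp
      ultimately show ?thesis unfolding s_def[symmetric] by linarith
    qed
    finally show ?thesis .
  qed
  moreover have "indep_on X {..<m} (\<lambda>i. lincomb {..<d} v (C i))" by (rule indep_on_lincomb[OF v(1) C(1)])
  ultimately show ?thesis using C(2) J(2) unfolding r_def[symmetric]
    by (intro exI[of _ m] exI[of _ "\<lambda>i. lincomb {..<d} v (C i)"] exI[of _ r] exI[of _ w]) blast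
qed

theorem kernels_of_nonpos:
  assumes "t \<in> {0..K}" "nonpos d t"
  shows "\<exists>T m. finite T \<and> T \<subseteq> {0..t} \<and> d \<le> (\<Sum>s\<in>T. m s) \<and>
    (\<forall>s\<in>T. \<exists>g. indep_on X {..<m s :: nat} g \<and> (\<forall>i<m s. \<forall>x\<in>X. app s (g i) x = 0))"
  using assms
proof (induction d arbitrary: t rule: less_induct)
  case (less d)
  (* At the smallest parameter s with a nonpositive subspace of dimension d, the strictly negative
     part has dimension less than d, because it stays nonpositive for some t' < s; the rest
     of the subspace is accounted for by the kernel at s. *)
  define A where "A = {s \<in> {0..K}. nonpos d s}"
  have tA: "t \<in> A" using less.prems by (simp add: A_def)
  have bdd: "bdd_below A" unfolding A_def by (rule bdd_belowI[of _ 0]) auto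
  define s where "s = Inf A"
  have s_le: "s \<le> a" if "a \<in> A" for a unfolding s_def using cInf_lower[OF that bdd] .
  have "s \<in> closure A" unfolding s_def using closure_contains_Inf[OF _ bdd] tA by auto
  then obtain tn where tn: "\<And>n. tn n \<in> A" "tn \<longlonglongrightarrow> s" unfolding closure_sequential by auto
  have "s \<in> A"
  proof -
    have "s \<in> {0..K}" by (rule closed_sequentially[OF closed_atLeastAtMost _ tn(2)]) (use tn(1) in \<open>auto simp: A_def\<close>)
    moreover have "nonpos d s" by (rule nonpos_closed[OF tn(2)]) (use tn(1) in \<open>auto simp: A_def\<close>)
    ultimately show ?thesis by (simp add: A_def)
  qed
  then have s: "0 \<le> s" "s \<le> K" "nonpos d s" "s \<le> t" using s_le[OF tA] by (auto simp: A_def)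
  obtain m g r w where sp: "d \<le> r + m" "indep_on X {..<m::nat} g" "\<And>i x. i < m \<Longrightarrow> x \<in> X \<Longrightarrow> app s (g i) x = 0"
    and neg: "\<And>c. (\<exists>i<r. c i \<noteq> 0) \<Longrightarrow> bil s (lincomb {..<r::nat} w c) (lincomb {..<r} w c) < 0"
    using nonpos_split[OF s(3)] by blast
  show ?case
  proof (cases "r = 0")
    case True
    then show ?thesis using sp s by (intro exI[of _ "{s}"] exI[of _ "\<lambda>_. m"]) auto
  next
    case False
    have "s \<noteq> 0"
    proof
      assume "s = 0"
      then show False using neg[of "\<lambda>_. 1"] psd0[of "lincomb {..<r} w (\<lambda>_. 1)"] False by (auto simp: bil_def)
    qed
    then obtain t' where t': "0 \<le> t'" "t' < s" "nonpos r t'"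
      using negative_frame_open[OF _ s(2) neg] s(1) by force
    have "r < d"
    proof (rule ccontr)
      assume "\<not> r < d"
      then have "t' \<in> A" using nonpos_mono[OF t'(3)] t' s by (auto simp: A_def)
      then show False using s_le t' by force
    qed
    then obtain T m' where T: "finite T" "T \<subseteq> {0..t'}" "r \<le> sum m' T"
      "\<forall>s\<in>T. \<exists>g. indep_on X {..<m' s :: nat} g \<and> (\<forall>i<m' s. \<forall>x\<in>X. app s (g i) x = 0)"
      using less.IH[OF _ _ t'(3)] t' s by auto
    \<comment> \<open>The earlier parameters lie in [0, t'] with t' < s, so no kernel is counted
      twice.\<close>
    have sT: "s \<notin> T" using T(2) t' by auto
    have "sum (m'(s := m)) (insert s T) = m + sum m' T"
      using sT T(1) by (simp add: sum.insert) (intro sum.cong, auto)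
    then have "d \<le> sum (m'(s := m)) (insert s T)" using sp(1) T(3) by simp
    moreover have "\<exists>g. indep_on X {..<(m'(s := m)) q} g \<and> (\<forall>i<(m'(s := m)) q. \<forall>x\<in>X. app q (g i) x = 0)"
      if "q \<in> insert s T" for q
      using that T(4) sp(2,3) sT by (cases "q = s") auto
    ultimately show ?thesis using T(1,2) t' s
      by (intro exI[of _ "insert s T"] exI[of _ "m'(s := m)"]) auto
  qed
qed

end

section \<open>Spanning trees and fundamental cycles\<close>


definition cycle_data :: "nat \<Rightarrow> endpoint set set \<Rightarrow> nat \<Rightarrow> (nat \<Rightarrow> nat) \<Rightarrow> (nat \<Rightarrow> endpoint set) \<Rightarrow> bool" where
  "cycle_data N V k es vs \<longleftrightarrow> 1 \<le> k \<and> inj_on es {..<k} \<and> inj_on vs {..<k} \<and>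
     (\<forall>i<k. es i < N \<and> joins V (es i) (vs i) (vs (Suc i mod k)))"

lemma is_cycle_iff: "is_cycle N V S \<longleftrightarrow> (\<exists>k es vs. cycle_data N V k es vs \<and> S = es ` {..<k})"
  unfolding is_cycle_def cycle_data_def by auto

definition adj :: "endpoint set set \<Rightarrow> nat set \<Rightarrow> (endpoint set \<times> endpoint set) set" where
  "adj V T = {(u, w). \<exists>n\<in>T. joins V n u w}"

lemma joins_sym: "joins V n u w \<longleftrightarrow> joins V n w u"
  unfolding joins_def by auto

lemma adj_mono: "S \<subseteq> T \<Longrightarrow> adj V S \<subseteq> adj V T"
  unfolding adj_def by auto

lemma partition_unique:
  assumes "partition_on A V" "u \<in> V" "w \<in> V" "p \<in> u" "p \<in> w"
  shows "u = w"
  using assms unfolding partition_on_def disjoint_def by blast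

lemma joins_unique:
  assumes V: "partition_on A V" and j: "joins V n u w" "joins V n u' w'"
  shows "{u, w} = {u', w'}"
  using j partition_unique[OF V] unfolding joins_def by (elim conjE disjE) blast+

lemma rtrancl_crosses:
  assumes "(x, y) \<in> R\<^sup>*" "x \<in> U" "y \<notin> U"
  shows "\<exists>u w. (u, w) \<in> R \<and> u \<in> U \<and> w \<notin> U"
  using assms by (induction rule: rtrancl_induct) blast+

text \<open>A path from the connected part \<open>U\<close> to a vertex outside must cross; the
  crossing edge joins \<open>T\<close> and its far end joins \<open>U\<close>. The bound
  \<open>card T < card V\<close> leaves at least \<open>N + 1 - card V\<close> edges outside
  \<open>T\<close>.\<close>

lemma spanning_edges:
  assumes fin: "finite V" and V0: "V \<noteq> {}"
    and conn: "\<And>u w. u \<in> V \<Longrightarrow> w \<in> V \<Longrightarrow> (u, w) \<in> (adj V {..<N})\<^sup>*"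
  shows "\<exists>T. T \<subseteq> {..<N} \<and> card T < card V \<and> (\<forall>u\<in>V. \<forall>w\<in>V. (u, w) \<in> (adj V T)\<^sup>*)"
proof -
  have "\<exists>U T. U \<subseteq> V \<and> card U = Suc j \<and> T \<subseteq> {..<N} \<and> card T < card U \<and>
      (\<forall>u\<in>U. \<forall>w\<in>U. (u, w) \<in> (adj V T)\<^sup>*)" if "Suc j \<le> card V" for j
    using that
  proof (induction j)
    case 0
    obtain v where "v \<in> V" using V0 by auto
    then show ?case by (intro exI[of _ "{v}"] exI[of _ "{}"]) auto
  next
    case (Suc j)
    then obtain U T where U: "U \<subseteq> V" "card U = Suc j" "T \<subseteq> {..<N}" "card T < card U"
      and c: "\<And>u w. u \<in> U \<Longrightarrow> w \<in> U \<Longrightarrow> (u, w) \<in> (adj V T)\<^sup>*" by auto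
    have fU: "finite U" using U(1) fin finite_subset by blast
    have "U \<noteq> V" using U(2) Suc.prems by auto
    then obtain y where y: "y \<in> V" "y \<notin> U" using U(1) by blast
    obtain x where x: "x \<in> U" using U(2) by fastforce
    obtain u w where uw: "(u, w) \<in> adj V {..<N}" "u \<in> U" "w \<notin> U"
      using rtrancl_crosses[OF conn[of x y] x y(2)] x y U(1) by blast
    then obtain n where n: "n < N" "joins V n u w" by (auto simp: adj_def)
    have wV: "w \<in> V" using n by (simp add: joins_def)
    let ?T = "insert n T"
    have mono: "(adj V T)\<^sup>* \<subseteq> (adj V ?T)\<^sup>*" by (intro rtrancl_mono adj_mono) auto
    have e1: "(u, w) \<in> adj V ?T" "(w, u) \<in> adj V ?T" using n joins_sym by (auto simp: adj_def)
    have "(p, q) \<in> (adj V ?T)\<^sup>*" if "p \<in> insert w U" "q \<in> insert w U" for p q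
    proof -
      have 1: "(p, u) \<in> (adj V ?T)\<^sup>*" using that(1) c[of p u] uw(2) mono e1 by blast
      have 2: "(u, q) \<in> (adj V ?T)\<^sup>*" using that(2) c[of u q] uw(2) mono e1 by blast
      show ?thesis using 1 2 by (rule rtrancl_trans)
    qed
    moreover have "card ?T \<le> Suc (card T)" by (rule card_insert_le_m1) auto
    ultimately show ?case using U wV uw fU n
      by (intro exI[of _ "insert w U"] exI[of _ ?T]) auto
  qed
  from this[of "card V - 1"] obtain U T where U: "U \<subseteq> V" "card U = card V" "T \<subseteq> {..<N}" "card T < card U"
      "\<forall>u\<in>U. \<forall>w\<in>U. (u, w) \<in> (adj V T)\<^sup>*"
    using fin V0 by (auto simp: card_gt_0_iff Suc_diff_le)
  then have "U = V" using card_subset_eq[OF fin] by blast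
  with U show ?thesis by blast
qed

text \<open>A path of minimal length repeats no vertex: cutting out the segment between two visits,
  as \<open>q\<close> does, would shorten it.\<close>

lemma simple_path:
  assumes "(x, y) \<in> R\<^sup>*"
  shows "\<exists>n p. p 0 = x \<and> p n = y \<and> (\<forall>i<n. (p i, p (Suc i)) \<in> R) \<and> inj_on p {..(n::nat)}"
proof -
  define P where "P n \<longleftrightarrow> (\<exists>p. p 0 = x \<and> p n = y \<and> (\<forall>i<n. (p i, p (Suc i)) \<in> R))" for n :: nat
  obtain n0 where "(x, y) \<in> R ^^ n0" using assms rtrancl_imp_relpow by blast
  then have "P n0" unfolding P_def relpow_fun_conv by blast
  define n where "n = (LEAST n. P n)"
  have Pn: "P n" unfolding n_def using \<open>P n0\<close> by (rule LeastI)
  then obtain p where p: "p 0 = x" "p n = y" "\<And>i. i < n \<Longrightarrow> (p i, p (Suc i)) \<in> R" by (auto simp: P_def)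
  have False if ij: "i < j" "j \<le> n" "p i = p j" for i j
  proof -
    define q where "q l = (if l \<le> i then p l else p (l + (j - i)))" for l
    have "P (n - (j - i))"
      unfolding P_def
    proof (intro exI[of _ q] conjI allI impI)
      show "q 0 = x" using p by (simp add: q_def)
      show "q (n - (j - i)) = y"
      proof (cases "n - (j - i) \<le> i")
        case True
        then have "n = j" using ij by auto
        then show ?thesis using p ij by (auto simp: q_def)
      next
        case False
        then show ?thesis using p ij by (auto simp: q_def)
      qed
      fix l assume l: "l < n - (j - i)"
      consider "l < i" | "l = i" | "l > i" by linarith
      then show "(q l, q (Suc l)) \<in> R"
      proof cases
        case 2
        then have "q l = p j" "q (Suc l) = p (Suc j)" using ij by (auto simp: q_def)
        then show ?thesis using p(3)[of j] l 2 ij by auto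
      qed (use p(3)[of l] p(3)[of "l + (j - i)"] l ij in \<open>auto simp: q_def\<close>)
    qed
    then have "n \<le> n - (j - i)" unfolding n_def by (rule Least_le)
    then show False using ij by auto
  qed
  then have "inj_on p {..n}" by (intro linorder_inj_onI) auto
  then show ?thesis using p by blast
qed

text \<open>A simple path in \<open>T\<close> between the two ends of \<open>e\<close>, closed by
  \<open>e\<close>. Its edges are distinct because an edge determines its pair of end vertices and
  the path repeats no vertex. For a loop the path is trivial and the cycle has length 1.\<close>

lemma fundamental_cycle:
  assumes V: "partition_on (endpoints N) V" and T: "T \<subseteq> {..<N}"
    and conn: "\<forall>u\<in>V. \<forall>w\<in>V. (u, w) \<in> (adj V T)\<^sup>*" and e: "e < N" "e \<notin> T"
  shows "\<exists>k es vs. cycle_data N V k es vs \<and> es ` {..<k} \<subseteq> insert e T \<and> e \<in> es ` {..<k}"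
proof -
  have "(e, False) \<in> \<Union>V" "(e, True) \<in> \<Union>V" using V e by (auto simp: partition_on_def endpoints_def)
  then obtain u w where uw: "u \<in> V" "w \<in> V" "(e, False) \<in> u" "(e, True) \<in> w" by blast
  then have ej: "joins V e w u" by (auto simp: joins_def)
  obtain n p where p: "p 0 = u" "p n = w" "\<And>i. i < n \<Longrightarrow> (p i, p (Suc i)) \<in> adj V T" "inj_on p {..n}"
    using simple_path[of u w "adj V T"] conn uw by blast
  have "\<forall>i. \<exists>m. i < n \<longrightarrow> m \<in> T \<and> joins V m (p i) (p (Suc i))" using p(3) by (auto simp: adj_def)
  then obtain f where f: "\<And>i. i < n \<Longrightarrow> f i \<in> T \<and> joins V (f i) (p i) (p (Suc i))" by metis
  \<comment> \<open>\<open>e\<close> gets the last index \<open>n\<close>, so that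
    \<open>Suc n mod Suc n\<close> leads back to \<open>p 0\<close>.\<close>
  define es where "es = f(n := e)"
  have "f i \<noteq> f j" if "i < j" "j < n" for i j
  proof
    assume "f i = f j"
    then have "{p i, p (Suc i)} = {p j, p (Suc j)}"
      using f[of i] f[of j] that joins_unique[OF V, of "f i" "p i" "p (Suc i)" "p j" "p (Suc j)"] by auto
    then have "p i = p j \<or> p i = p (Suc j)" by blast
    then show False using that inj_onD[OF p(4), of i j] inj_onD[OF p(4), of i "Suc j"] by auto
  qed
  then have "inj_on f {..<n}" by (intro linorder_inj_onI) auto
  then have "inj_on es {..<Suc n}" using f e(2) by (auto simp: es_def inj_on_def less_Suc_eq)
  moreover have "es i < N \<and> joins V (es i) (p i) (p (Suc i mod Suc n))" if "i < Suc n" for i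
    using that f[of i] T e ej p(1,2) by (cases "i = n") (auto simp: es_def)
  ultimately have "cycle_data N V (Suc n) es p"
    using p(4) by (auto simp: cycle_data_def lessThan_Suc_atMost)
  moreover have "es ` {..<Suc n} \<subseteq> insert e T" using f by (auto simp: es_def)
  moreover have "e \<in> es ` {..<Suc n}" by (auto simp: es_def image_iff)
  ultimately show ?thesis by blast
qed

text \<open>The cycles are indexed by the edges outside \<open>T\<close>. Two of them sharing an
  edge would have equal edge sets by independence, but the cycle of \<open>e\<close> contains no
  edge outside \<open>T\<close> other than \<open>e\<close>.\<close>

lemma cycle_basis:
  assumes G: "metric_graph N a b V" and C: "mg_connected N V" and I: "only_independent_cycles N V"
  shows "\<exists>(F :: nat set) k es vs. finite F \<and> N + 1 \<le> card F + card V \<and>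
     (\<forall>e\<in>F. cycle_data N V (k e) (es e) (vs e)) \<and>
     (\<forall>e\<in>F. \<forall>e'\<in>F. e \<noteq> e' \<longrightarrow> es e ` {..<k e} \<inter> es e' ` {..<k e'} = {})"
proof -
  have V: "partition_on (endpoints N) V" using G by (simp add: metric_graph_def)
  have fE: "finite (endpoints N)" by (simp add: endpoints_def)
  have fV: "finite V" using finite_elements[OF fE V] .
  have V0: "V \<noteq> {}" using G V by (auto simp: metric_graph_def partition_on_def endpoints_def)
  have "(u, w) \<in> (adj V {..<N})\<^sup>*" if "u \<in> V" "w \<in> V" for u w
    using C that unfolding mg_connected_def adj_def by (simp add: Bex_def)
  then obtain T where T: "T \<subseteq> {..<N}" "card T < card V" "\<forall>u\<in>V. \<forall>w\<in>V. (u, w) \<in> (adj V T)\<^sup>*"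
    using spanning_edges[OF fV V0] by blast
  define F where "F = {..<N} - T"
  have "\<forall>e. \<exists>k es vs. e \<in> F \<longrightarrow> cycle_data N V k es vs \<and> es ` {..<k} \<subseteq> insert e T \<and> e \<in> es ` {..<k}"
    using fundamental_cycle[OF V T(1,3)] by (auto simp: F_def)
  then obtain k es vs where c: "\<And>e. e \<in> F \<Longrightarrow> cycle_data N V (k e) (es e) (vs e)"
    "\<And>e. e \<in> F \<Longrightarrow> es e ` {..<k e} \<subseteq> insert e T" "\<And>e. e \<in> F \<Longrightarrow> e \<in> es e ` {..<k e}"
    by metis
  have cyc: "is_cycle N V (es e ` {..<k e})" if "e \<in> F" for e using c(1)[OF that] by (auto simp: is_cycle_iff)
  have "es e ` {..<k e} \<inter> es e' ` {..<k e'} = {}" if "e \<in> F" "e' \<in> F" "e \<noteq> e'" for e e'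
  proof (rule ccontr)
    assume "es e ` {..<k e} \<inter> es e' ` {..<k e'} \<noteq> {}"
    then have "es e ` {..<k e} = es e' ` {..<k e'}"
      using I cyc that unfolding only_independent_cycles_def by blast
    then have "e' \<in> insert e T" using c(2)[of e] c(3)[of e'] that by blast
    then show False using that by (auto simp: F_def)
  qed
  moreover have "N + 1 \<le> card F + card V"
  proof -
    have "card F = N - card T" unfolding F_def using T(1) finite_subset by (subst card_Diff_subset) auto
    moreover have "card T \<le> N" using card_mono[OF _ T(1)] by simp
    ultimately show ?thesis using T(2) by simp
  qed
  moreover have "finite F" by (simp add: F_def)
  ultimately show ?thesis using c(1)
    by - (rule exI[of _ F], rule exI[of _ k], rule exI[of _ es], rule exI[of _ vs], simp)
qed

section \<open>Trigonometric solutions and energy estimates\<close>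


(* The solutions of f'' = -t^2 f normalised at 0; the case t = 0 makes Sn continuous in t. *)
definition Cs :: "real \<Rightarrow> real \<Rightarrow> real" where "Cs t x = cos (t * x)"
definition Sn :: "real \<Rightarrow> real \<Rightarrow> real" where "Sn t x = (if t = 0 then x else sin (t * x) / t)"

lemma Cs_0 [simp]: "Cs t 0 = 1" and Sn_0 [simp]: "Sn t 0 = 0"
  by (auto simp: Cs_def Sn_def)

lemma Cs_minus [simp]: "Cs t (- x) = Cs t x" and Sn_minus [simp]: "Sn t (- x) = - Sn t x"
  by (auto simp: Cs_def Sn_def)

lemma Cs_add: "Cs t (x + y) = Cs t x * Cs t y - t\<^sup>2 * Sn t x * Sn t y"
  by (auto simp: Cs_def Sn_def distrib_left cos_add power2_eq_square)

lemma Sn_add: "Sn t (x + y) = Sn t x * Cs t y + Cs t x * Sn t y"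
  by (auto simp: Cs_def Sn_def distrib_left sin_add field_simps)

lemma Cs_Sn_squared: "(Cs t x)\<^sup>2 + t\<^sup>2 * (Sn t x)\<^sup>2 = 1"
  by (auto simp: Cs_def Sn_def power_divide)

lemma Sn_pos: assumes "0 \<le> t" "0 < x" "t * x < pi" shows "0 < Sn t x"
  using assms by (auto simp: Sn_def intro!: divide_pos_pos sin_gt_zero)

lemma DERIV_Cs [derivative_intros]:
  assumes "(g has_real_derivative g') (at x within S)"
  shows "((\<lambda>x. Cs t (g x)) has_real_derivative - t\<^sup>2 * Sn t (g x) * g') (at x within S)"
  unfolding Cs_def Sn_def
  by (auto intro!: derivative_eq_intros assms simp: power2_eq_square)

lemma DERIV_Sn [derivative_intros]:
  assumes "(g has_real_derivative g') (at x within S)"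
  shows "((\<lambda>x. Sn t (g x)) has_real_derivative Cs t (g x) * g') (at x within S)"
  unfolding Cs_def Sn_def
  by (cases "t = 0") (auto intro!: derivative_eq_intros assms)

lemma continuous_on_Cs_param: "continuous_on S (\<lambda>t. Cs t x)"
  unfolding Cs_def by (intro continuous_intros)

lemma continuous_on_Sn_param: "continuous_on S (\<lambda>t. Sn t x)"
proof -
  have "isCont (\<lambda>t. Sn t x) t" for t
  proof (cases "t = 0")
    case True
    \<comment> \<open>The limit of sin(t x) / t at t = 0 is the derivative of sin(t x) with respect
      to t.\<close>
    have "((\<lambda>h. (sin ((0 + h) * x) - sin (0 * x)) / h) \<longlongrightarrow> x) (at 0)"
      by (rule DERIV_D) (auto intro!: derivative_eq_intros)
    then have "((\<lambda>t. Sn t x) \<longlongrightarrow> x) (at 0)"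
      by (rule Lim_transform_eventually) (auto simp: Sn_def eventually_at_filter)
    then show ?thesis using True by (simp add: isCont_def Sn_def)
  next
    case False
    have "isCont (\<lambda>t. sin (t * x) / t) t" using False by (intro continuous_intros) auto
    moreover have "\<forall>\<^sub>F s in nhds t. sin (s * x) / s = Sn s x"
      by (rule eventually_mono[OF t1_space_nhds[OF False]]) (simp add: Sn_def)
    ultimately show ?thesis by (subst isCont_cong[symmetric])
  qed
  then show ?thesis by (simp add: continuous_at_imp_continuous_on)
qed

definition ode_on :: "real \<Rightarrow> real \<Rightarrow> real \<Rightarrow> (real \<Rightarrow> real) \<Rightarrow> (real \<Rightarrow> real) \<Rightarrow> bool" where
  "ode_on \<alpha> \<beta> lam f f' \<longleftrightarrow> (\<forall>x\<in>{\<alpha>..\<beta>}. (f has_real_derivative f' x) (at x within {\<alpha>..\<beta>}) \<and>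
     (f' has_real_derivative (- lam * f x)) (at x within {\<alpha>..\<beta>}))"

lemma edge_ode_iff:
  "edge_ode N a b lam f \<longleftrightarrow> (\<forall>n<N. ode_on (a n) (b n) lam (f n) (edge_deriv a b f n))"
  unfolding edge_ode_def ode_on_def has_real_derivative_iff_has_vector_derivative by simp

lemma edge_deriv_eq:
  assumes "a n < b n" "ode_on (a n) (b n) lam (f n) f'" "x \<in> {a n..b n}"
  shows "edge_deriv a b f n x = f' x"
  using assms unfolding edge_deriv_def ode_on_def has_real_derivative_iff_has_vector_derivative
  by (intro vector_derivative_within_closed_interval) auto

text \<open>\<open>edge_deriv\<close> is a derivative chosen by \<open>vector_derivative\<close>;
  uniqueness on a nondegenerate interval identifies it with the explicit \<open>f'\<close>, so
  concrete solutions can be checked by differentiation.\<close>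

lemma edge_odeI:
  assumes "\<And>n. n < N \<Longrightarrow> a n < b n" and f: "\<And>n. n < N \<Longrightarrow> ode_on (a n) (b n) lam (f n) (f' n)"
  shows "edge_ode N a b lam f"
  unfolding edge_ode_iff
proof (intro allI impI)
  fix n assume n: "n < N"
  have eq: "edge_deriv a b f n x = f' n x" if "x \<in> {a n..b n}" for x
    using edge_deriv_eq[of a n b lam f "f' n" x, OF assms(1)[OF n] f[OF n] that] .
  have "(edge_deriv a b f n has_real_derivative D) (at x within {a n..b n})"
    if "(f' n has_real_derivative D) (at x within {a n..b n})" "x \<in> {a n..b n}" for x D
    using has_vector_derivative_transform[OF that(2) _ that(1)[unfolded has_real_derivative_iff_has_vector_derivative]] eq
    unfolding has_real_derivative_iff_has_vector_derivative by auto
  then show "ode_on (a n) (b n) lam (f n) (edge_deriv a b f n)"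
    using f[OF n] eq unfolding ode_on_def by auto
qed

text \<open>\<open>A\<close> and \<open>B\<close> recover the initial data from
  \<open>(f, f')\<close> by the inverse fundamental matrix. Both are constant, and
  \<open>Cs_Sn_squared\<close> inverts the relation.\<close>

lemma ode_on_unique:
  assumes "ode_on \<alpha> \<beta> (t\<^sup>2) f f'" and x: "x \<in> {\<alpha>..\<beta>}"
  shows "f x = f \<alpha> * Cs t (x - \<alpha>) + f' \<alpha> * Sn t (x - \<alpha>)"
proof -
  define A where "A x = f x * Cs t (x - \<alpha>) - f' x * Sn t (x - \<alpha>)" for x
  define B where "B x = f x * t\<^sup>2 * Sn t (x - \<alpha>) + f' x * Cs t (x - \<alpha>)" for x
  have d: "(f has_real_derivative f' y) (at y within {\<alpha>..\<beta>})"
    "(f' has_real_derivative (- t\<^sup>2 * f y)) (at y within {\<alpha>..\<beta>})" if "y \<in> {\<alpha>..\<beta>}" for y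
    using assms(1) that by (auto simp: ode_on_def)
  have "(A has_real_derivative 0) (at y within {\<alpha>..\<beta>})" if "y \<in> {\<alpha>..\<beta>}" for y
    unfolding A_def using that by (auto intro!: derivative_eq_intros d simp: algebra_simps)
  then have "\<exists>c. \<forall>y\<in>{\<alpha>..\<beta>}. A y = c"
    by (intro has_field_derivative_zero_constant) auto
  then have A: "A x = A \<alpha>" using x by auto
  have "(B has_real_derivative 0) (at y within {\<alpha>..\<beta>})" if "y \<in> {\<alpha>..\<beta>}" for y
    unfolding B_def using that by (auto intro!: derivative_eq_intros d simp: algebra_simps)
  then have "\<exists>c. \<forall>y\<in>{\<alpha>..\<beta>}. B y = c"
    by (intro has_field_derivative_zero_constant) auto
  then have B: "B x = B \<alpha>" using x by auto
  have "f x = f x * ((Cs t (x - \<alpha>))\<^sup>2 + t\<^sup>2 * (Sn t (x - \<alpha>))\<^sup>2)" by (simp add: Cs_Sn_squared)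
  also have "\<dots> = A x * Cs t (x - \<alpha>) + B x * Sn t (x - \<alpha>)"
    by (simp add: A_def B_def algebra_simps power2_eq_square)
  finally show ?thesis using A B by (simp add: A_def B_def)
qed

text \<open>The left side is the energy of the solution \<open>h\<close> with the boundary values of
  \<open>f\<close>. The argument is Legendre's for the second variation; it requires a Riccati
  solution that is finite on the whole interval, which is what the bound by pi provides.\<close>

lemma riccati_bound:
  assumes "\<alpha> < \<beta>" "0 \<le> t" "t * (\<beta> - \<alpha>) < pi"
    and f: "\<And>x. x \<in> {\<alpha>..\<beta>} \<Longrightarrow> (f has_real_derivative f' x) (at x within {\<alpha>..\<beta>})"
    and f': "continuous_on {\<alpha>..\<beta>} f'"
  shows "Cs t (\<beta> - \<alpha>) / Sn t (\<beta> - \<alpha>) * ((f \<alpha>)\<^sup>2 + (f \<beta>)\<^sup>2) - 2 / Sn t (\<beta> - \<alpha>) * (f \<alpha> * f \<beta>)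
     \<le> integral {\<alpha>..\<beta>} (\<lambda>x. (f' x)\<^sup>2 - t\<^sup>2 * (f x)\<^sup>2)"
proof -
  define S where "S = Sn t (\<beta> - \<alpha>)"
  have S: "S > 0" unfolding S_def using assms by (intro Sn_pos) auto
  (* h solves h'' = -t^2 h with the boundary values of f, and w solves the Riccati equation
     w' = -t^2 - w^2. Then f'^2 - t^2 f^2 - Phi' is the square of (f' - h') - w (f - h). *)
  define h where "h x = f \<alpha> / S * Sn t (\<beta> - x) + f \<beta> / S * Sn t (x - \<alpha>)" for x
  define h' where "h' x = f \<beta> / S * Cs t (x - \<alpha>) - f \<alpha> / S * Cs t (\<beta> - x)" for x
  \<comment> \<open>Centred at the midpoint, so that the argument of \<open>tan\<close> stays
    strictly between -pi/2 and pi/2.\<close>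
  define w where "w x = - t * tan (t * (x - (\<alpha> + \<beta>) / 2))" for x
  define \<Phi> where "\<Phi> x = w x * (f x - h x)\<^sup>2 + 2 * h' x * (f x - h x) + h x * h' x" for x
  define \<Phi>' where "\<Phi>' x = (- t\<^sup>2 - (w x)\<^sup>2) * (f x - h x)\<^sup>2 + w x * (2 * (f x - h x) * (f' x - h' x)) +
    (2 * (- t\<^sup>2 * h x) * (f x - h x) + 2 * h' x * (f' x - h' x)) + (h' x * h' x + h x * (- t\<^sup>2 * h x))" for x
  have dh: "(h has_real_derivative h' x) (at x within {\<alpha>..\<beta>})" for x
    unfolding h_def h'_def using S by (auto intro!: derivative_eq_intros simp: algebra_simps)
  have dh': "(h' has_real_derivative (- t\<^sup>2 * h x)) (at x within {\<alpha>..\<beta>})" for x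
    unfolding h_def h'_def using S by (auto intro!: derivative_eq_intros simp: algebra_simps)
  have dw: "(w has_real_derivative (- t\<^sup>2 - (w x)\<^sup>2)) (at x within {\<alpha>..\<beta>})" if x: "x \<in> {\<alpha>..\<beta>}" for x
  proof -
    let ?y = "t * (x - (\<alpha> + \<beta>) / 2)"
    have "x - (\<alpha> + \<beta>) / 2 \<le> (\<beta> - \<alpha>) / 2" "- (x - (\<alpha> + \<beta>) / 2) \<le> (\<beta> - \<alpha>) / 2"
      using x by (auto simp: field_simps)
    then have "\<bar>x - (\<alpha> + \<beta>) / 2\<bar> \<le> (\<beta> - \<alpha>) / 2" by (rule abs_leI)
    then have "\<bar>?y\<bar> \<le> t * ((\<beta> - \<alpha>) / 2)"
      unfolding abs_mult using assms(2) by (simp only: abs_of_nonneg mult_left_mono)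
    then have y: "\<bar>?y\<bar> < pi / 2" using assms(3) by simp
    have c: "cos ?y > 0" using y by (intro cos_gt_zero_pi) auto
    have sec: "inverse ((cos ?y)\<^sup>2) = 1 + (tan ?y)\<^sup>2"
      using tan_sec[of ?y] c by (simp add: power_inverse)
    have alg: "- t * ((1 + T\<^sup>2) * t) = - t\<^sup>2 - (- t * T)\<^sup>2" for T :: real
      by (simp add: algebra_simps power2_eq_square)
    have "(w has_real_derivative - t * (inverse ((cos ?y)\<^sup>2) * t)) (at x within {\<alpha>..\<beta>})"
    proof -
      have "((\<lambda>x. t * (x - (\<alpha> + \<beta>) / 2)) has_real_derivative t) (at x within {\<alpha>..\<beta>})"
        by (auto intro!: derivative_eq_intros)
      then show ?thesis unfolding w_def
        using c by (intro DERIV_cmult DERIV_chain2[OF DERIV_tan]) auto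
    qed
    then show ?thesis unfolding sec alg by (simp only: w_def)
  qed
  have "(\<Phi> has_real_derivative \<Phi>' x) (at x within {\<alpha>..\<beta>})" if "x \<in> {\<alpha>..\<beta>}" for x
    unfolding \<Phi>_def \<Phi>'_def using that
    by (auto intro!: derivative_eq_intros dh dh' dw f simp: algebra_simps power2_eq_square)
  then have int: "(\<Phi>' has_integral (\<Phi> \<beta> - \<Phi> \<alpha>)) {\<alpha>..\<beta>}"
    using assms(1) by (intro fundamental_theorem_of_calculus)
      (auto simp: has_real_derivative_iff_has_vector_derivative)
  have cf: "continuous_on {\<alpha>..\<beta>} f" using f by (intro DERIV_continuous_on) auto
  have int2: "((\<lambda>x. (f' x)\<^sup>2 - t\<^sup>2 * (f x)\<^sup>2) has_integral integral {\<alpha>..\<beta>} (\<lambda>x. (f' x)\<^sup>2 - t\<^sup>2 * (f x)\<^sup>2)) {\<alpha>..\<beta>}"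
    by (intro integrable_integral integrable_continuous_real continuous_intros f' cf)
  have "\<Phi>' x \<le> (f' x)\<^sup>2 - t\<^sup>2 * (f x)\<^sup>2" for x
  proof -
    have "(f' x)\<^sup>2 - t\<^sup>2 * (f x)\<^sup>2 - \<Phi>' x = (f' x - h' x - w x * (f x - h x))\<^sup>2"
      unfolding \<Phi>'_def by (simp add: algebra_simps power2_eq_square)
    then show ?thesis using zero_le_power2[of "f' x - h' x - w x * (f x - h x)"] by linarith
  qed
  then have "\<Phi> \<beta> - \<Phi> \<alpha> \<le> integral {\<alpha>..\<beta>} (\<lambda>x. (f' x)\<^sup>2 - t\<^sup>2 * (f x)\<^sup>2)"
    by (intro has_integral_le[OF int int2]) auto
  \<comment> \<open>As \<open>h\<close> and \<open>f\<close> agree at both ends, only the summand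
    \<open>h x * h' x\<close> of \<open>\<Phi>\<close> survives there.\<close>
  moreover have "h \<alpha> = f \<alpha>" "h \<beta> = f \<beta>" using S by (auto simp: h_def S_def)
  then have "\<Phi> \<beta> - \<Phi> \<alpha> = f \<beta> * h' \<beta> - f \<alpha> * h' \<alpha>" by (simp add: \<Phi>_def)
  moreover have "\<dots> = Cs t (\<beta> - \<alpha>) / S * ((f \<alpha>)\<^sup>2 + (f \<beta>)\<^sup>2) - 2 / S * (f \<alpha> * f \<beta>)"
    by (simp add: h'_def algebra_simps power2_eq_square)
  ultimately show ?thesis unfolding S_def by simp
qed

lemma piecewise_riccati_bound:
  assumes l: "0 < l" "0 \<le> t" "t * l < pi"
    and f: "\<And>x. x \<in> {\<alpha>..\<alpha> + real m * l} \<Longrightarrow> (f has_real_derivative f' x) (at x within {\<alpha>..\<alpha> + real m * l})"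
    and f': "continuous_on {\<alpha>..\<alpha> + real m * l} f'"
  shows "(\<Sum>j<m. Cs t l / Sn t l * ((f (\<alpha> + real j * l))\<^sup>2 + (f (\<alpha> + real (Suc j) * l))\<^sup>2)
           - 2 / Sn t l * (f (\<alpha> + real j * l) * f (\<alpha> + real (Suc j) * l)))
     \<le> integral {\<alpha>..\<alpha> + real m * l} (\<lambda>x. (f' x)\<^sup>2 - t\<^sup>2 * (f x)\<^sup>2)"
  using f f'
proof (induction m)
  case 0
  then show ?case by simp
next
  case (Suc m)
  let ?x = "\<alpha> + real m * l" and ?y = "\<alpha> + real (Suc m) * l"
  have le: "\<alpha> \<le> ?x" "?x < ?y" using l by (auto simp: algebra_simps)
  have sub: "{\<alpha>..?x} \<subseteq> {\<alpha>..?y}" "{?x..?y} \<subseteq> {\<alpha>..?y}" using le by auto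
  have d: "(f has_real_derivative f' x) (at x within A)" if "A \<subseteq> {\<alpha>..?y}" "x \<in> A" for x A
    using DERIV_subset[OF Suc.prems(1) that(1)] that by blast
  have c': "continuous_on A f'" if "A \<subseteq> {\<alpha>..?y}" for A
    using continuous_on_subset[OF Suc.prems(2) that] .
  have cf: "continuous_on {\<alpha>..?y} f" using Suc.prems(1) by (intro DERIV_continuous_on) auto
  have yx: "?y - ?x = l" by (simp add: algebra_simps)
  have 1: "(\<Sum>j<m. Cs t l / Sn t l * ((f (\<alpha> + real j * l))\<^sup>2 + (f (\<alpha> + real (Suc j) * l))\<^sup>2)
           - 2 / Sn t l * (f (\<alpha> + real j * l) * f (\<alpha> + real (Suc j) * l)))
     \<le> integral {\<alpha>..?x} (\<lambda>x. (f' x)\<^sup>2 - t\<^sup>2 * (f x)\<^sup>2)"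
    by (intro Suc.IH d c') (use sub in auto)
  have 2: "Cs t l / Sn t l * ((f ?x)\<^sup>2 + (f ?y)\<^sup>2) - 2 / Sn t l * (f ?x * f ?y)
     \<le> integral {?x..?y} (\<lambda>x. (f' x)\<^sup>2 - t\<^sup>2 * (f x)\<^sup>2)"
    using riccati_bound[of ?x ?y t f f'] le l d[OF sub(2)] c'[OF sub(2)] by (simp only: yx)
  have 3: "integral {\<alpha>..?x} (\<lambda>x. (f' x)\<^sup>2 - t\<^sup>2 * (f x)\<^sup>2) + integral {?x..?y} (\<lambda>x. (f' x)\<^sup>2 - t\<^sup>2 * (f x)\<^sup>2)
     = integral {\<alpha>..?y} (\<lambda>x. (f' x)\<^sup>2 - t\<^sup>2 * (f x)\<^sup>2)"
    using le by (intro Henstock_Kurzweil_Integration.integral_combine integrable_continuous_real continuous_intros cf Suc.prems(2)) auto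
  show ?case unfolding sum.lessThan_Suc using 1 2 3 by linarith
qed

section \<open>Energy, inner product and Green's formula on the edges\<close>

definition edge_C1 :: "nat \<Rightarrow> (nat \<Rightarrow> real) \<Rightarrow> (nat \<Rightarrow> real) \<Rightarrow> (nat \<Rightarrow> real \<Rightarrow> real) \<Rightarrow> (nat \<Rightarrow> real \<Rightarrow> real) \<Rightarrow> bool" where
  "edge_C1 N a b f f' \<longleftrightarrow> (\<forall>n<N. (\<forall>x\<in>{a n..b n}. (f n has_real_derivative f' n x) (at x within {a n..b n})) \<and>
     continuous_on {a n..b n} (f' n))"

definition energy :: "nat \<Rightarrow> (nat \<Rightarrow> real) \<Rightarrow> (nat \<Rightarrow> real) \<Rightarrow> real \<Rightarrow> (nat \<Rightarrow> real \<Rightarrow> real) \<Rightarrow> (nat \<Rightarrow> real \<Rightarrow> real) \<Rightarrow> real" where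
  "energy N a b mu f f' = (\<Sum>n<N. integral {a n..b n} (\<lambda>x. (f' n x)\<^sup>2 - mu * (f n x)\<^sup>2))"

definition l2_inner :: "nat \<Rightarrow> (nat \<Rightarrow> real) \<Rightarrow> (nat \<Rightarrow> real) \<Rightarrow> (nat \<Rightarrow> real \<Rightarrow> real) \<Rightarrow> (nat \<Rightarrow> real \<Rightarrow> real) \<Rightarrow> real" where
  "l2_inner N a b f g = (\<Sum>n<N. integral {a n..b n} (\<lambda>x. f n x * g n x))"

text \<open>The boundary term left when f' g' is integrated by parts.\<close>

definition boundary_form :: "nat \<Rightarrow> (nat \<Rightarrow> real) \<Rightarrow> (nat \<Rightarrow> real) \<Rightarrow> (nat \<Rightarrow> real \<Rightarrow> real) \<Rightarrow> (nat \<Rightarrow> real \<Rightarrow> real) \<Rightarrow> real" where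
  "boundary_form N a b f g = (\<Sum>n<N. edge_deriv a b f n (b n) * g n (b n) - edge_deriv a b f n (a n) * g n (a n))"

definition edge_cont :: "nat \<Rightarrow> (nat \<Rightarrow> real) \<Rightarrow> (nat \<Rightarrow> real) \<Rightarrow> (nat \<Rightarrow> real \<Rightarrow> real) \<Rightarrow> bool" where
  "edge_cont N a b f \<longleftrightarrow> (\<forall>n<N. continuous_on {a n..b n} (f n))"

lemma edge_ode_C1: "edge_ode N a b lam f \<Longrightarrow> edge_C1 N a b f (edge_deriv a b f)"
  unfolding edge_ode_iff ode_on_def edge_C1_def by (auto intro!: DERIV_continuous_on)

lemma edge_C1_cont: "edge_C1 N a b f f' \<Longrightarrow> edge_cont N a b f \<and> edge_cont N a b f'"
  unfolding edge_C1_def edge_cont_def by (auto intro!: DERIV_continuous_on)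

lemma edge_C1_sum:
  assumes "\<And>i. i \<in> I \<Longrightarrow> edge_C1 N a b (g i) (g' i)"
  shows "edge_C1 N a b (\<lambda>n x. \<Sum>i\<in>I. c i * g i n x) (\<lambda>n x. \<Sum>i\<in>I. c i * g' i n x)"
  using assms unfolding edge_C1_def
  by (auto intro!: DERIV_sum DERIV_cmult continuous_intros)

lemma edge_cont_sum:
  assumes "\<And>i. i \<in> I \<Longrightarrow> edge_cont N a b (g i)"
  shows "edge_cont N a b (\<lambda>n x. \<Sum>i\<in>I. c i * g i n x)"
  using assms unfolding edge_cont_def by (auto intro!: continuous_intros)

lemma l2_inner_commute: "l2_inner N a b f g = l2_inner N a b g f"
  unfolding l2_inner_def by (simp add: mult.commute)

lemma l2_inner_sum_right:
  assumes "edge_cont N a b f" "finite I" "\<And>i. i \<in> I \<Longrightarrow> edge_cont N a b (g i)"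
  shows "l2_inner N a b f (\<lambda>n x. \<Sum>i\<in>I. c i * g i n x) = (\<Sum>i\<in>I. c i * l2_inner N a b f (g i))"
proof -
  have "integral {a n..b n} (\<lambda>x. f n x * (\<Sum>i\<in>I. c i * g i n x)) = (\<Sum>i\<in>I. c i * integral {a n..b n} (\<lambda>x. f n x * g i n x))"
    if "n < N" for n
  proof -
    have "integral {a n..b n} (\<lambda>x. f n x * (\<Sum>i\<in>I. c i * g i n x)) = integral {a n..b n} (\<lambda>x. \<Sum>i\<in>I. c i * (f n x * g i n x))"
      by (simp add: sum_distrib_left mult_ac)
    also have "\<dots> = (\<Sum>i\<in>I. integral {a n..b n} (\<lambda>x. c i * (f n x * g i n x)))"
      using assms that unfolding edge_cont_def
      by (intro integral_sum integrable_continuous_real continuous_intros) auto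
    finally show ?thesis by simp
  qed
  then have "l2_inner N a b f (\<lambda>n x. \<Sum>i\<in>I. c i * g i n x) = (\<Sum>n<N. \<Sum>i\<in>I. c i * integral {a n..b n} (\<lambda>x. f n x * g i n x))"
    unfolding l2_inner_def by simp
  also have "\<dots> = (\<Sum>i\<in>I. c i * l2_inner N a b f (g i))"
    unfolding l2_inner_def by (subst sum.swap) (simp add: sum_distrib_left)
  finally show ?thesis .
qed

lemma l2_inner_sum_sum:
  assumes "finite I" "\<And>i. i \<in> I \<Longrightarrow> edge_cont N a b (g i)"
  shows "l2_inner N a b (\<lambda>n x. \<Sum>i\<in>I. c i * g i n x) (\<lambda>n x. \<Sum>i\<in>I. c i * g i n x) =
     (\<Sum>i\<in>I. \<Sum>j\<in>I. c i * c j * l2_inner N a b (g i) (g j))"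
proof -
  have "l2_inner N a b (\<lambda>n x. \<Sum>i\<in>I. c i * g i n x) (\<lambda>n x. \<Sum>i\<in>I. c i * g i n x) =
      (\<Sum>j\<in>I. c j * l2_inner N a b (g j) (\<lambda>n x. \<Sum>i\<in>I. c i * g i n x))"
    by (subst l2_inner_sum_right[OF edge_cont_sum]) (use assms in \<open>auto simp: l2_inner_commute\<close>)
  also have "\<dots> = (\<Sum>j\<in>I. c j * (\<Sum>i\<in>I. c i * l2_inner N a b (g j) (g i)))"
    using assms by (intro sum.cong refl) (simp add: l2_inner_sum_right)
  finally show ?thesis by (simp add: sum_distrib_left mult_ac)
qed

lemma energy_eq_l2_inner:
  assumes "edge_C1 N a b f f'"
  shows "energy N a b mu f f' = l2_inner N a b f' f' - mu * l2_inner N a b f f"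
proof -
  have c: "edge_cont N a b f" "edge_cont N a b f'" using edge_C1_cont[OF assms] by auto
  have "integral {a n..b n} (\<lambda>x. (f' n x)\<^sup>2 - mu * (f n x)\<^sup>2) =
     integral {a n..b n} (\<lambda>x. f' n x * f' n x) - mu * integral {a n..b n} (\<lambda>x. f n x * f n x)" if "n < N" for n
  proof -
    have "integral {a n..b n} (\<lambda>x. f' n x * f' n x - mu * (f n x * f n x)) =
       integral {a n..b n} (\<lambda>x. f' n x * f' n x) - integral {a n..b n} (\<lambda>x. mu * (f n x * f n x))"
      using c that unfolding edge_cont_def
      by (intro integral_diff integrable_continuous_real continuous_intros) auto
    then show ?thesis by (simp add: power2_eq_square)
  qed
  then show ?thesis unfolding energy_def l2_inner_def by (simp add: sum_subtractf sum_distrib_left)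
qed

lemma integral_square_nonneg: "0 \<le> integral S (\<lambda>x. f x * f x :: real)"
  by (cases "(\<lambda>x. f x * f x) integrable_on S") (auto simp: not_integrable_integral intro: integral_nonneg)

lemma l2_inner_self_nonneg: "0 \<le> l2_inner N a b f f"
  unfolding l2_inner_def by (intro sum_nonneg integral_square_nonneg)

lemma l2_inner_self_le_0:
  assumes "\<And>n. n < N \<Longrightarrow> a n < b n" "edge_cont N a b f" "l2_inner N a b f f \<le> 0" "n < N" "x \<in> {a n..b n}"
  shows "f n x = 0"
proof -
  have nn: "0 \<le> integral {a n..b n} (\<lambda>x. f n x * f n x)" for n
    by (rule integral_square_nonneg)
  have "l2_inner N a b f f = 0" using assms(3) l2_inner_self_nonneg by (simp add: order_antisym)
  then have "integral {a n..b n} (\<lambda>x. f n x * f n x) = 0"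
    using assms(4) nn unfolding l2_inner_def by (subst (asm) sum_nonneg_eq_0_iff) auto
  moreover have "continuous_on {a n..b n} (\<lambda>x. f n x * f n x)"
    using assms(2,4) by (auto simp: edge_cont_def intro!: continuous_intros)
  ultimately have "\<forall>x\<in>{a n..b n}. f n x * f n x = 0"
    using integral_eq_0_iff[of "a n" "b n" "\<lambda>x. f n x * f n x"] assms(1)[OF assms(4)] by auto
  then show ?thesis using assms(5) by auto
qed

text \<open>Green's formula: the derivative of f' g is f' g' - lam f g.\<close>

lemma l2_inner_deriv:
  assumes le: "\<And>n. n < N \<Longrightarrow> a n < b n" and f: "edge_ode N a b lam f" and g: "edge_ode N a b lam' g"
  shows "l2_inner N a b (edge_deriv a b f) (edge_deriv a b g) = boundary_form N a b f g + lam * l2_inner N a b f g"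
proof -
  have "integral {a n..b n} (\<lambda>x. edge_deriv a b f n x * edge_deriv a b g n x) =
     edge_deriv a b f n (b n) * g n (b n) - edge_deriv a b f n (a n) * g n (a n) + lam * integral {a n..b n} (\<lambda>x. f n x * g n x)"
    if n: "n < N" for n
  proof -
    let ?f' = "edge_deriv a b f n" and ?g' = "edge_deriv a b g n"
    have df: "(f n has_real_derivative ?f' x) (at x within {a n..b n})"
      "(?f' has_real_derivative - lam * f n x) (at x within {a n..b n})"
      "(g n has_real_derivative ?g' x) (at x within {a n..b n})" if "x \<in> {a n..b n}" for x
      using f g n that by (auto simp: edge_ode_iff ode_on_def)
    have c: "continuous_on {a n..b n} (f n)" "continuous_on {a n..b n} ?f'" "continuous_on {a n..b n} (g n)"
      "continuous_on {a n..b n} ?g'"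
      using edge_C1_cont[OF edge_ode_C1[OF f]] edge_C1_cont[OF edge_ode_C1[OF g]] n by (auto simp: edge_cont_def)
    have "((\<lambda>x. ?f' x * ?g' x - lam * (f n x * g n x)) has_integral (?f' (b n) * g n (b n) - ?f' (a n) * g n (a n))) {a n..b n}"
    proof (rule fundamental_theorem_of_calculus)
      show "a n \<le> b n" using le[OF n] by simp
      show "((\<lambda>x. ?f' x * g n x) has_vector_derivative ?f' x * ?g' x - lam * (f n x * g n x)) (at x within {a n..b n})"
        if "x \<in> {a n..b n}" for x
        unfolding has_real_derivative_iff_has_vector_derivative[symmetric]
        using that by (auto intro!: derivative_eq_intros df)
    qed
    then have "integral {a n..b n} (\<lambda>x. ?f' x * ?g' x - lam * (f n x * g n x)) = ?f' (b n) * g n (b n) - ?f' (a n) * g n (a n)"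
      by (rule integral_unique)
    moreover have "integral {a n..b n} (\<lambda>x. ?f' x * ?g' x - lam * (f n x * g n x)) =
       integral {a n..b n} (\<lambda>x. ?f' x * ?g' x) - integral {a n..b n} (\<lambda>x. lam * (f n x * g n x))"
      by (intro integral_diff integrable_continuous_real continuous_intros c)
    ultimately show ?thesis by simp
  qed
  then show ?thesis unfolding l2_inner_def boundary_form_def by (simp add: sum.distrib sum_subtractf sum_distrib_left)
qed

text \<open>Vertex conditions enter only through vanishing boundary terms. The locale therefore
  covers eigenfunctions of L^st as well as the test functions, which live on the cut graph.\<close>

locale eigenfamily =
  fixes N :: nat and a b :: "nat \<Rightarrow> real" and I :: "'i set" and lam :: "'i \<Rightarrow> real" and g :: "'i \<Rightarrow> nat \<Rightarrow> real \<Rightarrow> real"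
  assumes len: "\<And>n. n < N \<Longrightarrow> a n < b n" and fin: "finite I"
    and ode: "\<And>i. i \<in> I \<Longrightarrow> edge_ode N a b (lam i) (g i)"
    and boundary_form_0: "\<And>i j. i \<in> I \<Longrightarrow> j \<in> I \<Longrightarrow> boundary_form N a b (g i) (g j) = 0"
begin

lemma orth: assumes "i \<in> I" "j \<in> I" "lam i \<noteq> lam j" shows "l2_inner N a b (g i) (g j) = 0"
proof -
  have "lam i * l2_inner N a b (g i) (g j) = lam j * l2_inner N a b (g i) (g j)"
    using l2_inner_deriv[OF len ode[OF assms(1)] ode[OF assms(2)]] l2_inner_deriv[OF len ode[OF assms(2)] ode[OF assms(1)]] boundary_form_0 assms
    by (simp add: l2_inner_commute)
  then show ?thesis using assms(3) by simp
qed

lemma C1: "i \<in> I \<Longrightarrow> edge_C1 N a b (g i) (edge_deriv a b (g i))"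
  using ode edge_ode_C1 by blast

lemma cont: "i \<in> I \<Longrightarrow> edge_cont N a b (g i)" "i \<in> I \<Longrightarrow> edge_cont N a b (edge_deriv a b (g i))"
  using edge_C1_cont C1 by blast+

lemma energy_nonpos:
  assumes mu: "\<And>i. i \<in> I \<Longrightarrow> lam i \<le> mu"
  shows "energy N a b mu (\<lambda>n x. \<Sum>i\<in>I. c i * g i n x) (\<lambda>n x. \<Sum>i\<in>I. c i * edge_deriv a b (g i) n x) \<le> 0"
proof -
  have "energy N a b mu (\<lambda>n x. \<Sum>i\<in>I. c i * g i n x) (\<lambda>n x. \<Sum>i\<in>I. c i * edge_deriv a b (g i) n x)
    = (\<Sum>i\<in>I. \<Sum>j\<in>I. c i * c j * (l2_inner N a b (edge_deriv a b (g i)) (edge_deriv a b (g j)) - mu * l2_inner N a b (g i) (g j)))"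
    by (subst energy_eq_l2_inner[OF edge_C1_sum[OF C1]])
      (simp_all add: l2_inner_sum_sum fin cont sum_subtractf sum_distrib_left algebra_simps)
  (* By orthogonality only the terms with lam i = lam j survive, so lam i - mu may be split
     symmetrically; this exhibits the energy as minus a square norm. *)
  also have "\<dots> = (\<Sum>i\<in>I. \<Sum>j\<in>I. - ((c i * sqrt (mu - lam i)) * (c j * sqrt (mu - lam j)) * l2_inner N a b (g i) (g j)))"
  proof (intro sum.cong refl)
    fix i j assume ij: "i \<in> I" "j \<in> I"
    have "l2_inner N a b (edge_deriv a b (g i)) (edge_deriv a b (g j)) = lam i * l2_inner N a b (g i) (g j)"
      using l2_inner_deriv[OF len ode ode] boundary_form_0 ij by simp
    moreover have "sqrt (mu - lam i) * sqrt (mu - lam i) = mu - lam i" using mu[OF ij(1)] by simp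
    ultimately show "c i * c j * (l2_inner N a b (edge_deriv a b (g i)) (edge_deriv a b (g j)) - mu * l2_inner N a b (g i) (g j)) =
      - ((c i * sqrt (mu - lam i)) * (c j * sqrt (mu - lam j)) * l2_inner N a b (g i) (g j))"
      using orth[OF ij] by (cases "lam i = lam j") (simp_all add: algebra_simps)
  qed
  also have "\<dots> = - l2_inner N a b (\<lambda>n x. \<Sum>i\<in>I. (c i * sqrt (mu - lam i)) * g i n x) (\<lambda>n x. \<Sum>i\<in>I. (c i * sqrt (mu - lam i)) * g i n x)"
    by (simp add: l2_inner_sum_sum fin cont sum_negf)
  also have "\<dots> \<le> 0" using l2_inner_self_nonneg by simp
  finally show ?thesis .
qed

text \<open>Components for different eigenvalues are orthogonal, so the square norm of the component
  at \<open>r\<close> is a combination of inner products with the whole sum, which vanishes.\<close>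

lemma component_zero:
  assumes z: "\<And>n x. n < N \<Longrightarrow> x \<in> {a n..b n} \<Longrightarrow> (\<Sum>i\<in>I. c i * g i n x) = 0"
    and n: "n < N" "x \<in> {a n..b n}"
  shows "(\<Sum>i\<in>{i\<in>I. lam i = r}. c i * g i n x) = 0"
proof (rule l2_inner_self_le_0[of N a b "\<lambda>n x. \<Sum>i\<in>{i\<in>I. lam i = r}. c i * g i n x" n x, OF len _ _ n])
  let ?J = "{i\<in>I. lam i = r}"
  show "edge_cont N a b (\<lambda>n x. \<Sum>i\<in>?J. c i * g i n x)" by (intro edge_cont_sum cont) auto
  have "l2_inner N a b (\<lambda>n x. \<Sum>i\<in>?J. c i * g i n x) (\<lambda>n x. \<Sum>i\<in>?J. c i * g i n x) =
     (\<Sum>i\<in>?J. c i * (\<Sum>j\<in>?J. c j * l2_inner N a b (g i) (g j)))"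
    by (subst l2_inner_sum_sum) (use fin cont in \<open>auto simp: sum_distrib_left mult_ac\<close>)
  also have "\<dots> = (\<Sum>i\<in>?J. c i * (\<Sum>j\<in>I. c j * l2_inner N a b (g i) (g j)))"
  proof (intro sum.cong refl)
    fix i assume i: "i \<in> ?J"
    have "(\<Sum>j\<in>?J. c j * l2_inner N a b (g i) (g j)) = (\<Sum>j\<in>I. c j * l2_inner N a b (g i) (g j))"
    proof (rule sum.mono_neutral_left[OF fin], blast, rule ballI)
      fix j assume "j \<in> I - ?J"
      then show "c j * l2_inner N a b (g i) (g j) = 0" using orth[of i j] i by auto
    qed
    then show "c i * (\<Sum>j\<in>?J. c j * l2_inner N a b (g i) (g j)) = c i * (\<Sum>j\<in>I. c j * l2_inner N a b (g i) (g j))" by simp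
  qed
  also have "\<dots> = (\<Sum>i\<in>?J. c i * l2_inner N a b (g i) (\<lambda>n x. \<Sum>j\<in>I. c j * g j n x))"
    by (intro sum.cong refl) (simp add: l2_inner_sum_right fin cont)
  also have "\<dots> = 0"
  proof (intro sum.neutral ballI)
    fix i
    have "integral {a m..b m} (\<lambda>x. g i m x * (\<Sum>j\<in>I. c j * g j m x)) = integral {a m..b m} (\<lambda>x. 0)" if "m < N" for m
      using z[OF that] by (intro integral_cong) auto
    then show "c i * l2_inner N a b (g i) (\<lambda>n x. \<Sum>j\<in>I. c j * g j n x) = 0" unfolding l2_inner_def by simp
  qed
  finally show "l2_inner N a b (\<lambda>n x. \<Sum>i\<in>?J. c i * g i n x) (\<lambda>n x. \<Sum>i\<in>?J. c i * g i n x) \<le> 0" by simp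
qed

end

section \<open>The subdivided graph\<close>


text \<open>\<open>Inl v\<close> is an original vertex, \<open>Inr (e, j)\<close> the
  \<open>j\<close>-th inner division point of edge \<open>e\<close>.\<close>

type_synonym node = "endpoint set + nat \<times> nat"

definition kron :: "'x \<Rightarrow> 'x \<Rightarrow> real" where "kron x u = (if x = u then 1 else 0)"

lemma sum_kron: "finite X \<Longrightarrow> x \<in> X \<Longrightarrow> (\<Sum>u\<in>X. kron x u * f u) = f x"
proof -
  assume "finite X" "x \<in> X"
  have "(\<Sum>u\<in>X. kron x u * f u) = (\<Sum>u\<in>X. if x = u then f u else 0)"
    by (intro sum.cong) (auto simp: kron_def)
  then show ?thesis using \<open>finite X\<close> \<open>x \<in> X\<close> by simp
qed

definition vert :: "endpoint set set \<Rightarrow> endpoint \<Rightarrow> endpoint set" where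
  "vert V p = (THE v. v \<in> V \<and> p \<in> v)"

lemma vert_eq: "partition_on A V \<Longrightarrow> v \<in> V \<Longrightarrow> p \<in> v \<Longrightarrow> vert V p = v"
  unfolding vert_def by (rule the_equality) (use partition_unique[of A V] in blast)+

lemma vert_mem: "partition_on A V \<Longrightarrow> p \<in> A \<Longrightarrow> vert V p \<in> V \<and> p \<in> vert V p"
  using vert_eq by (metis UnionE partition_onD1)

locale mgraph =
  fixes N :: nat and a b :: "nat \<Rightarrow> real" and V :: "endpoint set set"
  assumes graph: "metric_graph N a b V"
begin

lemma len: "n < N \<Longrightarrow> a n < b n" and part: "partition_on (endpoints N) V"
  using graph by (auto simp: metric_graph_def)

lemma finite_endpoints: "finite (endpoints N)" by (simp add: endpoints_def)

lemma finite_V: "finite V" using finite_elements[OF finite_endpoints part] .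

lemma vertI: "n < N \<Longrightarrow> vert V (n, s) \<in> V" "n < N \<Longrightarrow> (n, s) \<in> vert V (n, s)"
  using vert_mem[OF part] by (auto simp: endpoints_def)

lemma vertex_nonempty: "v \<in> V \<Longrightarrow> \<exists>n s. n < N \<and> (n, s) \<in> v \<and> vert V (n, s) = v"
proof -
  assume v: "v \<in> V"
  then obtain p where p: "p \<in> v" using part by (metis all_not_in_conv partition_onD3)
  then have "p \<in> endpoints N" using v part by (auto simp: partition_on_def)
  then show ?thesis using p vert_eq[OF part v p] by (cases p) (auto simp: endpoints_def)
qed

lemma sum_endpoints: "(\<Sum>p\<in>endpoints N. f p) = (\<Sum>n<N. f (n, False) + f (n, True))"
proof -
  have "(\<Sum>p\<in>endpoints N. f p) = (\<Sum>(n, s)\<in>{..<N} \<times> UNIV. f (n, s))"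
    unfolding endpoints_def by (intro sum.cong) auto
  also have "\<dots> = (\<Sum>n<N. \<Sum>s\<in>UNIV. f (n, s))" by (rule sum.cartesian_product[symmetric])
  finally show ?thesis by (simp add: UNIV_bool)
qed

lemma sum_vertices: "(\<Sum>v\<in>V. \<Sum>p\<in>v. f p) = (\<Sum>n<N. f (n, False) + f (n, True))"
proof -
  have "(\<Sum>p\<in>\<Union>V. f p) = (\<Sum>v\<in>V. \<Sum>p\<in>v. f p)"
    using part finite_endpoints
    by (intro sum.Union_disjoint[unfolded o_def, THEN trans])
       (auto simp: partition_on_def disjoint_def intro: finite_subset)
  then show ?thesis using part sum_endpoints[of f] by (simp add: partition_on_def)
qed

lemma sum_vertex:
  assumes "v \<in> V"
  shows "(\<Sum>p\<in>v. f p) = (\<Sum>n<N. kron (vert V (n, False)) v * f (n, False) + kron (vert V (n, True)) v * f (n, True))"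
proof -
  have "(\<Sum>p\<in>v. f p) = (\<Sum>p\<in>endpoints N. kron (vert V p) v * f p)"
  proof (rule sum.mono_neutral_cong_left[OF finite_endpoints])
    show "v \<subseteq> endpoints N" using assms part by (auto simp: partition_on_def)
    show "\<forall>p\<in>endpoints N - v. kron (vert V p) v * f p = 0"
      using vert_mem[OF part] by (auto simp: kron_def)
    show "\<And>p. p \<in> v \<Longrightarrow> f p = kron (vert V p) v * f p"
      using vert_eq[OF part assms] by (simp add: kron_def)
  qed
  then show ?thesis by (simp add: sum_endpoints)
qed

lemma boundary_form_eq: "boundary_form N a b f g = - (\<Sum>n<N. normal_der a b f (n, False) * end_val a b g (n, False)
     + normal_der a b f (n, True) * end_val a b g (n, True))"
  unfolding boundary_form_def normal_der_def end_val_def sum_negf[symmetric] by (intro sum.cong) auto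

text \<open>At each vertex the common value of \<open>g\<close> factors out of the Kirchhoff sum of
  \<open>f\<close>.\<close>

lemma boundary_form_std:
  assumes f: "std_sol N a b V lam f" and g: "std_sol N a b V lam' g"
  shows "boundary_form N a b f g = 0"
proof -
  have "(\<Sum>p\<in>v. normal_der a b f p * end_val a b g p) = 0" if v: "v \<in> V" for v
  proof -
    obtain q where "q \<in> v" using vertex_nonempty[OF v] by auto
    have "(\<Sum>p\<in>v. normal_der a b f p * end_val a b g p) = (\<Sum>p\<in>v. normal_der a b f p * end_val a b g q)"
    proof (intro sum.cong refl)
      fix p assume "p \<in> v"
      then have "end_val a b g p = end_val a b g q" using g v \<open>q \<in> v\<close> unfolding std_sol_def by blast
      then show "normal_der a b f p * end_val a b g p = normal_der a b f p * end_val a b g q" by simp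
    qed
    also have "\<dots> = 0" using f v unfolding std_sol_def by (simp add: sum_distrib_right[symmetric])
    finally show ?thesis .
  qed
  then show ?thesis
    unfolding boundary_form_eq sum_vertices[of "\<lambda>p. normal_der a b f p * end_val a b g p", symmetric] by simp
qed

end

(* Every edge is divided into m pieces. The margin K + 1 instead of K makes the energy at K
   strictly positive on nonzero functions that vanish at all division points. *)
locale subdivided = mgraph +
  fixes K :: real and m :: nat
  assumes K: "0 \<le> K" and m: "0 < m" and fine: "\<And>n. n < N \<Longrightarrow> (K + 1) * ((b n - a n) / real m) < pi"
begin

definition l :: "nat \<Rightarrow> real" where "l n = (b n - a n) / real m"

lemma l_pos: "n < N \<Longrightarrow> 0 < l n" using len m by (simp add: l_def)

lemma ml: "a n + real m * l n = b n" using m by (simp add: l_def)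

lemma tl_less: assumes "n < N" "t \<le> K + 1" shows "t * l n < pi"
proof -
  have "t * l n \<le> (K + 1) * l n" using assms l_pos[of n] by (intro mult_right_mono) auto
  also have "\<dots> < pi" using fine[OF assms(1)] by (simp add: l_def)
  finally show ?thesis .
qed

lemma Sn_l: "n < N \<Longrightarrow> 0 \<le> t \<Longrightarrow> t \<le> K + 1 \<Longrightarrow> 0 < Sn t (l n)"
  by (rule Sn_pos[OF _ l_pos tl_less])

definition node_of :: "nat \<Rightarrow> nat \<Rightarrow> node" where
  "node_of e j = (if j = 0 then Inl (vert V (e, False)) else if j = m then Inl (vert V (e, True)) else Inr (e, j))"

definition X :: "node set" where "X = Inl ` V \<union> Inr ` ({..<N} \<times> {1..<m})"

(* The minimal energy of a piece with boundary values y, y' is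
   link_diag * (y^2 + y'^2) - 2 * link_off * y * y'; M is the matrix of the sum over all pieces. *)
definition link_diag :: "real \<Rightarrow> nat \<Rightarrow> real" where "link_diag t e = Cs t (l e) / Sn t (l e)"
definition link_off :: "real \<Rightarrow> nat \<Rightarrow> real" where "link_off t e = 1 / Sn t (l e)"

definition M :: "real \<Rightarrow> node \<Rightarrow> node \<Rightarrow> real" where
  "M t u w = (\<Sum>e<N. \<Sum>j<m. link_diag t e * (kron (node_of e j) u * kron (node_of e j) w + kron (node_of e (Suc j)) u * kron (node_of e (Suc j)) w)
     - link_off t e * (kron (node_of e j) u * kron (node_of e (Suc j)) w + kron (node_of e (Suc j)) u * kron (node_of e j) w))"

lemma finite_X: "finite X" unfolding X_def using finite_V by auto

lemma node_of_X: "e < N \<Longrightarrow> j \<le> m \<Longrightarrow> node_of e j \<in> X"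
  using vertI by (auto simp: node_of_def X_def)

lemma X_node_of: "u \<in> X \<Longrightarrow> \<exists>e j. e < N \<and> j \<le> m \<and> u = node_of e j"
proof -
  assume "u \<in> X"
  then consider v where "v \<in> V" "u = Inl v" | e j where "e < N" "1 \<le> j" "j < m" "u = Inr (e, j)"
    by (auto simp: X_def)
  then show ?thesis
  proof cases
    case 1
    then obtain n s where n: "n < N" "vert V (n, s) = v" using vertex_nonempty by blast
    then have "u = node_of n (if s then m else 0)" using m 1 by (auto simp: node_of_def)
    then show ?thesis using n by (intro exI[of _ n] exI[of _ "if s then m else 0"]) auto
  next
    case 2
    then show ?thesis by (intro exI[of _ e] exI[of _ j]) (auto simp: node_of_def)
  qed
qed

lemma M_app: "(\<Sum>w\<in>X. M t u w * Y w) = (\<Sum>e<N. \<Sum>j<m.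
    kron (node_of e j) u * (link_diag t e * Y (node_of e j) - link_off t e * Y (node_of e (Suc j)))
    + kron (node_of e (Suc j)) u * (link_diag t e * Y (node_of e (Suc j)) - link_off t e * Y (node_of e j)))"
proof -
  have "(\<Sum>w\<in>X. M t u w * Y w) = (\<Sum>w\<in>X. \<Sum>e<N. \<Sum>j<m.
      (kron (node_of e j) u * link_diag t e - kron (node_of e (Suc j)) u * link_off t e) * (kron (node_of e j) w * Y w)
      + (kron (node_of e (Suc j)) u * link_diag t e - kron (node_of e j) u * link_off t e) * (kron (node_of e (Suc j)) w * Y w))"
    unfolding M_def sum_distrib_right by (intro sum.cong refl) (simp add: algebra_simps)
  also have "\<dots> = (\<Sum>e<N. \<Sum>j<m. \<Sum>w\<in>X.
      (kron (node_of e j) u * link_diag t e - kron (node_of e (Suc j)) u * link_off t e) * (kron (node_of e j) w * Y w)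
      + (kron (node_of e (Suc j)) u * link_diag t e - kron (node_of e j) u * link_off t e) * (kron (node_of e (Suc j)) w * Y w))"
    by (subst sum.swap, rule sum.cong[OF refl], rule sum.swap)
  also have "\<dots> = (\<Sum>e<N. \<Sum>j<m.
      (kron (node_of e j) u * link_diag t e - kron (node_of e (Suc j)) u * link_off t e) * Y (node_of e j)
      + (kron (node_of e (Suc j)) u * link_diag t e - kron (node_of e j) u * link_off t e) * Y (node_of e (Suc j)))"
    by (intro sum.cong refl) (simp add: sum.distrib sum_distrib_left[symmetric] sum_kron finite_X node_of_X)
  finally show ?thesis by (simp add: algebra_simps)
qed

lemma M_bil: "(\<Sum>u\<in>X. \<Sum>w\<in>X. M t u w * Y u * Y w) = (\<Sum>e<N. \<Sum>j<m.
    link_diag t e * ((Y (node_of e j))\<^sup>2 + (Y (node_of e (Suc j)))\<^sup>2) - 2 * link_off t e * (Y (node_of e j) * Y (node_of e (Suc j))))"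
proof -
  have "(\<Sum>u\<in>X. \<Sum>w\<in>X. M t u w * Y u * Y w) = (\<Sum>u\<in>X. Y u * (\<Sum>w\<in>X. M t u w * Y w))"
    by (simp add: sum_distrib_left mult_ac)
  also have "\<dots> = (\<Sum>u\<in>X. \<Sum>e<N. \<Sum>j<m.
    (link_diag t e * Y (node_of e j) - link_off t e * Y (node_of e (Suc j))) * (kron (node_of e j) u * Y u)
    + (link_diag t e * Y (node_of e (Suc j)) - link_off t e * Y (node_of e j)) * (kron (node_of e (Suc j)) u * Y u))"
    unfolding M_app sum_distrib_left by (intro sum.cong refl) (simp add: algebra_simps)
  also have "\<dots> = (\<Sum>e<N. \<Sum>j<m. \<Sum>u\<in>X.
    (link_diag t e * Y (node_of e j) - link_off t e * Y (node_of e (Suc j))) * (kron (node_of e j) u * Y u)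
    + (link_diag t e * Y (node_of e (Suc j)) - link_off t e * Y (node_of e j)) * (kron (node_of e (Suc j)) u * Y u))"
    by (subst sum.swap, rule sum.cong[OF refl], rule sum.swap)
  also have "\<dots> = (\<Sum>e<N. \<Sum>j<m.
    (link_diag t e * Y (node_of e j) - link_off t e * Y (node_of e (Suc j))) * Y (node_of e j)
    + (link_diag t e * Y (node_of e (Suc j)) - link_off t e * Y (node_of e j)) * Y (node_of e (Suc j)))"
    by (intro sum.cong refl) (simp add: sum.distrib sum_distrib_left[symmetric] sum_kron finite_X node_of_X)
  finally show ?thesis by (simp add: algebra_simps power2_eq_square)
qed

sublocale symmetric_family X M K
proof
  show "finite X" by (rule finite_X)
  show "M t x y = M t y x" for t x y unfolding M_def by (intro sum.cong refl) (simp add: algebra_simps)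
  show "continuous_on {0..K} (\<lambda>t. M t x y)" for x y
    unfolding M_def
  proof (intro continuous_on_sum continuous_on_diff continuous_on_mult continuous_on_const)
    fix e assume "e \<in> {..<N}"
    then have "Sn t (l e) \<noteq> 0" if "t \<in> {0..K}" for t using Sn_l[of e t] that by auto
    then show "continuous_on {0..K} (\<lambda>t. link_diag t e)" "continuous_on {0..K} (\<lambda>t. link_off t e)"
      unfolding link_diag_def link_off_def
      by (auto intro!: continuous_on_divide continuous_on_const continuous_on_Cs_param continuous_on_Sn_param)
  qed
  show "0 \<le> (\<Sum>x\<in>X. \<Sum>y\<in>X. M 0 x y * u x * u y)" for u
    unfolding M_bil
  proof (intro sum_nonneg)
    fix e j assume "e \<in> {..<N}"
    \<comment> \<open>At t = 0 the minimiser on a piece is linear, with energy (difference)^2 /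
      length.\<close>
    have "link_diag 0 e * ((u (node_of e j))\<^sup>2 + (u (node_of e (Suc j)))\<^sup>2) - 2 * link_off 0 e * (u (node_of e j) * u (node_of e (Suc j)))
      = (u (node_of e j) - u (node_of e (Suc j)))\<^sup>2 / l e"
      unfolding link_diag_def link_off_def Cs_def Sn_def by (simp add: power2_eq_square algebra_simps diff_divide_distrib add_divide_distrib)
    then show "0 \<le> link_diag 0 e * ((u (node_of e j))\<^sup>2 + (u (node_of e (Suc j)))\<^sup>2) - 2 * link_off 0 e * (u (node_of e j) * u (node_of e (Suc j)))"
      using l_pos[of e] \<open>e \<in> {..<N}\<close> by simp
  qed
qed

text \<open>Only the two pieces meeting at the node contribute, and the kernel equation says that
  the derivatives of their solutions agree there. Multiplication by \<open>Sn t (l e)\<close> gives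
  the recurrence.\<close>

lemma kernel_interior:
  assumes "app t Y (Inr (e, i)) = 0" "e < N" "1 \<le> i" "i < m" "0 < Sn t (l e)"
  shows "Y (node_of e (Suc i)) + Y (node_of e (i - 1)) = 2 * Cs t (l e) * Y (node_of e i)"
proof -
  let ?u = "Inr (e, i) :: node"
  define G where "G d j = link_diag t d * Y (node_of d j) - link_off t d * Y (node_of d (Suc j))" for d j
  define H where "H d j = link_diag t d * Y (node_of d (Suc j)) - link_off t d * Y (node_of d j)" for d j
  have 1: "kron (node_of d j) ?u = (if d = e then if j = i then 1 else 0 else 0)" if "j < m" for d j
    using that assms by (auto simp: kron_def node_of_def)
  have 2: "kron (node_of d (Suc j)) ?u = (if d = e then if j = i - 1 then 1 else 0 else 0)" if "j < m" for d j
    using that assms by (auto simp: kron_def node_of_def)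
  have "0 = (\<Sum>d<N. \<Sum>j<m. kron (node_of d j) ?u * G d j + kron (node_of d (Suc j)) ?u * H d j)"
    using assms(1) unfolding app_def M_app G_def H_def by simp
  also have "\<dots> = (\<Sum>d<N. if d = e then \<Sum>j<m. (if j = i then G e j else 0) + (if j = i - 1 then H e j else 0) else 0)"
    by (intro sum.cong refl) (auto simp: 1 2 intro!: sum.cong)
  also have "\<dots> = G e i + H e (i - 1)"
    using assms by (simp add: sum.distrib)
  finally have "G e i + H e (i - 1) = 0" by simp
  then have "Sn t (l e) * (Y (node_of e (Suc i)) + Y (node_of e (i - 1))) = Sn t (l e) * (2 * Cs t (l e) * Y (node_of e i))"
    using assms(3,5) unfolding G_def H_def link_diag_def link_off_def by (simp add: field_simps)
  then show ?thesis using assms(5) by (simp only: mult_cancel_left) auto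
qed

text \<open>The Kirchhoff condition in terms of node values: each bracket is minus the normal
  derivative, at that end, of the solution on the adjacent piece.\<close>

lemma kernel_vertex:
  assumes "app t Y (Inl v) = 0"
  shows "(\<Sum>e<N. kron (vert V (e, False)) v * (link_diag t e * Y (node_of e 0) - link_off t e * Y (node_of e 1)) +
      kron (vert V (e, True)) v * (link_diag t e * Y (node_of e m) - link_off t e * Y (node_of e (m - 1)))) = 0"
proof -
  let ?u = "Inl v :: node"
  define G where "G d j = link_diag t d * Y (node_of d j) - link_off t d * Y (node_of d (Suc j))" for d j
  define H where "H d j = link_diag t d * Y (node_of d (Suc j)) - link_off t d * Y (node_of d j)" for d j
  have 1: "kron (node_of d j) ?u = (if j = 0 then kron (vert V (d, False)) v else 0)" if "j < m" for d j
    using that by (auto simp: kron_def node_of_def)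
  have 2: "kron (node_of d (Suc j)) ?u = (if j = m - 1 then kron (vert V (d, True)) v else 0)" if "j < m" for d j
    using that by (auto simp: kron_def node_of_def)
  have "0 = (\<Sum>d<N. \<Sum>j<m. kron (node_of d j) ?u * G d j + kron (node_of d (Suc j)) ?u * H d j)"
    using assms(1) unfolding app_def M_app G_def H_def by simp
  also have "\<dots> = (\<Sum>d<N. \<Sum>j<m. (if j = 0 then kron (vert V (d, False)) v * G d j else 0)
      + (if j = m - 1 then kron (vert V (d, True)) v * H d j else 0))"
    by (intro sum.cong refl) (auto simp: 1 2)
  also have "\<dots> = (\<Sum>d<N. kron (vert V (d, False)) v * G d 0 + kron (vert V (d, True)) v * H d (m - 1))"
    using m by (intro sum.cong refl) (simp add: sum.distrib)
  finally show ?thesis using m unfolding G_def H_def by simp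
qed

(* The solution on each edge with the prescribed values at the first two nodes. The kernel
   equation at an inner node is the recurrence y(j+1) + y(j-1) = 2 Cs t l * y(j), so for kernel
   vectors it takes the prescribed values at all nodes. *)
definition ext :: "real \<Rightarrow> (node \<Rightarrow> real) \<Rightarrow> nat \<Rightarrow> real \<Rightarrow> real" where
  "ext t Y e x = Y (node_of e 0) * Cs t (x - a e) + (Y (node_of e 1) - Y (node_of e 0) * Cs t (l e)) / Sn t (l e) * Sn t (x - a e)"

definition ext' :: "real \<Rightarrow> (node \<Rightarrow> real) \<Rightarrow> nat \<Rightarrow> real \<Rightarrow> real" where
  "ext' t Y e x = (Y (node_of e 1) - Y (node_of e 0) * Cs t (l e)) / Sn t (l e) * Cs t (x - a e) - t\<^sup>2 * (Y (node_of e 0) * Sn t (x - a e))"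

lemma ext_ode: "ode_on (a e) (b e) (t\<^sup>2) (ext t Y e) (ext' t Y e)"
proof -
  define q where "q = (Y (node_of e 1) - Y (node_of e 0) * Cs t (l e)) / Sn t (l e)"
  show ?thesis unfolding ode_on_def ext_def ext'_def q_def[symmetric]
    by (auto intro!: derivative_eq_intros simp: algebra_simps)
qed

text \<open>The addition theorems as a flow. Steps by \<open>l e\<close> and \<open>- l e\<close>
  together give the recurrence of kernel vectors, and one step back from \<open>b e\<close> gives
  the derivative at the right end.\<close>

lemma ext_shift:
  "ext t Y e (x + h) = ext t Y e x * Cs t h + ext' t Y e x * Sn t h"
proof -
  define q where "q = (Y (node_of e 1) - Y (node_of e 0) * Cs t (l e)) / Sn t (l e)"
  have "x + h - a e = (x - a e) + h" by simp
  then show ?thesis unfolding ext_def ext'_def q_def[symmetric]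
    by (simp only: Cs_add Sn_add) (simp add: algebra_simps)
qed

text \<open>Nodes 0 and 1 hold by construction. Beyond them both sides satisfy the same recurrence,
  which reaches two nodes back, hence the strong induction.\<close>

lemma ext_node:
  assumes ker: "\<And>u. u \<in> X \<Longrightarrow> app t Y u = 0" and e: "e < N" and t: "0 \<le> t" "t \<le> K + 1" and j: "j \<le> m"
  shows "ext t Y e (a e + real j * l e) = Y (node_of e j)"
  using j
proof (induction j rule: less_induct)
  case (less j)
  have S: "Sn t (l e) > 0" using Sn_l e t by blast
  consider "j = 0" | "j = 1" | i where "j = Suc i" "1 \<le> i" by (cases j; cases "j = 1") auto
  then show ?case
  proof cases
    case 1
    then show ?thesis by (simp add: ext_def)
  next
    case 2
    then show ?thesis using S by (simp add: ext_def)
  next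
    case 3
    let ?x = "a e + real i * l e"
    have i: "ext t Y e ?x = Y (node_of e i)" "ext t Y e (a e + real (i - 1) * l e) = Y (node_of e (i - 1))"
      by (rule less.IH; use less.prems 3 in simp)+
    have "app t Y (Inr (e, i)) = 0" using 3 less.prems e by (intro ker) (auto simp: X_def)
    then have rec: "Y (node_of e (Suc i)) + Y (node_of e (i - 1)) = 2 * Cs t (l e) * Y (node_of e i)"
      using kernel_interior 3 less.prems e S by auto
    have eq: "a e + real j * l e = ?x + l e" "a e + real (i - 1) * l e = ?x + - l e"
      using 3 by (auto simp: algebra_simps of_nat_diff)
    have "ext t Y e (?x + l e) + ext t Y e (?x + - l e) = 2 * Cs t (l e) * ext t Y e ?x"
      unfolding ext_shift by simp
    then show ?thesis using rec i \<open>j = Suc i\<close> unfolding eq by simp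
  qed
qed

lemma ext_std_sol:
  assumes ker: "\<And>u. u \<in> X \<Longrightarrow> app t Y u = 0" and t: "0 \<le> t" "t \<le> K"
  shows "std_sol N a b V (t\<^sup>2) (ext t Y)"
proof -
  have S: "Sn t (l e) > 0" if "e < N" for e using Sn_l that t by auto
  have node: "ext t Y e (a e + real j * l e) = Y (node_of e j)" if "e < N" "j \<le> m" for e j
    using ext_node[OF ker that(1) _ _ that(2)] t by auto
  have va: "ext t Y e (a e) = Y (Inl (vert V (e, False)))" if "e < N" for e
    using node[OF that, of 0] by (simp add: node_of_def)
  have vb: "ext t Y e (b e) = Y (Inl (vert V (e, True)))" if "e < N" for e
    using node[OF that, of m] m by (simp add: node_of_def ml)
  have ed: "edge_deriv a b (ext t Y) e x = ext' t Y e x" if "e < N" "x \<in> {a e..b e}" for e x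
    using edge_deriv_eq[of a e b "t\<^sup>2" "ext t Y" "ext' t Y e" x] len ext_ode that by auto
  have na: "normal_der a b (ext t Y) (e, False) = - (link_diag t e * Y (node_of e 0) - link_off t e * Y (node_of e 1))" if e: "e < N" for e
  proof -
    have "normal_der a b (ext t Y) (e, False) = ext' t Y e (a e)"
      using ed[of e "a e"] len[of e] that by (simp add: normal_der_def)
    also have "\<dots> = (Y (node_of e 1) - Y (node_of e 0) * Cs t (l e)) / Sn t (l e)" by (simp add: ext'_def)
    finally show ?thesis by (simp add: link_diag_def link_off_def diff_divide_distrib)
  qed
  have nb: "normal_der a b (ext t Y) (e, True) = - (link_diag t e * Y (node_of e m) - link_off t e * Y (node_of e (m - 1)))" if e: "e < N" for e
  proof -
    have 1: "normal_der a b (ext t Y) (e, True) = - ext' t Y e (b e)"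
      using ed[of e "b e"] len[of e] that by (simp add: normal_der_def)
    \<comment> \<open>The derivative at \<open>b e\<close> is read off from the values at the last
      two nodes.\<close>
    have "b e + - l e = a e + real (m - 1) * l e"
      using m ml[of e, symmetric] by (simp add: of_nat_diff algebra_simps)
    then have "Y (node_of e (m - 1)) = ext t Y e (b e + - l e)" using node[of e "m - 1"] e by simp
    also have "\<dots> = Y (node_of e m) * Cs t (l e) - ext' t Y e (b e) * Sn t (l e)"
      unfolding ext_shift using node[of e m] e by (simp add: ml)
    finally have "ext' t Y e (b e) = (Y (node_of e m) * Cs t (l e) - Y (node_of e (m - 1))) / Sn t (l e)"
      using S[OF e] by (simp add: field_simps)
    then show ?thesis using 1 by (simp add: link_diag_def link_off_def diff_divide_distrib)
  qed
  show ?thesis unfolding std_sol_def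
  proof (intro conjI ballI)
    show "edge_ode N a b (t\<^sup>2) (ext t Y)" by (rule edge_odeI[OF len ext_ode])
    fix v assume v: "v \<in> V"
    have ev: "end_val a b (ext t Y) p = Y (Inl v)" if p: "p \<in> v" for p
    proof -
      have "p \<in> endpoints N" using p v part by (auto simp: partition_on_def)
      then have "fst p < N" by (auto simp: endpoints_def)
      then show ?thesis using va vb vert_eq[OF part v p] by (cases p) (auto simp: end_val_def)
    qed
    show "end_val a b (ext t Y) p = end_val a b (ext t Y) q" if "p \<in> v" "q \<in> v" for p q
      using ev that by simp
    have "(\<Sum>p\<in>v. normal_der a b (ext t Y) p) =
      (\<Sum>e<N. - (kron (vert V (e, False)) v * (link_diag t e * Y (node_of e 0) - link_off t e * Y (node_of e 1)) +
      kron (vert V (e, True)) v * (link_diag t e * Y (node_of e m) - link_off t e * Y (node_of e (m - 1)))))"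
      unfolding sum_vertex[OF v] by (intro sum.cong refl) (simp add: na nb algebra_simps)
    also have "\<dots> = 0" using kernel_vertex[OF ker, of v] v by (simp only: sum_negf) (simp add: X_def)
    finally show "(\<Sum>p\<in>v. normal_der a b (ext t Y) p) = 0" .
  qed
qed

lemma kernel_eigenfunctions:
  assumes Y: "indep_on X {..<k} Y" and ker: "\<And>i u. i < k \<Longrightarrow> u \<in> X \<Longrightarrow> app t (Y i) u = 0"
    and t: "0 \<le> t" "t \<le> K"
  shows "\<exists>g. (\<forall>i<k. std_sol N a b V (t\<^sup>2) (g i)) \<and> lin_indep_on N a b k g"
proof (intro exI[of _ "\<lambda>i. ext t (Y i)"] conjI allI impI)
  show "std_sol N a b V (t\<^sup>2) (ext t (Y i))" if "i < k" for i
    using ext_std_sol[OF ker[OF that] t] .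
  show "lin_indep_on N a b k (\<lambda>i. ext t (Y i))"
    unfolding lin_indep_on_def
  proof (intro allI impI)
    fix c :: "nat \<Rightarrow> real" and i
    assume z: "\<forall>n<N. \<forall>x\<in>{a n..b n}. (\<Sum>i<k. c i * ext t (Y i) n x) = 0" and i: "i < k"
    have "lincomb {..<k} Y c u = 0" if u: "u \<in> X" for u
    proof -
      obtain e j where ej: "e < N" "j \<le> m" "u = node_of e j" using X_node_of[OF u] by blast
      have "a e + real j * l e \<in> {a e..b e}"
        using l_pos[OF ej(1)] ej(2) by (auto simp: ml[symmetric])
      then have "(\<Sum>i<k. c i * ext t (Y i) e (a e + real j * l e)) = 0" using z ej by blast
      moreover have "ext t (Y i) e (a e + real j * l e) = Y i u" if "i < k" for i
        using ext_node[OF ker[OF that], of e j] ej t by auto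
      ultimately show ?thesis by (simp add: lincomb_def)
    qed
    then show "c i = 0" using indep_onD[OF Y, of c i] i by auto
  qed
qed

section \<open>Energies of functions compared with their node values\<close>

lemma edge_pieces:
  assumes f: "edge_C1 N a b f f'" and t: "0 \<le> t" "t \<le> K + 1" and e: "e < N"
  shows "(\<Sum>j<m. link_diag t e * ((f e (a e + real j * l e))\<^sup>2 + (f e (a e + real (Suc j) * l e))\<^sup>2)
      - 2 * link_off t e * (f e (a e + real j * l e) * f e (a e + real (Suc j) * l e)))
    \<le> integral {a e..b e} (\<lambda>x. (f' e x)\<^sup>2 - t\<^sup>2 * (f e x)\<^sup>2)"
proof -
  have "(\<Sum>j<m. Cs t (l e) / Sn t (l e) * ((f e (a e + real j * l e))\<^sup>2 + (f e (a e + real (Suc j) * l e))\<^sup>2)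
           - 2 / Sn t (l e) * (f e (a e + real j * l e) * f e (a e + real (Suc j) * l e)))
     \<le> integral {a e..a e + real m * l e} (\<lambda>x. (f' e x)\<^sup>2 - t\<^sup>2 * (f e x)\<^sup>2)"
    using f e unfolding edge_C1_def by (intro piecewise_riccati_bound l_pos tl_less t) (auto simp: ml)
  then show ?thesis by (simp add: link_diag_def link_off_def ml)
qed

lemma bil_le_energy:
  assumes f: "edge_C1 N a b f f'" and Y: "\<And>e j. e < N \<Longrightarrow> j \<le> m \<Longrightarrow> Y (node_of e j) = f e (a e + real j * l e)"
  shows "bil K Y Y \<le> energy N a b (K\<^sup>2) f f'"
  unfolding bil_def M_bil energy_def
proof (intro sum_mono)
  fix e assume "e \<in> {..<N}"
  then have e: "e < N" by simp
  have "(\<Sum>j<m. link_diag K e * ((Y (node_of e j))\<^sup>2 + (Y (node_of e (Suc j)))\<^sup>2) - 2 * link_off K e * (Y (node_of e j) * Y (node_of e (Suc j)))) =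
    (\<Sum>j<m. link_diag K e * ((f e (a e + real j * l e))\<^sup>2 + (f e (a e + real (Suc j) * l e))\<^sup>2)
      - 2 * link_off K e * (f e (a e + real j * l e) * f e (a e + real (Suc j) * l e)))"
    by (intro sum.cong refl) (simp only: Y[OF e] lessThan_iff less_imp_le Suc_leI)
  then show "(\<Sum>j<m. link_diag K e * ((Y (node_of e j))\<^sup>2 + (Y (node_of e (Suc j)))\<^sup>2) - 2 * link_off K e * (Y (node_of e j) * Y (node_of e (Suc j))))
      \<le> integral {a e..b e} (\<lambda>x. (f' e x)\<^sup>2 - K\<^sup>2 * (f e x)\<^sup>2)"
    using edge_pieces[OF f, of K e] K e by simp
qed

text \<open>With zero node values the piecewise bound at \<open>K + 1\<close> gives int f'^2 >= (K +
  1)^2 int f^2, while the energy hypothesis gives int f'^2 <= K^2 int f^2.\<close>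

lemma zero_at_nodes:
  assumes f: "edge_C1 N a b f f'" and en: "energy N a b (K\<^sup>2) f f' \<le> 0"
    and z: "\<And>e j. e < N \<Longrightarrow> j \<le> m \<Longrightarrow> f e (a e + real j * l e) = 0"
    and n: "n < N" "x \<in> {a n..b n}"
  shows "f n x = 0"
proof (rule l2_inner_self_le_0[of N a b f, OF len _ _ n])
  show c: "edge_cont N a b f" using edge_C1_cont[OF f] by simp
  have "0 \<le> integral {a e..b e} (\<lambda>x. (f' e x)\<^sup>2 - (K + 1)\<^sup>2 * (f e x)\<^sup>2)" if e: "e < N" for e
  proof -
    have "(\<Sum>j<m. link_diag (K + 1) e * ((f e (a e + real j * l e))\<^sup>2 + (f e (a e + real (Suc j) * l e))\<^sup>2)
      - 2 * link_off (K + 1) e * (f e (a e + real j * l e) * f e (a e + real (Suc j) * l e))) = 0"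
      using z[OF e] by (intro sum.neutral ballI) (simp only: lessThan_iff less_imp_le Suc_leI, simp)
    then show ?thesis using edge_pieces[OF f, of "K + 1" e] K e by simp
  qed
  then have "0 \<le> energy N a b ((K + 1)\<^sup>2) f f'" unfolding energy_def by (intro sum_nonneg) auto
  then have "(K + 1)\<^sup>2 * l2_inner N a b f f \<le> K\<^sup>2 * l2_inner N a b f f"
    using en energy_eq_l2_inner[OF f, of "K\<^sup>2"] energy_eq_l2_inner[OF f, of "(K + 1)\<^sup>2"] by linarith
  then have "(2 * K + 1) * l2_inner N a b f f \<le> 0" by (simp add: power2_eq_square algebra_simps)
  then show "l2_inner N a b f f \<le> 0" using K by (simp add: mult_le_0_iff)
qed

text \<open>With more eigenfunctions than nodes, a nontrivial combination vanishes at all nodes. Its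
  energy at K is nonpositive, so it vanishes identically, and so does each of its eigenvalue
  components. This makes the spectrum up to K^2 finite; over an infinite set the sum in
  \<open>eig_count\<close> would be 0 by convention.\<close>

lemma eigenfamily_card_le:
  assumes fin: "finite I" and sol: "\<And>i. i \<in> I \<Longrightarrow> std_sol N a b V (lam i) (g i)" 
    and lam: "\<And>i. i \<in> I \<Longrightarrow> lam i \<le> K\<^sup>2"
    and ind: "\<And>c i. i \<in> I \<Longrightarrow>
      (\<And>n x. n < N \<Longrightarrow> x \<in> {a n..b n} \<Longrightarrow> (\<Sum>j\<in>{j\<in>I. lam j = lam i}. c j * g j n x) = 0) \<Longrightarrow> c i = (0::real)"
  shows "card I \<le> card X"
proof (rule ccontr)
  assume "\<not> card I \<le> card X"
  interpret ef: eigenfamily N a b I lam g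
  proof
    show "edge_ode N a b (lam i) (g i)" if "i \<in> I" for i using sol[OF that] by (simp add: std_sol_def)
    show "boundary_form N a b (g i) (g j) = 0" if "i \<in> I" "j \<in> I" for i j using boundary_form_std[OF sol sol] that .
  qed (use len fin in auto)
  have "\<forall>u. \<exists>p. u \<in> X \<longrightarrow> fst p < N \<and> snd p \<le> m \<and> u = node_of (fst p) (snd p)"
  proof
    fix u
    show "\<exists>p. u \<in> X \<longrightarrow> fst p < N \<and> snd p \<le> m \<and> u = node_of (fst p) (snd p)"
    proof (cases "u \<in> X")
      case True
      then obtain e j where "e < N" "j \<le> m" "u = node_of e j" using X_node_of by blast
      then show ?thesis by (intro exI[of _ "(e, j)"]) auto
    qed auto
  qed
  then obtain q where q: "\<And>u. u \<in> X \<Longrightarrow> fst (q u) < N \<and> snd (q u) \<le> m \<and> u = node_of (fst (q u)) (snd (q u))"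
    by metis
  define A where "A u i = g i (fst (q u)) (a (fst (q u)) + real (snd (q u)) * l (fst (q u)))" for u i
  obtain c where c: "\<exists>i\<in>I. c i \<noteq> 0" "\<And>u. u \<in> X \<Longrightarrow> (\<Sum>i\<in>I. A u i * c i) = 0"
    using kernel_vector[OF fin finite_X, of A] \<open>\<not> card I \<le> card X\<close> by auto
  \<comment> \<open>\<open>A\<close> evaluates at one chosen representative \<open>q u\<close> of
    each node; continuity at the vertices makes the value independent of this choice.\<close>
  have A: "A (node_of e j) i = g i e (a e + real j * l e)" if "e < N" "j \<le> m" "i \<in> I" for e j i
  proof -
    define e' j' where "e' = fst (q (node_of e j))" and "j' = snd (q (node_of e j))"
    have q': "e' < N" "j' \<le> m" "node_of e' j' = node_of e j" using q[OF node_of_X[OF that(1,2)]] by (auto simp: e'_def j'_def)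
    have A': "A (node_of e j) i = g i e' (a e' + real j' * l e')" by (simp add: A_def e'_def j'_def)
    have val: "\<exists>s. g i d (a d + real k * l d) = end_val a b (g i) (d, s) \<and> (d, s) \<in> v" if "d < N" "k \<le> m" "node_of d k = Inl v" for d k v
    proof -
      from that(3) consider "k = 0" "v = vert V (d, False)" | "k = m" "v = vert V (d, True)"
        by (auto simp: node_of_def split: if_splits)
      then show ?thesis
      proof cases
        case 1
        then show ?thesis using vertI[OF that(1)] by (intro exI[of _ False]) (auto simp: end_val_def)
      next
        case 2
        then show ?thesis using vertI[OF that(1)] by (intro exI[of _ True]) (auto simp: end_val_def ml)
      qed
    qed
    show ?thesis
    proof (cases "node_of e j")
      case (Inl v)
      then have "v \<in> V" using node_of_X[OF that(1,2)] by (auto simp: X_def)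
      then show ?thesis using val[OF q'(1,2)] val[OF that(1,2)] q'(3) Inl sol[OF that(3)] A'
        unfolding std_sol_def by metis
    next
      case (Inr p)
      then have "e' = e \<and> j' = j" using q'(3) by (auto simp: node_of_def split: if_splits)
      then show ?thesis using A' by simp
    qed
  qed
  have z: "(\<Sum>i\<in>I. c i * g i n x) = 0" if "n < N" "x \<in> {a n..b n}" for n x
  proof (rule zero_at_nodes[of "\<lambda>n x. \<Sum>i\<in>I. c i * g i n x" "\<lambda>n x. \<Sum>i\<in>I. c i * edge_deriv a b (g i) n x", OF _ _ _ that])
    show "edge_C1 N a b (\<lambda>n x. \<Sum>i\<in>I. c i * g i n x) (\<lambda>n x. \<Sum>i\<in>I. c i * edge_deriv a b (g i) n x)"
      by (intro edge_C1_sum ef.C1)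
    show "energy N a b (K\<^sup>2) (\<lambda>n x. \<Sum>i\<in>I. c i * g i n x) (\<lambda>n x. \<Sum>i\<in>I. c i * edge_deriv a b (g i) n x) \<le> 0"
      by (intro ef.energy_nonpos lam)
    show "(\<Sum>i\<in>I. c i * g i e (a e + real j * l e)) = 0" if "e < N" "j \<le> m" for e j
      using c(2)[OF node_of_X[OF that]] A[OF that] by (simp add: mult.commute cong: sum.cong)
  qed
  have "c i = 0" if "i \<in> I" for i
    using ind[OF that, of c] ef.component_zero[of c, OF z] by blast
  then show False using c(1) by blast
qed

section \<open>Multiplicities and the spectrum up to K^2\<close>

lemma multiplicity_le:
  assumes "lam \<le> K\<^sup>2" "\<forall>i<k. std_sol N a b V lam (g i)" "lin_indep_on N a b k g"
  shows "k \<le> card X"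
proof -
  have "card {..<k} \<le> card X"
  proof (rule eigenfamily_card_le[of "{..<k}" "\<lambda>_. lam" g])
    fix c :: "nat \<Rightarrow> real" and i assume i: "i \<in> {..<k}"
      and z: "\<And>n x. n < N \<Longrightarrow> x \<in> {a n..b n} \<Longrightarrow> (\<Sum>j\<in>{j \<in> {..<k}. lam = lam}. c j * g j n x) = 0"
    have "(\<Sum>j<k. c j * g j n x) = 0" if "n < N" "x \<in> {a n..b n}" for n x
      using z[OF that] by (simp add: lessThan_def)
    then show "c i = 0" using assms(3) i unfolding lin_indep_on_def by blast
  qed (use assms in auto)
  then show ?thesis by simp
qed

definition mult :: "real \<Rightarrow> nat" where "mult lam = multiplicity N a b (std_sol N a b V) lam"

lemma mult_ge:
  assumes "lam \<le> K\<^sup>2" "\<forall>i<k. std_sol N a b V lam (g i)" "lin_indep_on N a b k g"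
  shows "k \<le> mult lam"
  unfolding mult_def multiplicity_def
proof (rule cSup_upper)
  show "k \<in> {k. \<exists>g. (\<forall>i<k. std_sol N a b V lam (g i)) \<and> lin_indep_on N a b k g}" using assms by auto
  show "bdd_above {k. \<exists>g. (\<forall>i<k. std_sol N a b V lam (g i)) \<and> lin_indep_on N a b k g}"
    using multiplicity_le[OF assms(1)] by (intro bdd_aboveI[of _ "card X"]) blast
qed

lemma mult_attained:
  assumes "lam \<le> K\<^sup>2"
  shows "\<exists>g. (\<forall>i<mult lam. std_sol N a b V lam (g i)) \<and> lin_indep_on N a b (mult lam) g"
proof -
  let ?S = "{k. \<exists>g. (\<forall>i<k. std_sol N a b V lam (g i)) \<and> lin_indep_on N a b k g}"
  have "?S \<subseteq> {..card X}" using multiplicity_le[OF assms] by auto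
  then have "finite ?S" using finite_subset by blast
  moreover have "0 \<in> ?S" by (auto simp: lin_indep_on_def)
  ultimately have "Sup ?S \<in> ?S" by (metis (no_types, lifting) Max_in cSup_eq_Max empty_iff)
  then show ?thesis unfolding mult_def multiplicity_def by simp
qed

lemma sum_mult_le:
  assumes Z: "finite Z" "\<And>r. r \<in> Z \<Longrightarrow> r \<le> K\<^sup>2"
  shows "(\<Sum>r\<in>Z. mult r) \<le> card X"
proof -
  have "\<forall>r. \<exists>g. r \<in> Z \<longrightarrow> (\<forall>i<mult r. std_sol N a b V r (g i)) \<and> lin_indep_on N a b (mult r) g"
    using mult_attained Z by blast
  then obtain g where g: "\<And>r i. r \<in> Z \<Longrightarrow> i < mult r \<Longrightarrow> std_sol N a b V r (g r i)"
      "\<And>r. r \<in> Z \<Longrightarrow> lin_indep_on N a b (mult r) (g r)" by metis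
  let ?I = "SIGMA r:Z. {..<mult r}"
  have "card ?I \<le> card X"
  proof (rule eigenfamily_card_le[of ?I fst "\<lambda>p. g (fst p) (snd p)"])
    fix c :: "real \<times> nat \<Rightarrow> real" and p assume p: "p \<in> ?I"
      and z: "\<And>n x. n < N \<Longrightarrow> x \<in> {a n..b n} \<Longrightarrow> (\<Sum>q\<in>{q \<in> ?I. fst q = fst p}. c q * g (fst q) (snd q) n x) = 0"
    obtain r i where ri: "p = (r, i)" "r \<in> Z" "i < mult r" using p by auto
    have "{q \<in> ?I. fst q = fst p} = Pair r ` {..<mult r}" using ri by auto
    then have "(\<Sum>j<mult r. c (r, j) * g r j n x) = 0" if "n < N" "x \<in> {a n..b n}" for n x
      using z[OF that] by (simp add: sum.reindex inj_on_def)
    moreover have "(\<forall>n<N. \<forall>x\<in>{a n..b n}. (\<Sum>j<mult r. c (r, j) * g r j n x) = 0) \<longrightarrow> (\<forall>j<mult r. c (r, j) = 0)"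
      using g(2)[OF ri(2)] unfolding lin_indep_on_def by (rule spec)
    ultimately show "c p = 0" using ri by blast
  qed (use Z g in auto)
  then show ?thesis using Z by simp
qed

lemma finite_spectrum: "finite {r. r \<le> K\<^sup>2 \<and> 0 < mult r}"
proof (rule ccontr)
  assume "infinite {r. r \<le> K\<^sup>2 \<and> 0 < mult r}"
  then obtain Z where Z: "Z \<subseteq> {r. r \<le> K\<^sup>2 \<and> 0 < mult r}" "finite Z" "card Z = Suc (card X)"
    using infinite_arbitrarily_large by blast
  have "card Z = (\<Sum>r\<in>Z. 1)" by simp
  also have "\<dots> \<le> (\<Sum>r\<in>Z. mult r)" using Z by (intro sum_mono) (auto simp: Suc_le_eq)
  also have "\<dots> \<le> card X" using Z by (intro sum_mult_le) auto
  finally show False using Z(3) by simp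
qed

text \<open>The substitute for one half of the min-max principle. Kernel vectors at \<open>s\<close>
  are eigenfunctions for s^2, and squaring is injective on the nonnegative parameters, so the kernel
  dimensions add up within the eigenvalue count.\<close>

theorem nonpos_imp_eig_count:
  assumes "nonpos d K"
  shows "d \<le> eig_count N a b (std_sol N a b V) (K\<^sup>2)"
proof -
  have "K \<in> {0..K}" using K by simp
  from kernels_of_nonpos[OF this assms]
  obtain T k where T: "finite T" "T \<subseteq> {0..K}" "d \<le> sum k T"
    and ker: "\<And>s. s \<in> T \<Longrightarrow> \<exists>g. indep_on X {..<k s :: nat} g \<and> (\<forall>i<k s. \<forall>x\<in>X. app s (g i) x = 0)"
    by (elim exE conjE) blast
  have sq: "s\<^sup>2 \<le> K\<^sup>2" if "s \<in> T" for s using T(2) that by (intro power_mono) auto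
  have k: "k s \<le> mult (s\<^sup>2)" if s: "s \<in> T" for s
  proof -
    obtain Y where Y: "indep_on X {..<k s} Y" "\<And>i u. i < k s \<Longrightarrow> u \<in> X \<Longrightarrow> app s (Y i) u = 0"
      using ker[OF s] by blast
    obtain g where "\<forall>i<k s. std_sol N a b V (s\<^sup>2) (g i)" "lin_indep_on N a b (k s) g"
      using kernel_eigenfunctions[OF Y] s T(2) by (meson atLeastAtMost_iff subsetD)
    then show ?thesis using mult_ge[OF sq[OF s]] by blast
  qed
  have inj: "inj_on (\<lambda>s. s\<^sup>2) T" using T(2) by (intro inj_onI) (auto simp: power2_eq_iff_nonneg subset_iff)
  have "d \<le> (\<Sum>s\<in>T. mult (s\<^sup>2))" using T(3) sum_mono[of T k "\<lambda>s. mult (s\<^sup>2)"] k by force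
  also have "\<dots> = (\<Sum>r\<in>(\<lambda>s. s\<^sup>2) ` T. mult r)" by (simp add: sum.reindex[OF inj])
  also have "\<dots> = (\<Sum>r\<in>{r \<in> (\<lambda>s. s\<^sup>2) ` T. 0 < mult r}. mult r)"
    using T(1) by (intro sum.mono_neutral_right) auto
  also have "\<dots> \<le> (\<Sum>r\<in>{r. r \<le> K\<^sup>2 \<and> 0 < mult r}. mult r)"
    using finite_spectrum sq by (intro sum_mono2) auto
  also have "\<dots> = eig_count N a b (std_sol N a b V) (K\<^sup>2)" by (simp add: eig_count_def mult_def)
  finally show ?thesis .
qed

end

section \<open>Counting Dirichlet eigenvalues and gluing test functions\<close>


context mgraph
begin

lemma boundary_form_dir:
  assumes "dir_sol N a b lam g"
  shows "boundary_form N a b f g = 0"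
  unfolding boundary_form_eq using assms by (simp add: dir_sol_def endpoints_def)

lemma negative_eigenvalue:
  assumes f: "edge_ode N a b lam f" and boundary_form: "boundary_form N a b f f = 0" and lam: "lam < 0" and n: "n < N" "x \<in> {a n..b n}"
  shows "f n x = 0"
proof (rule l2_inner_self_le_0[of N a b f, OF len _ _ n])
  show "edge_cont N a b f" using edge_C1_cont edge_ode_C1[OF f] by blast
  have "0 \<le> lam * l2_inner N a b f f"
    using l2_inner_deriv[OF len f f] boundary_form l2_inner_self_nonneg[of N a b "edge_deriv a b f"] by simp
  then show "l2_inner N a b f f \<le> 0" using lam by (simp add: zero_le_mult_iff)
qed

lemma multiplicity_le_of_bound:
  assumes "\<And>k g. (\<And>i. i < k \<Longrightarrow> sol lam (g i)) \<Longrightarrow> lin_indep_on N a b k g \<Longrightarrow> k \<le> B"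
  shows "multiplicity N a b sol lam \<le> B"
  unfolding multiplicity_def
proof (rule cSup_least)
  have "0 \<in> {k. \<exists>g. (\<forall>i<k. sol lam (g i)) \<and> lin_indep_on N a b k g}" by (auto simp: lin_indep_on_def)
  then show "{k. \<exists>g. (\<forall>i<k. sol lam (g i)) \<and> lin_indep_on N a b k g} \<noteq> {}" by blast
qed (use assms in blast)

lemma negative_independent:
  assumes lam: "lam < 0" and ode: "\<And>i. i < k \<Longrightarrow> edge_ode N a b lam (g i)"
    and boundary_form: "\<And>i. i < k \<Longrightarrow> boundary_form N a b (g i) (g i) = 0" and ind: "lin_indep_on N a b k g"
  shows "k = 0"
proof -
  have "g i n x = 0" if "i < k" "n < N" "x \<in> {a n..b n}" for i n x
    using negative_eigenvalue[OF ode boundary_form lam] that by blast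
  then have z: "\<forall>n<N. \<forall>x\<in>{a n..b n}. (\<Sum>i<k. 1 * g i n x) = 0" by simp
  have "(\<forall>n<N. \<forall>x\<in>{a n..b n}. (\<Sum>i<k. 1 * g i n x) = 0) \<longrightarrow> (\<forall>i<k. (1::real) = 0)"
    using ind unfolding lin_indep_on_def by (rule spec)
  then show ?thesis using z by auto
qed

lemma multiplicity_negative:
  assumes lam: "lam < 0" and ode: "\<And>f. sol lam f \<Longrightarrow> edge_ode N a b lam f" and boundary_form: "\<And>f. sol lam f \<Longrightarrow> boundary_form N a b f f = 0"
  shows "multiplicity N a b sol lam = 0"
proof -
  have "multiplicity N a b sol lam \<le> 0"
  proof (rule multiplicity_le_of_bound)
    fix k g assume "\<And>i. i < k \<Longrightarrow> sol lam (g i)" "lin_indep_on N a b k g"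
    then show "k \<le> 0" using negative_independent[OF lam, of k g] ode boundary_form by simp
  qed
  then show ?thesis by simp
qed

text \<open>Bounds the infimum in \<open>eigval\<close> from below, and shows that a threshold with
  positive count can be written as K^2 with K >= 0.\<close>

lemma eig_count_negative:
  assumes "mu < 0" and "\<And>lam f. sol lam f \<Longrightarrow> edge_ode N a b lam f" and "\<And>lam f. sol lam f \<Longrightarrow> boundary_form N a b f f = 0"
  shows "eig_count N a b sol mu = 0"
proof -
  have "multiplicity N a b sol lam = 0" if "lam \<le> mu" for lam
    using multiplicity_negative[of lam sol] assms that by auto
  then show ?thesis unfolding eig_count_def by (intro sum.neutral) auto
qed

text \<open>The edges on which \<open>lam\<close> is a Dirichlet eigenvalue of the edge taken
  alone.\<close>

definition resonant :: "real \<Rightarrow> nat set" where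
  "resonant lam = {n. n < N \<and> (\<exists>j\<ge>1. lam = (real j * pi / (b n - a n))\<^sup>2)}"

text \<open>For \<open>K \<ge> 0\<close>, the number of Dirichlet eigenvalues (j pi / L)^2 with j >=
  1 of edge \<open>n\<close> up to K^2.\<close>

definition dir_number :: "real \<Rightarrow> nat \<Rightarrow> nat" where
  "dir_number K n = nat \<lfloor>K * (b n - a n) / pi\<rfloor>"

lemma Sn_zero:
  assumes "0 \<le> t" "n < N" "Sn t (b n - a n) = 0"
  shows "n \<in> resonant (t\<^sup>2)"
proof -
  have L: "b n - a n > 0" using len[OF assms(2)] by simp
  have t: "t \<noteq> 0" "sin (t * (b n - a n)) = 0" using assms(3) L by (auto simp: Sn_def split: if_splits)
  then obtain j :: int where j: "t * (b n - a n) = of_int j * pi" using sin_zero_iff_int2 by blast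
  have "t * (b n - a n) > 0" using t assms(1) L by simp
  then have "j > 0" using j by (simp add: zero_less_mult_iff)
  then have "t = real (nat j) * pi / (b n - a n)" "nat j \<ge> 1" using j L by (auto simp: field_simps)
  then show ?thesis using assms(2) unfolding resonant_def by blast
qed

text \<open>On each edge a Dirichlet solution is its initial slope times \<open>Sn\<close>, and the
  slope vanishes unless the edge is resonant. More functions than resonant edges therefore admit a
  combination with all slopes 0.\<close>

lemma dir_independent_le:
  assumes sol: "\<And>i. i < k \<Longrightarrow> dir_sol N a b lam (g i)" and ind: "lin_indep_on N a b k g"
  shows "k \<le> card (resonant lam)"
proof (cases "lam < 0")
  case True
  have "k = 0"
  proof (rule negative_independent[OF True _ _ ind])
    show "edge_ode N a b lam (g i)" if "i < k" for i using sol[OF that] by (simp add: dir_sol_def)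
    show "boundary_form N a b (g i) (g i) = 0" if "i < k" for i using boundary_form_dir[OF sol[OF that]] .
  qed
  then show ?thesis by simp
next
  case False
  define t where "t = sqrt lam"
  have t: "t \<ge> 0" "lam = t\<^sup>2" using False by (auto simp: t_def)
  show ?thesis
  proof (rule ccontr)
    assume "\<not> k \<le> card (resonant lam)"
    have fin: "finite (resonant lam)" by (simp add: resonant_def)
    obtain c where c: "\<exists>i\<in>{..<k}. c i \<noteq> 0"
        "\<And>n. n \<in> resonant lam \<Longrightarrow> (\<Sum>i<k. edge_deriv a b (g i) n (a n) * c i) = 0"
      using kernel_vector[OF _ fin, of "{..<k}" "\<lambda>n i. edge_deriv a b (g i) n (a n)"] \<open>\<not> k \<le> _\<close> by auto
    have ends: "end_val a b (g i) (n, s) = 0" if "i < k" "n < N" for i n s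
    proof -
      have "\<forall>p\<in>endpoints N. end_val a b (g i) p = 0" using sol[OF that(1)] unfolding dir_sol_def by (rule conjunct2)
      then show ?thesis by (rule bspec) (simp add: endpoints_def that)
    qed
    have rep: "g i n x = edge_deriv a b (g i) n (a n) * Sn t (x - a n)" if "i < k" "n < N" "x \<in> {a n..b n}" for i n x
    proof -
      have "g i n (a n) = 0" using ends[OF that(1,2), of False] by (simp add: end_val_def)
      moreover have "ode_on (a n) (b n) (t\<^sup>2) (g i n) (edge_deriv a b (g i) n)"
        using sol[OF that(1)] that(2) by (simp add: dir_sol_def edge_ode_iff t(2))
      ultimately show ?thesis using ode_on_unique[OF _ that(3), of t "g i n" "edge_deriv a b (g i) n"] by simp
    qed
    have z: "(\<Sum>i<k. c i * g i n x) = 0" if n: "n < N" "x \<in> {a n..b n}" for n x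
    proof -
      have "(\<Sum>i<k. edge_deriv a b (g i) n (a n) * c i) = 0"
      proof (cases "n \<in> resonant lam")
        case False
        then have "Sn t (b n - a n) \<noteq> 0" using Sn_zero[OF t(1) n(1)] t(2) by auto
        moreover have "edge_deriv a b (g i) n (a n) * Sn t (b n - a n) = 0" if "i < k" for i
        proof -
          have "g i n (b n) = 0" using ends[OF that n(1), of True] by (simp add: end_val_def)
          then show ?thesis using rep[OF that n(1), of "b n"] len[OF n(1)] by simp
        qed
        ultimately show ?thesis by simp
      qed (rule c(2))
      moreover have "(\<Sum>i<k. c i * g i n x) = (\<Sum>i<k. edge_deriv a b (g i) n (a n) * c i) * Sn t (x - a n)"
        unfolding sum_distrib_right using rep n by (intro sum.cong refl) simp
      ultimately show ?thesis by simp
    qed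
    have "(\<forall>n<N. \<forall>x\<in>{a n..b n}. (\<Sum>i<k. c i * g i n x) = 0) \<longrightarrow> (\<forall>i<k. c i = 0)"
      using ind unfolding lin_indep_on_def by (rule spec)
    then show False using z c(1) by blast
  qed
qed

lemma dir_multiplicity_le: "multiplicity N a b (dir_sol N a b) lam \<le> card (resonant lam)"
  using dir_independent_le by (intro multiplicity_le_of_bound) blast

lemma resonant_le:
  assumes "0 \<le> K" "n < N" "1 \<le> j" "(real j * pi / (b n - a n))\<^sup>2 \<le> K\<^sup>2"
  shows "j \<in> {1..dir_number K n}"
proof -
  have L: "b n - a n > 0" using len[OF assms(2)] by simp
  have "real j * pi / (b n - a n) \<le> K" using power2_le_imp_le[OF assms(4,1)] .
  then have "real j \<le> K * (b n - a n) / pi" using L by (simp add: field_simps)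
  then have "int j \<le> \<lfloor>K * (b n - a n) / pi\<rfloor>" by (simp add: le_floor_iff)
  then show ?thesis using assms(3) by (simp add: dir_number_def)
qed

text \<open>Pairs of an eigenvalue and a resonant edge are images of pairs of an edge and a
  frequency number. Keeping \<open>n\<close> in \<open>?h\<close> separates edges that share an
  eigenvalue.\<close>

lemma dir_spectrum:
  assumes "0 \<le> K"
  shows "finite {lam. lam \<le> K\<^sup>2 \<and> 0 < multiplicity N a b (dir_sol N a b) lam}" (is "finite ?S")
    and "eig_count N a b (dir_sol N a b) (K\<^sup>2) \<le> (\<Sum>n<N. dir_number K n)"
proof -
  let ?P = "SIGMA n:{..<N}. {1..dir_number K n}"
  let ?h = "\<lambda>(n, j). ((real j * pi / (b n - a n))\<^sup>2, n)"
  have sub: "Sigma ?S resonant \<subseteq> ?h ` ?P"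
  proof
    fix p assume "p \<in> Sigma ?S resonant"
    then obtain lam n j where p: "p = (lam, n)" "lam \<le> K\<^sup>2" "n < N" "j \<ge> 1" "lam = (real j * pi / (b n - a n))\<^sup>2"
      by (auto simp: resonant_def)
    then have "(n, j) \<in> ?P" using resonant_le[OF assms, of n j] by auto
    then show "p \<in> ?h ` ?P" using p by (intro image_eqI[of _ _ "(n, j)"]) auto
  qed
  have fP: "finite (?h ` ?P)" by auto
  have pos: "resonant lam \<noteq> {}" if "lam \<in> ?S" for lam
  proof -
    have "0 < card (resonant lam)" using that dir_multiplicity_le[of lam] by force
    then show ?thesis by (simp add: card_gt_0_iff)
  qed
  have "?S \<subseteq> fst ` Sigma ?S resonant" using pos by force
  then show fS: "finite ?S" using sub fP by (meson finite_imageI finite_subset)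
  have "eig_count N a b (dir_sol N a b) (K\<^sup>2) \<le> (\<Sum>lam\<in>?S. card (resonant lam))"
    unfolding eig_count_def by (intro sum_mono dir_multiplicity_le)
  also have "\<dots> = card (Sigma ?S resonant)" using fS by (simp add: resonant_def)
  also have "\<dots> \<le> card (?h ` ?P)" by (rule card_mono[OF fP sub])
  also have "\<dots> \<le> card ?P" by (rule card_image_le) auto
  also have "\<dots> = (\<Sum>n<N. dir_number K n)" by simp
  finally show "eig_count N a b (dir_sol N a b) (K\<^sup>2) \<le> (\<Sum>n<N. dir_number K n)" .
qed

lemma dir_multiplicity_pos:
  assumes "n < N" "1 \<le> j"
  shows "0 < multiplicity N a b (dir_sol N a b) ((real j * pi / (b n - a n))\<^sup>2)"
proof -
  define t where "t = real j * pi / (b n - a n)"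
  have L: "b n - a n > 0" using len[OF assms(1)] by simp
  have t: "t > 0" unfolding t_def using L assms(2) by (intro divide_pos_pos mult_pos_pos) auto
  define f where "f e x = (if e = n then Sn t (x - a n) else 0)" for e x
  define f' where "f' e x = (if e = n then Cs t (x - a n) else 0)" for e x
  have "dir_sol N a b (t\<^sup>2) f" unfolding dir_sol_def
  proof (intro conjI ballI)
    show "edge_ode N a b (t\<^sup>2) f"
    proof (rule edge_odeI[OF len])
      fix e
      show "ode_on (a e) (b e) (t\<^sup>2) (f e) (f' e)"
        unfolding ode_on_def f_def f'_def by (cases "e = n") (auto intro!: derivative_eq_intros)
    qed
    have "t * (b n - a n) = real j * pi" unfolding t_def using L by simp
    then have "sin (t * (b n - a n)) = 0" by (simp only: sin_npi)
    then have "Sn t (b n - a n) = 0" using t by (simp add: Sn_def)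
    then show "end_val a b f p = 0" for p by (simp add: end_val_def f_def)
  qed
  moreover have "lin_indep_on N a b 1 (\<lambda>_. f)" unfolding lin_indep_on_def
  proof (intro allI impI)
    fix c :: "nat \<Rightarrow> real" and i :: nat
    assume z: "\<forall>n<N. \<forall>x\<in>{a n..b n}. (\<Sum>i<1. c i * f n x) = 0" and i: "i < 1"
    \<comment> \<open>A point of the edge with 0 < t h <= 1 < pi, where \<open>Sn\<close> is
      positive.\<close>
    define h where "h = min (b n - a n) (1 / t)"
    have h: "0 < h" "h \<le> b n - a n" "t * h < pi"
    proof -
      show "0 < h" "h \<le> b n - a n" using L t by (auto simp: h_def)
      have "t * h \<le> t * (1 / t)" using t by (intro mult_left_mono) (auto simp: h_def)
      then show "t * h < pi" using t pi_gt3 by simp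
    qed
    have "Sn t h > 0" using Sn_pos[OF _ h(1,3)] t by simp
    moreover have "c 0 * f n (a n + h) = 0" using z assms(1) h L by auto
    ultimately show "c i = 0" using i by (simp add: f_def)
  qed
  moreover have "bdd_above {k. \<exists>g. (\<forall>i<k. dir_sol N a b (t\<^sup>2) (g i)) \<and> lin_indep_on N a b k g}"
    using dir_independent_le by (intro bdd_aboveI[of _ "card (resonant (t\<^sup>2))"]) blast
  ultimately have "1 \<le> multiplicity N a b (dir_sol N a b) (t\<^sup>2)"
    unfolding multiplicity_def by (intro cSup_upper) auto
  then show ?thesis by (simp add: t_def)
qed

text \<open>Makes the set behind each Dirichlet eigenvalue nonempty, so that its infimum is
  meaningful. Edge 0 alone supplies \<open>k\<close> eigenvalues.\<close>

lemma dir_eig_count_unbounded: "\<exists>mu. k \<le> eig_count N a b (dir_sol N a b) mu"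
proof -
  have N: "0 < N" using graph by (simp add: metric_graph_def)
  then have L: "b 0 - a 0 > 0" using len by simp
  define ev where "ev j = (real j * pi / (b 0 - a 0))\<^sup>2" for j
  define K where "K = real k * pi / (b 0 - a 0)"
  have K: "0 \<le> K" using L by (simp add: K_def)
  let ?S = "{lam. lam \<le> K\<^sup>2 \<and> 0 < multiplicity N a b (dir_sol N a b) lam}"
  have "inj_on ev {1..k}"
    using L by (intro inj_onI) (simp add: ev_def power2_eq_iff_nonneg)
  then have "k = card (ev ` {1..k})" by (simp add: card_image)
  also have "\<dots> \<le> card ?S"
  proof (rule card_mono[OF dir_spectrum(1)[OF K]])
    show "ev ` {1..k} \<subseteq> ?S"
    proof
      fix y assume "y \<in> ev ` {1..k}"
      then obtain j where j: "1 \<le> j" "j \<le> k" "y = ev j" by auto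
      have "y \<le> K\<^sup>2" unfolding j ev_def K_def using j(2) L
        by (intro power_mono divide_right_mono mult_right_mono) auto
      then show "y \<in> ?S" using dir_multiplicity_pos[OF N j(1)] by (simp add: j(3) ev_def)
    qed
  qed
  also have "\<dots> = (\<Sum>lam\<in>?S. 1)" by simp
  also have "\<dots> \<le> eig_count N a b (dir_sol N a b) (K\<^sup>2)"
    unfolding eig_count_def by (intro sum_mono) auto
  finally show ?thesis by blast
qed

end

section \<open>Gluing test functions by linear algebra\<close>

context subdivided
begin

(* The unknowns are the coefficients of the test functions and one value for every vertex; each
   endpoint in P gives one linear equation, and by assumption these imply continuity. *)
lemma glue:
  fixes g :: "'i \<Rightarrow> nat \<Rightarrow> real \<Rightarrow> real"
  assumes ef: "eigenfamily N a b I lam g" and lam: "\<And>i. i \<in> I \<Longrightarrow> lam i \<le> K\<^sup>2"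
    and ind: "\<And>c i. (\<And>n x. n < N \<Longrightarrow> x \<in> {a n..b n} \<Longrightarrow> (\<Sum>i\<in>I. c i * g i n x) = 0) \<Longrightarrow> i \<in> I \<Longrightarrow> c i = 0"
    and P: "finite P"
    and match: "\<And>c y n s. (\<And>p. p \<in> P \<Longrightarrow> (\<Sum>i\<in>I. c i * end_val a b (g i) p) = y (vert V p)) \<Longrightarrow> n < N \<Longrightarrow>
      (\<Sum>i\<in>I. c i * end_val a b (g i) (n, s)) = y (vert V (n, s))"
    and PE: "P \<subseteq> endpoints N"
  shows "card I + card V \<le> eig_count N a b (std_sol N a b V) (K\<^sup>2) + card P"
proof -
  interpret ef: eigenfamily N a b I lam g by (rule ef)
  define U :: "('i + endpoint set) set" where "U = Inl ` I \<union> Inr ` V"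
  have U: "finite U" unfolding U_def using ef.fin finite_V by auto
  have sumU: "(\<Sum>u\<in>U. h u) = (\<Sum>i\<in>I. h (Inl i)) + (\<Sum>v\<in>V. h (Inr v))" for h :: "_ \<Rightarrow> real"
    unfolding U_def using ef.fin finite_V
    by (subst sum.union_disjoint) (auto simp: sum.reindex)
  have cardU: "card U = card I + card V"
    unfolding U_def using ef.fin finite_V by (subst card_Un_disjoint) (auto simp: card_image)
  \<comment> \<open>The equation for \<open>p\<close>: the value of the combination at
    \<open>p\<close> minus the unknown at the vertex of \<open>p\<close>.\<close>
  define A where "A p u = (case u of Inl i \<Rightarrow> end_val a b (g i) p | Inr v \<Rightarrow> - kron (vert V p) v)" for p u
  obtain J and C0 :: "('i + endpoint set) \<Rightarrow> ('i + endpoint set) \<Rightarrow> real"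
    where J: "J \<subseteq> U" "card U \<le> card J + card P" "indep_on U J C0"
      and ker0: "\<And>j p. j \<in> J \<Longrightarrow> p \<in> P \<Longrightarrow> (\<Sum>u\<in>U. A p u * C0 j u) = 0"
    using kernel_family[OF U P, of A] by blast
  define d where "d = card J"
  have fJ: "finite J" using J(1) U finite_subset by blast
  obtain h where h: "bij_betw h {..<d} J" using ex_bij_betw_nat_finite[OF fJ] by (auto simp: d_def atLeast0LessThan)
  define C where "C = C0 \<circ> h"
  have C: "indep_on U {..<d} C" unfolding C_def by (rule indep_on_reindex[OF J(3) h])
  have ker: "(\<Sum>u\<in>U. A p u * C j u) = 0" if "j < d" "p \<in> P" for j p
    using ker0[of "h j" p] that h by (auto simp: C_def bij_betw_def)
  define F where "F z n x = (\<Sum>i\<in>I. z (Inl i) * g i n x)" for z :: "'i + endpoint set \<Rightarrow> real" and n x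
  \<comment> \<open>At a vertex the node value is the unknown itself, at an inner node it comes from
    the test combination. On solutions of the equations both prescriptions agree at edge ends, see
    \<open>node\<close>.\<close>
  define Y where "Y z u = (case u of Inl v \<Rightarrow> z (Inr v) | Inr (e, j) \<Rightarrow> F z e (a e + real j * l e))"
    for z :: "'i + endpoint set \<Rightarrow> real" and u :: node
  have Ylin: "lincomb {..<d} (\<lambda>j. Y (C j)) c u = Y (lincomb {..<d} C c) u" for c u
  proof (cases u)
    case (Inr p)
    obtain e j where p: "p = (e, j)" by (cases p)
    have "(\<Sum>k<d. c k * (\<Sum>i\<in>I. C k (Inl i) * g i e x)) = (\<Sum>i\<in>I. (\<Sum>k<d. c k * C k (Inl i)) * g i e x)" for x
      unfolding sum_distrib_left sum_distrib_right by (subst sum.swap) (simp add: mult_ac)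
    then show ?thesis using Inr p by (simp add: lincomb_def Y_def F_def)
  qed (simp add: lincomb_def Y_def)
  have solves: "(\<Sum>i\<in>I. lincomb {..<d} C c (Inl i) * end_val a b (g i) (n, s)) = lincomb {..<d} C c (Inr (vert V (n, s)))"
    if n: "n < N" for c n s
  proof (rule match[of "\<lambda>i. lincomb {..<d} C c (Inl i)" "\<lambda>v. lincomb {..<d} C c (Inr v)", OF _ n])
    fix p assume p: "p \<in> P"
    then have v: "vert V p \<in> V" using vert_mem[OF part, of p] PE by blast
    have "(\<Sum>u\<in>U. A p u * lincomb {..<d} C c u) = (\<Sum>k<d. c k * (\<Sum>u\<in>U. A p u * C k u))"
      unfolding lincomb_def sum_distrib_left by (subst sum.swap) (simp add: mult_ac)
    also have "\<dots> = 0" using ker p by simp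
    finally have "(\<Sum>i\<in>I. end_val a b (g i) p * lincomb {..<d} C c (Inl i))
        - (\<Sum>v\<in>V. kron (vert V p) v * lincomb {..<d} C c (Inr v)) = 0"
      unfolding sumU A_def by (simp add: sum_negf)
    then show "(\<Sum>i\<in>I. lincomb {..<d} C c (Inl i) * end_val a b (g i) p) = lincomb {..<d} C c (Inr (vert V p))"
      by (simp add: sum_kron finite_V v mult.commute)
  qed
  have node: "Y (lincomb {..<d} C c) (node_of e j) = F (lincomb {..<d} C c) e (a e + real j * l e)" if "e < N" "j \<le> m" for c e j
    using solves[OF that(1), of c False] solves[OF that(1), of c True] m
    by (auto simp: node_of_def Y_def F_def end_val_def ml)
  define F' where "F' z n x = (\<Sum>i\<in>I. z (Inl i) * edge_deriv a b (g i) n x)" for z :: "'i + endpoint set \<Rightarrow> real" and n x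
  have FC1: "edge_C1 N a b (F z) (F' z)" for z
    using edge_C1_sum[OF ef.C1, where c = "\<lambda>i. z (Inl i)"] unfolding F_def F'_def by simp
  have en: "energy N a b (K\<^sup>2) (F z) (F' z) \<le> 0" for z
    using ef.energy_nonpos[OF lam, where c = "\<lambda>i. z (Inl i)"] unfolding F_def F'_def by simp
  have "nonpos d K" unfolding nonpos_def
  proof (intro exI[of _ "\<lambda>j. Y (C j)"] conjI allI)
    fix c
    have "bil K (Y (lincomb {..<d} C c)) (Y (lincomb {..<d} C c)) \<le> energy N a b (K\<^sup>2) (F (lincomb {..<d} C c)) (F' (lincomb {..<d} C c))"
      by (rule bil_le_energy[OF FC1 node])
    also have "\<dots> \<le> 0" by (rule en)
    finally show "bil K (lincomb {..<d} (\<lambda>j. Y (C j)) c) (lincomb {..<d} (\<lambda>j. Y (C j)) c) \<le> 0"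
      by (simp add: Ylin cong: bil_cong)
  next
    \<comment> \<open>Zero node values force \<open>F\<close> to vanish by
      \<open>zero_at_nodes\<close>, which kills the coefficients of the test functions; the vertex
      unknowns are node values themselves.\<close>
    show "indep_on X {..<d} (\<lambda>j. Y (C j))"
    proof (rule indep_onI)
      fix c j assume z: "\<And>u. u \<in> X \<Longrightarrow> lincomb {..<d} (\<lambda>j. Y (C j)) c u = 0" and j: "j \<in> {..<d}"
      let ?z = "lincomb {..<d} C c"
      have "F ?z n x = 0" if "n < N" "x \<in> {a n..b n}" for n x
      proof (rule zero_at_nodes[OF FC1 en _ that])
        show "F ?z e (a e + real j * l e) = 0" if "e < N" "j \<le> m" for e j
          using node[OF that, of c] z[OF node_of_X[OF that]] by (simp add: Ylin)
      qed
      then have I0: "?z (Inl i) = 0" if "i \<in> I" for i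
        using ind[of "\<lambda>i. ?z (Inl i)" i] that unfolding F_def by blast
      have V0: "?z (Inr v) = 0" if "v \<in> V" for v
        using z[of "Inl v"] that unfolding Ylin by (simp add: X_def Y_def)
      show "c j = 0"
        using I0 V0 j by (intro indep_onD[OF C, of c j]) (auto simp: U_def)
    qed
  qed
  then have "d \<le> eig_count N a b (std_sol N a b V) (K\<^sup>2)" by (rule nonpos_imp_eig_count)
  then show ?thesis using J(2) by (simp add: cardU d_def)
qed

end

section \<open>Test functions on edges and cycles\<close>


lemma sum_floor_le:
  fixes L :: "nat \<Rightarrow> real"
  assumes S: "finite S" and L: "\<And>e. e \<in> S \<Longrightarrow> 0 < L e" and K: "0 \<le> K"
    and even: "\<And>h. h \<in> S \<Longrightarrow> \<exists>\<nu> :: nat \<Rightarrow> int. (\<forall>e\<in>S. \<nu> e \<in> {-1, 1}) \<and>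
       (\<exists>m :: int. (\<Sum>e\<in>S. of_int (\<nu> e) * L e) / L h = 2 * of_int m)"
  shows "(\<Sum>e\<in>S. nat \<lfloor>K * L e / pi\<rfloor>) \<le> 2 * nat \<lfloor>K * (\<Sum>e\<in>S. L e) / (2 * pi)\<rfloor>"
proof -
  define q where "q e = \<lfloor>K * L e / pi\<rfloor>" for e
  have q0: "0 \<le> q e" if "e \<in> S" for e using L[OF that] K by (simp add: q_def)
  define S' where "S' = {e \<in> S. 0 < q e}"
  (* Lower K to the largest K' for which some t h = K' L h / pi is a positive integer; no floor on
     the left changes. For the sign choice of h, sum t A - sum t B is an even integer, hence
     2 floor (sum t S / 2) = floor (sum t A) + floor (sum t B). *)
  have "(\<Sum>e\<in>S. q e) \<le> 2 * \<lfloor>K * (\<Sum>e\<in>S. L e) / (2 * pi)\<rfloor>"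
  proof (cases "S' = {}")
    case True
    then have "(\<Sum>e\<in>S. q e) = 0" using q0 by (intro sum.neutral) (force simp: S'_def)
    moreover have "0 \<le> K * (\<Sum>e\<in>S. L e) / (2 * pi)" using K L by (intro divide_nonneg_nonneg mult_nonneg_nonneg sum_nonneg) (auto intro: less_imp_le)
    ultimately show ?thesis by simp
  next
    case False
    have fS': "finite S'" using S by (simp add: S'_def)
    \<comment> \<open>\<open>r e\<close> is the smallest parameter at which edge \<open>e\<close>
      still attains \<open>q e\<close>, so the maximum over \<open>S'\<close> is the smallest one
      that keeps all floors.\<close>
    define r where "r e = of_int (q e) * pi / L e" for e
    define K' where "K' = Max (r ` S')"
    have "K' \<in> r ` S'" unfolding K'_def using fS' False by (intro Max_in) auto
    then obtain h where h: "h \<in> S'" "K' = r h" by auto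
    then have hS: "h \<in> S" "0 < q h" by (auto simp: S'_def)
    have r_le: "r e \<le> K" if "e \<in> S" for e
    proof -
      have "of_int (q e) \<le> K * L e / pi" by (simp add: q_def)
      then show ?thesis using L[OF that] by (simp add: r_def field_simps)
    qed
    have K': "K' \<le> K" "0 \<le> K'" using r_le[OF hS(1)] L[OF hS(1)] hS(2) by (auto simp: h(2) r_def)
    define t where "t e = K' * L e / pi" for e
    have th: "t h = of_int (q h)" using L[OF hS(1)] by (simp add: t_def h(2) r_def)
    have t_ge: "of_int (q e) \<le> t e" if "e \<in> S" for e
    proof (cases "0 < q e")
      case True
      then have "r e \<le> K'" unfolding K'_def using fS' that by (intro Max_ge) (auto simp: S'_def)
      then show ?thesis using L[OF that] by (simp add: r_def t_def field_simps)
    next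
      case False
      then have "q e = 0" using q0[OF that] by simp
      then show ?thesis using L[OF that] K' by (simp add: t_def)
    qed
    obtain \<nu> :: "nat \<Rightarrow> int" and m :: int where \<nu>: "\<And>e. e \<in> S \<Longrightarrow> \<nu> e \<in> {-1, 1}"
      "(\<Sum>e\<in>S. of_int (\<nu> e) * L e) / L h = 2 * of_int m" using even[OF hS(1)] by blast
    define A where "A = {e \<in> S. \<nu> e = 1}"
    define B where "B = {e \<in> S. \<nu> e = -1}"
    have AB: "S = A \<union> B" "A \<inter> B = {}" "finite A" "finite B" using \<nu>(1) S by (auto simp: A_def B_def)
    have "(\<Sum>e\<in>S. of_int (\<nu> e) * t e) = K' / pi * (\<Sum>e\<in>S. of_int (\<nu> e) * L e)"
      by (simp add: t_def sum_distrib_left mult_ac)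
    also have "(\<Sum>e\<in>S. of_int (\<nu> e) * L e) = 2 * of_int m * L h"
      using \<nu>(2) L[OF hS(1)] by (simp add: field_simps)
    also have "K' / pi * (2 * of_int m * L h) = 2 * of_int m * t h" by (simp add: t_def)
    finally have "(\<Sum>e\<in>S. of_int (\<nu> e) * t e) = of_int (2 * m * q h)" by (simp add: th)
    moreover have "(\<Sum>e\<in>S. of_int (\<nu> e) * t e) = (\<Sum>e\<in>A. of_int (\<nu> e) * t e) + (\<Sum>e\<in>B. of_int (\<nu> e) * t e)"
      unfolding AB(1) by (rule sum.union_disjoint[OF AB(3,4,2)])
    moreover have "(\<Sum>e\<in>A. of_int (\<nu> e) * t e) = sum t A" by (intro sum.cong) (auto simp: A_def)
    moreover have "(\<Sum>e\<in>B. of_int (\<nu> e) * t e) = - sum t B"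
      unfolding sum_negf[symmetric] by (intro sum.cong) (auto simp: B_def)
    ultimately have PM: "sum t A = sum t B + of_int (2 * m * q h)" by simp
    have tot: "sum t S = sum t A + sum t B" unfolding AB(1) by (rule sum.union_disjoint[OF AB(3,4,2)])
    have "sum t S / 2 = sum t B + of_int (m * q h)" using PM tot by simp
    then have "\<lfloor>sum t S / 2\<rfloor> = \<lfloor>sum t B\<rfloor> + m * q h" by (simp only: floor_add_int[symmetric])
    moreover have "\<lfloor>sum t A\<rfloor> = \<lfloor>sum t B\<rfloor> + 2 * m * q h" unfolding PM by (simp only: floor_add_int[symmetric])
    ultimately have dir_number: "2 * \<lfloor>sum t S / 2\<rfloor> = \<lfloor>sum t A\<rfloor> + \<lfloor>sum t B\<rfloor>" by simp
    have part: "sum q C \<le> \<lfloor>sum t C\<rfloor>" if "C \<subseteq> S" for C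
      using that t_ge by (simp add: le_floor_iff) (intro sum_mono, auto)
    have "sum q S = sum q A + sum q B" unfolding AB(1) by (rule sum.union_disjoint[OF AB(3,4,2)])
    also have "\<dots> \<le> 2 * \<lfloor>sum t S / 2\<rfloor>" unfolding dir_number using part[of A] part[of B] AB(1) by auto
    also have "\<dots> \<le> 2 * \<lfloor>K * (\<Sum>e\<in>S. L e) / (2 * pi)\<rfloor>"
    proof -
      have "sum t S / 2 = K' * (\<Sum>e\<in>S. L e) / (2 * pi)"
        unfolding t_def by (simp add: sum_divide_distrib sum_distrib_left mult_ac)
      also have "\<dots> \<le> K * (\<Sum>e\<in>S. L e) / (2 * pi)"
        using K' L by (intro divide_right_mono mult_right_mono sum_nonneg) (auto intro: less_imp_le)
      finally show ?thesis by (intro mult_left_mono floor_mono) auto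
    qed
    finally show ?thesis .
  qed
  moreover have "int (\<Sum>e\<in>S. nat (q e)) = (\<Sum>e\<in>S. q e)"
    using q0 by simp
  ultimately show ?thesis unfolding q_def by linarith
qed

(* Arc length coordinate along a cycle: cycle_orient says whether edge n is traversed from a n to
   b n, and functions on the circle are pulled back by cycle_lift, their derivatives by cycle_lift'. *)
definition cycle_pos :: "(nat \<Rightarrow> real) \<Rightarrow> (nat \<Rightarrow> real) \<Rightarrow> (nat \<Rightarrow> nat) \<Rightarrow> nat \<Rightarrow> real" where
  "cycle_pos a b es i = (\<Sum>j<i. b (es j) - a (es j))"

definition cycle_orient :: "nat \<Rightarrow> (nat \<Rightarrow> nat) \<Rightarrow> (nat \<Rightarrow> endpoint set) \<Rightarrow> nat \<Rightarrow> bool" where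
  "cycle_orient k es vs n \<longleftrightarrow> (let i = inv_into {..<k} es n in (n, False) \<in> vs i \<and> (n, True) \<in> vs (Suc i mod k))"

definition cycle_coord :: "(nat \<Rightarrow> real) \<Rightarrow> (nat \<Rightarrow> real) \<Rightarrow> nat \<Rightarrow> (nat \<Rightarrow> nat) \<Rightarrow> (nat \<Rightarrow> endpoint set) \<Rightarrow> nat \<Rightarrow> real \<Rightarrow> real" where
  "cycle_coord a b k es vs n x = cycle_pos a b es (inv_into {..<k} es n) + (if cycle_orient k es vs n then x - a n else b n - x)"

definition cycle_lift :: "(nat \<Rightarrow> real) \<Rightarrow> (nat \<Rightarrow> real) \<Rightarrow> nat \<Rightarrow> (nat \<Rightarrow> nat) \<Rightarrow> (nat \<Rightarrow> endpoint set) \<Rightarrow> (real \<Rightarrow> real) \<Rightarrow> nat \<Rightarrow> real \<Rightarrow> real" where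
  "cycle_lift a b k es vs G n x = (if n \<in> es ` {..<k} then G (cycle_coord a b k es vs n x) else 0)"

definition cycle_lift' :: "(nat \<Rightarrow> real) \<Rightarrow> (nat \<Rightarrow> real) \<Rightarrow> nat \<Rightarrow> (nat \<Rightarrow> nat) \<Rightarrow> (nat \<Rightarrow> endpoint set) \<Rightarrow> (real \<Rightarrow> real) \<Rightarrow> nat \<Rightarrow> real \<Rightarrow> real" where
  "cycle_lift' a b k es vs G n x = (if n \<in> es ` {..<k} then (if cycle_orient k es vs n then 1 else - 1) * G (cycle_coord a b k es vs n x) else 0)"

lemma (in mgraph) boundary_form_eq_deriv:
  assumes "\<And>n. n < N \<Longrightarrow> ode_on (a n) (b n) lam (f n) (f' n)"
  shows "boundary_form N a b f g = (\<Sum>n<N. f' n (b n) * g n (b n) - f' n (a n) * g n (a n))"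
  unfolding boundary_form_def
proof (intro sum.cong refl)
  fix n assume "n \<in> {..<N}"
  then have n: "n < N" by simp
  have "edge_deriv a b f n x = f' n x" if "x \<in> {a n..b n}" for x
    using edge_deriv_eq[of a n b lam f "f' n" x] len[OF n] assms[OF n] that by simp
  then show "edge_deriv a b f n (b n) * g n (b n) - edge_deriv a b f n (a n) * g n (a n) =
    f' n (b n) * g n (b n) - f' n (a n) * g n (a n)" using len[OF n] by simp
qed

locale cycle = mgraph +
  fixes k :: nat and es :: "nat \<Rightarrow> nat" and vs :: "nat \<Rightarrow> endpoint set"
  assumes cyc: "cycle_data N V k es vs"
begin

abbreviation "pos \<equiv> cycle_pos a b es"
abbreviation "ori \<equiv> cycle_orient k es vs"
abbreviation "phi \<equiv> cycle_coord a b k es vs"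
abbreviation "lift \<equiv> cycle_lift a b k es vs"
abbreviation "lift' \<equiv> cycle_lift' a b k es vs"
abbreviation "circ \<equiv> pos k"

lemma k: "1 \<le> k" and inj: "inj_on es {..<k}" and es: "i < k \<Longrightarrow> es i < N"
  and joins: "i < k \<Longrightarrow> joins V (es i) (vs i) (vs (Suc i mod k))"
  using cyc by (auto simp: cycle_data_def)

lemma ix: "i < k \<Longrightarrow> inv_into {..<k} es (es i) = i"
  using inj by simp

lemma ori_iff: "i < k \<Longrightarrow> ori (es i) \<longleftrightarrow> (es i, False) \<in> vs i \<and> (es i, True) \<in> vs (Suc i mod k)"
  by (simp add: cycle_orient_def ix)

text \<open>\<open>joins\<close> allows both directions; if the forward one fails, the reversed one
  must hold. As \<open>True\<close> marks the right end, an edge starts at \<open>\<not> ori\<close>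
  and finishes at \<open>ori\<close>.\<close>

lemma start_mem: "i < k \<Longrightarrow> (es i, \<not> ori (es i)) \<in> vs i"
  and finish_mem: "i < k \<Longrightarrow> (es i, ori (es i)) \<in> vs (Suc i mod k)"
proof -
  assume i: "i < k"
  have "(es i, \<not> ori (es i)) \<in> vs i \<and> (es i, ori (es i)) \<in> vs (Suc i mod k)"
  proof (cases "ori (es i)")
    case True
    then show ?thesis using ori_iff[OF i] by simp
  next
    case False
    then have "(es i, True) \<in> vs i" "(es i, False) \<in> vs (Suc i mod k)"
      using ori_iff[OF i] joins[OF i] unfolding joins_def by blast+
    then show ?thesis using False by simp
  qed
  then show "(es i, \<not> ori (es i)) \<in> vs i" "(es i, ori (es i)) \<in> vs (Suc i mod k)" by blast+
qed

lemma vs_V: "i < k \<Longrightarrow> vs i \<in> V"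
  using joins by (simp add: joins_def)

lemma vert_start: "i < k \<Longrightarrow> vert V (es i, \<not> ori (es i)) = vs i"
  by (rule vert_eq[OF part vs_V start_mem])

lemma vert_finish: "i < k \<Longrightarrow> vert V (es i, ori (es i)) = vs (Suc i mod k)"
  using k by (intro vert_eq[OF part vs_V finish_mem]) auto

lemma phi_start: "i < k \<Longrightarrow> phi (es i) (if ori (es i) then a (es i) else b (es i)) = pos i"
  by (simp add: cycle_coord_def ix)

lemma phi_finish: "i < k \<Longrightarrow> phi (es i) (if ori (es i) then b (es i) else a (es i)) = pos (Suc i)"
  by (simp add: cycle_coord_def ix cycle_pos_def)

lemma end_val_start: "i < k \<Longrightarrow> end_val a b (lift G) (es i, \<not> ori (es i)) = G (pos i)"
  using phi_start[of i] by (auto simp: end_val_def cycle_lift_def)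

lemma end_val_finish: "i < k \<Longrightarrow> end_val a b (lift G) (es i, ori (es i)) = G (pos (Suc i))"
  using phi_finish[of i] by (auto simp: end_val_def cycle_lift_def)

lemma circ_pos: "0 < circ"
proof -
  have "{..<k} \<noteq> {}" using k by (simp add: lessThan_empty_iff)
  then show ?thesis unfolding cycle_pos_def using len es by (intro sum_pos) auto
qed

lemma circ_eq: "circ = (\<Sum>e\<in>es ` {..<k}. b e - a e)"
  unfolding cycle_pos_def by (simp add: sum.reindex[OF inj])

text \<open>Reversing an edge changes the sign of the first derivative only: \<open>\<sigma>\<close>
  occurs squared in the second.\<close>

lemma lift_ode:
  assumes G: "\<And>x. (G has_real_derivative G' x) (at x)" and G': "\<And>x. (G' has_real_derivative (- lam * G x)) (at x)"
  shows "ode_on (a n) (b n) lam (lift G n) (lift' G' n)"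
proof (cases "n \<in> es ` {..<k}")
  case True
  define \<sigma> where "\<sigma> = (if ori n then 1 else - 1 :: real)"
  have phi: "(phi n has_real_derivative \<sigma>) (at x within A)" for x A
    unfolding cycle_coord_def \<sigma>_def by (auto intro!: derivative_eq_intros)
  have 1: "((\<lambda>x. G (phi n x)) has_real_derivative G' (phi n x) * \<sigma>) (at x within A)" for x A
    by (rule DERIV_chain2[OF G phi])
  have 2: "((\<lambda>x. \<sigma> * G' (phi n x)) has_real_derivative \<sigma> * (- lam * G (phi n x) * \<sigma>)) (at x within A)" for x A
    by (intro DERIV_cmult DERIV_chain2[OF G' phi])
  have eq: "\<sigma> * (- lam * G (phi n x) * \<sigma>) = - lam * G (phi n x)" for x
    by (simp add: \<sigma>_def)
  show ?thesis using 1 2[unfolded eq] True unfolding ode_on_def cycle_lift_def cycle_lift'_def \<sigma>_def[symmetric]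
    by (simp add: mult.commute)
next
  case False
  then show ?thesis unfolding ode_on_def cycle_lift_def cycle_lift'_def by simp
qed

text \<open>Along the cycle the boundary terms telescope, since reversing an edge swaps its ends and
  also flips the derivative. What remains compares the coordinates 0 and
  \<open>circ\<close>.\<close>

lemma boundary_form_lift:
  assumes G: "\<And>x. (G has_real_derivative G' x) (at x)" and G': "\<And>x. (G' has_real_derivative (- lam * G x)) (at x)"
  shows "boundary_form N a b (lift G) (lift H) = G' circ * H circ - G' 0 * H 0"
proof -
  define W where "W x = G' x * H x" for x
  have "boundary_form N a b (lift G) (lift H) = (\<Sum>n<N. lift' G' n (b n) * lift H n (b n) - lift' G' n (a n) * lift H n (a n))"
    by (rule boundary_form_eq_deriv[OF lift_ode[OF G G']])
  also have "\<dots> = (\<Sum>n\<in>es ` {..<k}. lift' G' n (b n) * lift H n (b n) - lift' G' n (a n) * lift H n (a n))"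
    using es by (intro sum.mono_neutral_right) (auto simp: cycle_lift_def)
  also have "\<dots> = (\<Sum>i<k. W (pos (Suc i)) - W (pos i))"
    unfolding sum.reindex[OF inj] o_def
  proof (intro sum.cong refl)
    fix i assume "i \<in> {..<k}"
    then have i: "i < k" by simp
    show "lift' G' (es i) (b (es i)) * lift H (es i) (b (es i)) - lift' G' (es i) (a (es i)) * lift H (es i) (a (es i)) =
      W (pos (Suc i)) - W (pos i)"
      using phi_start[OF i] phi_finish[OF i] i by (cases "ori (es i)") (simp_all add: cycle_lift_def cycle_lift'_def W_def)
  qed
  also have "\<dots> = W (pos k) - W (pos 0)" by (rule sum_lessThan_telescope)
  finally show ?thesis by (simp add: W_def cycle_pos_def)
qed

end

(* (block, frequency number, sine flag), where the block Inl n is a single edge and Inr e is the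
   cycle attached to e. *)
type_synonym test_index = "(nat + nat) \<times> nat \<times> bool"

section \<open>Test functions for edge disjoint cycles and the remaining edges\<close>

locale cactus = subdivided +
  fixes F :: "nat set" and k :: "nat \<Rightarrow> nat" and es :: "nat \<Rightarrow> nat \<Rightarrow> nat" and vs :: "nat \<Rightarrow> nat \<Rightarrow> endpoint set"
  assumes finite_F: "finite F" and cyc: "\<And>e. e \<in> F \<Longrightarrow> cycle_data N V (k e) (es e) (vs e)"
    and disj: "\<And>e e'. e \<in> F \<Longrightarrow> e' \<in> F \<Longrightarrow> e \<noteq> e' \<Longrightarrow> es e ` {..<k e} \<inter> es e' ` {..<k e'} = {}"
begin

lemma cycle: "e \<in> F \<Longrightarrow> cycle N a b V (k e) (es e) (vs e)"
  using cyc by unfold_locales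

definition cycle_edges :: "nat \<Rightarrow> nat set" where "cycle_edges e = es e ` {..<k e}"
definition single :: "nat set" where "single = {..<N} - (\<Union>e\<in>F. cycle_edges e)"
definition circ :: "nat \<Rightarrow> real" where "circ e = cycle_pos a b (es e) (k e)"
text \<open>For each cycle, \<open>2 * max_freq e\<close> nonconstant periodic functions have
  frequency at most K; \<open>sum_floor_le\<close> compares this number with the Dirichlet count on
  its edges.\<close>

definition max_freq :: "nat \<Rightarrow> nat" where "max_freq e = nat \<lfloor>K * circ e / (2 * pi)\<rfloor>"

text \<open>Cosines start at j = 0, the constants. The sines in \<open>I3\<close> start at j = 1,
  because \<open>Sn 0\<close> is the identity and not periodic.\<close>

definition I1 :: "test_index set" where "I1 = (\<lambda>(n, j). (Inl n, j, False)) ` (SIGMA n:single. {..dir_number K n})"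
definition I2 :: "test_index set" where "I2 = (\<lambda>(e, j). (Inr e, j, False)) ` (SIGMA e:F. {..max_freq e})"
definition I3 :: "test_index set" where "I3 = (\<lambda>(e, j). (Inr e, j, True)) ` (SIGMA e:F. {1..max_freq e})"
definition I :: "test_index set" where "I = I1 \<union> I2 \<union> I3"

definition freq :: "test_index \<Rightarrow> real" where
  "freq i = (case i of (Inl n, j, s) \<Rightarrow> real j * pi / (b n - a n) | (Inr e, j, s) \<Rightarrow> 2 * real j * pi / circ e)"

definition trig :: "test_index \<Rightarrow> real \<Rightarrow> real" where
  "trig i x = (if snd (snd i) then Sn (freq i) x else Cs (freq i) x)"

definition trig' :: "test_index \<Rightarrow> real \<Rightarrow> real" where
  "trig' i x = (if snd (snd i) then Cs (freq i) x else - (freq i)\<^sup>2 * Sn (freq i) x)"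

definition test_fun :: "test_index \<Rightarrow> nat \<Rightarrow> real \<Rightarrow> real" where
  "test_fun i n x = (case fst i of Inl n' \<Rightarrow> if n = n' then trig i (x - a n) else 0
     | Inr e \<Rightarrow> cycle_lift a b (k e) (es e) (vs e) (trig i) n x)"

definition test_fun' :: "test_index \<Rightarrow> nat \<Rightarrow> real \<Rightarrow> real" where
  "test_fun' i n x = (case fst i of Inl n' \<Rightarrow> if n = n' then trig' i (x - a n) else 0
     | Inr e \<Rightarrow> cycle_lift' a b (k e) (es e) (vs e) (trig' i) n x)"

definition block_edges :: "nat + nat \<Rightarrow> nat set" where
  "block_edges \<beta> = (case \<beta> of Inl n \<Rightarrow> {n} | Inr e \<Rightarrow> cycle_edges e)"

lemma finite_single: "finite single" by (simp add: single_def)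

lemma finite_I: "finite I"
  unfolding I_def I1_def I2_def I3_def using finite_single finite_F by auto

lemma I_iff:
  "(Inl n, j, s) \<in> I \<longleftrightarrow> n \<in> single \<and> j \<le> dir_number K n \<and> \<not> s"
  "(Inr e, j, s) \<in> I \<longleftrightarrow> e \<in> F \<and> j \<le> max_freq e \<and> (s \<longrightarrow> 1 \<le> j)"
  unfolding I_def I1_def I2_def I3_def by (cases s; force simp: image_iff)+

lemma I_cases:
  assumes "i \<in> I"
  obtains (single) n j where "i = (Inl n, j, False)" "n \<in> single" "j \<le> dir_number K n" "n < N"
  | (cos) e j where "i = (Inr e, j, False)" "e \<in> F" "j \<le> max_freq e"
  | (sin) e j where "i = (Inr e, j, True)" "e \<in> F" "1 \<le> j" "j \<le> max_freq e"
  using assms unfolding I_def I1_def I2_def I3_def by (auto simp: single_def)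

lemma circ_pos: "e \<in> F \<Longrightarrow> 0 < circ e"
  using cycle.circ_pos[OF cycle] by (simp add: circ_def)

lemma trig_deriv: "(trig i has_real_derivative trig' i x) (at x within A)"
  "(trig' i has_real_derivative - (freq i)\<^sup>2 * trig i x) (at x within A)"
  unfolding trig_def trig'_def by (cases "snd (snd i)"; auto intro!: derivative_eq_intros)+

lemma test_fun_ode: assumes "i \<in> I" "n < N" shows "ode_on (a n) (b n) ((freq i)\<^sup>2) (test_fun i n) (test_fun' i n)"
proof (cases "fst i")
  case (Inl n')
  have s: "((\<lambda>x. x - a n) has_real_derivative 1) (at x within A)" for x A by (auto intro!: derivative_eq_intros)
  have 1: "((\<lambda>x. trig i (x - a n)) has_real_derivative trig' i (x - a n)) (at x within A)" for x A
    using DERIV_chain2[OF trig_deriv(1) s] by simp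
  have 2: "((\<lambda>x. trig' i (x - a n)) has_real_derivative - (freq i)\<^sup>2 * trig i (x - a n)) (at x within A)" for x A
    using DERIV_chain2[OF trig_deriv(2) s] by simp
  show ?thesis using 1 2 unfolding ode_on_def test_fun_def test_fun'_def Inl by (cases "n = n'") simp_all
next
  case (Inr e)
  then have "e \<in> F" using assms(1) by (auto elim: I_cases)
  then show ?thesis using cycle.lift_ode[OF cycle trig_deriv] unfolding test_fun_def test_fun'_def Inr by simp
qed

lemma trig_period:
  assumes "i \<in> I" "fst i = Inr e"
  shows "trig i (circ e) = trig i 0" "trig' i (circ e) = trig' i 0"
proof -
  have "\<exists>j s. i = (Inr e, j, s) \<and> (s \<longrightarrow> 1 \<le> j) \<and> e \<in> F"
    by (cases rule: I_cases[OF assms(1)]) (use assms(2) in auto)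
  then obtain j s where i: "i = (Inr e, j, s)" "s \<Longrightarrow> 1 \<le> j" "e \<in> F" by blast
  have c: "circ e > 0" using circ_pos[OF i(3)] .
  define w where "w = freq i"
  have w: "w = 2 * real j * pi / circ e" unfolding w_def freq_def i(1) by simp
  have tr: "trig i x = (if s then Sn w x else Cs w x)"
    "trig' i x = (if s then Cs w x else - w\<^sup>2 * Sn w x)" for x
    unfolding trig_def trig'_def w_def[symmetric] by (simp_all add: i(1))
  have f: "w * circ e = 2 * real j * pi" unfolding w using c by simp
  have C: "Cs w (circ e) = 1" unfolding Cs_def f using cos_2npi[of j] by (simp add: mult_ac)
  have S: "Sn w (circ e) = 0" if "w \<noteq> 0"
    unfolding Sn_def f using that sin_2npi[of j] by (simp add: mult_ac)
  have "w \<noteq> 0" if s unfolding w using i(2)[OF that] c by simp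
  then show "trig i (circ e) = trig i 0" "trig' i (circ e) = trig' i 0"
    unfolding tr C using S by (cases s; cases "w = 0"; simp)+
qed

lemma test_fun_zero: assumes "n \<notin> block_edges (fst i)" shows "test_fun i n x = 0" "test_fun' i n x = 0"
  using assms unfolding test_fun_def test_fun'_def block_edges_def cycle_edges_def cycle_lift_def cycle_lift'_def by (cases "fst i"; auto)+

lemma block_edges_disjoint:
  assumes "i \<in> I" "i' \<in> I" "fst i \<noteq> fst i'"
  shows "block_edges (fst i) \<inter> block_edges (fst i') = {}"
  using assms disj by (elim I_cases) (auto simp: block_edges_def cycle_edges_def single_def)

text \<open>Different blocks have disjoint edges; on a single edge the derivative vanishes at both
  ends; on a cycle the two remaining terms cancel by periodicity.\<close>

lemma boundary_form_test_fun:
  assumes i: "i \<in> I" "i' \<in> I"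
  shows "boundary_form N a b (test_fun i) (test_fun i') = 0"
proof -
  have eq: "boundary_form N a b (test_fun i) (test_fun i') = (\<Sum>n<N. test_fun' i n (b n) * test_fun i' n (b n) - test_fun' i n (a n) * test_fun i' n (a n))"
    by (rule boundary_form_eq_deriv[OF test_fun_ode[OF i(1)]])
  show ?thesis
  proof (cases "fst i = fst i'")
    case False
    have z: "test_fun' i n x * test_fun i' n x = 0" for n x
      using block_edges_disjoint[OF i False] test_fun_zero[of n i x] test_fun_zero[of n i' x] by auto
    show ?thesis unfolding eq z by simp
  next
    case True
    show ?thesis
    proof (cases "fst i")
      case (Inl n)
      then obtain j where j: "i = (Inl n, j, False)" "n < N" using i(1) by (auto elim: I_cases)
      have L: "b n - a n > 0" using len[OF j(2)] by simp
      have f: "freq i * (b n - a n) = real j * pi" unfolding freq_def j(1) using L by simp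
      have "trig' i (b n - a n) = 0" unfolding trig'_def j(1) snd_conv Sn_def
        using f unfolding j(1) by (simp add: sin_npi)
      moreover have "trig' i 0 = 0" unfolding trig'_def j(1) by simp
      ultimately have "test_fun' i m (b m) = 0" "test_fun' i m (a m) = 0" for m
        unfolding test_fun'_def Inl by auto
      then show ?thesis unfolding eq by simp
    next
      case (Inr e)
      then have e: "e \<in> F" using i(1) by (auto elim: I_cases)
      have "test_fun i = cycle_lift a b (k e) (es e) (vs e) (trig i)" "test_fun i' = cycle_lift a b (k e) (es e) (vs e) (trig i')"
        using Inr True by (auto simp: test_fun_def fun_eq_iff)
      then have "boundary_form N a b (test_fun i) (test_fun i') = trig' i (circ e) * trig i' (circ e) - trig' i 0 * trig i' 0"
        using cycle.boundary_form_lift[OF cycle[OF e] trig_deriv] by (simp add: circ_def)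
      then show ?thesis using trig_period[OF i(1) Inr] trig_period[OF i(2)] Inr True by simp
    qed
  qed
qed

lemma freq_nonneg: "i \<in> I \<Longrightarrow> 0 \<le> freq i"
  using len circ_pos by (elim I_cases) (auto simp: freq_def intro!: divide_nonneg_pos)

lemma freq_le: assumes "i \<in> I" shows "freq i \<le> K"
  using assms
proof (cases rule: I_cases)
  case (single n j)
  have L: "b n - a n > 0" using len single by simp
  then have "real j \<le> K * (b n - a n) / pi"
    using single(3) K unfolding dir_number_def by (simp add: le_nat_iff le_floor_iff)
  then show ?thesis using L unfolding single(1) freq_def by (simp add: field_simps)
next
  case (cos e j)
  have c: "circ e > 0" using circ_pos cos by simp
  then have "real j \<le> K * circ e / (2 * pi)"
    using cos(3) K unfolding max_freq_def by (simp add: le_nat_iff le_floor_iff)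
  then show ?thesis using c unfolding cos(1) freq_def by (simp add: field_simps)
next
  case (sin e j)
  have c: "circ e > 0" using circ_pos sin by simp
  then have "real j \<le> K * circ e / (2 * pi)"
    using sin(4) K unfolding max_freq_def by (simp add: le_nat_iff le_floor_iff)
  then show ?thesis using c unfolding sin(1) freq_def by (simp add: field_simps)
qed

lemma freq_cong: "fst i = fst i' \<Longrightarrow> fst (snd i) = fst (snd i') \<Longrightarrow> freq i = freq i'"
  by (cases i; cases i') (auto simp: freq_def)

lemma freq_inj:
  assumes "i \<in> I" "i' \<in> I" "fst i = fst i'" "(freq i)\<^sup>2 = (freq i')\<^sup>2"
  shows "fst (snd i) = fst (snd i')"
proof -
  have "freq i = freq i'" using assms freq_nonneg by (simp add: power2_eq_iff_nonneg)
  moreover have "b n \<noteq> a n" if "n < N" for n using len[OF that] by simp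
  moreover have "circ e \<noteq> 0" if "e \<in> F" for e using circ_pos[OF that] by simp
  ultimately show ?thesis using assms(1-3)
    by (elim I_cases) (auto simp: freq_def)
qed

lemma eigenfamily_test_fun: "eigenfamily N a b I (\<lambda>i. (freq i)\<^sup>2) test_fun"
proof
  show "edge_ode N a b ((freq i)\<^sup>2) (test_fun i)" if "i \<in> I" for i
    by (rule edge_odeI[OF len test_fun_ode[OF that]])
qed (use len finite_I boundary_form_test_fun in auto)

text \<open>\<open>component_zero\<close> isolates one frequency and disjointness of the blocks
  isolates one block. What remains is a single cosine or a pair of cosine and sine, separated by
  evaluating at the start of an edge and at a nearby point.\<close>

lemma test_fun_independent:
  assumes z: "\<And>n x. n < N \<Longrightarrow> x \<in> {a n..b n} \<Longrightarrow> (\<Sum>i\<in>I. c i * test_fun i n x) = 0" and i: "i \<in> I"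
  shows "c i = 0"
proof -
  interpret ef: eigenfamily N a b I "\<lambda>i. (freq i)\<^sup>2" test_fun by (rule eigenfamily_test_fun)
  let ?A = "{i' \<in> I. (freq i')\<^sup>2 = (freq i)\<^sup>2}"
  let ?B = "{i' \<in> I. fst i' = fst i \<and> fst (snd i') = fst (snd i)}"
  have comp: "(\<Sum>i'\<in>?B. c i' * test_fun i' n x) = 0" if n: "n < N" "n \<in> block_edges (fst i)" "x \<in> {a n..b n}" for n x
  proof -
    have "(\<Sum>i'\<in>?B. c i' * test_fun i' n x) = (\<Sum>i'\<in>?A. c i' * test_fun i' n x)"
    proof (rule sum.mono_neutral_left)
      show "finite ?A" using finite_I by simp
      show "?B \<subseteq> ?A"
      proof
        fix i' assume "i' \<in> ?B"
        then show "i' \<in> ?A" using freq_cong[of i' i] by simp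
      qed
      show "\<forall>i'\<in>?A - ?B. c i' * test_fun i' n x = 0"
      proof
        fix i' assume i': "i' \<in> ?A - ?B"
        then have "fst i' \<noteq> fst i" using freq_inj[of i' i] i by auto
        then have "n \<notin> block_edges (fst i')" using block_edges_disjoint[of i' i] i i' n by auto
        then show "c i' * test_fun i' n x = 0" using test_fun_zero by simp
      qed
    qed
    also have "\<dots> = 0" using ef.component_zero[OF z n(1,3)] by simp
    finally show ?thesis .
  qed
  \<comment> \<open>The relation at arc length \<open>y\<close> on the first edge of the cycle: y =
    0 gives the cosine coefficient, a small y > 0 then the sine coefficient.\<close>
  have cyccase: "c (Inr e, j, False) * Cs w y + (if 1 \<le> j then c (Inr e, j, True) * Sn w y else 0) = 0"
    if e: "fst i = Inr e" "fst (snd i) = j" and y: "0 \<le> y" "y \<le> b (es e 0) - a (es e 0)" and w: "w = 2 * real j * pi / circ e"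
    for e j y w
  proof -
    have eF: "e \<in> F" and jJ: "j \<le> max_freq e" using i e by (auto elim: I_cases)
    interpret c: cycle N a b V "k e" "es e" "vs e" by (rule cycle[OF eF])
    let ?n = "es e 0"
    define x where "x = (if c.ori ?n then a ?n + y else b ?n - y)"
    have k0: "0 < k e" using c.k by simp
    have n: "?n < N" "?n \<in> es e ` {..<k e}" using c.es[of 0] k0 by auto
    have x: "x \<in> {a ?n..b ?n}" "c.phi ?n x = y"
      using y c.ix[of 0] k0 by (auto simp: x_def cycle_coord_def cycle_pos_def)
    have B: "?B = {(Inr e, j, False)} \<union> (if 1 \<le> j then {(Inr e, j, True)} else {})"
    proof (rule set_eqI)
      fix i' :: test_index
      obtain \<beta> j' s where i': "i' = (\<beta>, j', s)" by (cases i')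
      show "i' \<in> ?B \<longleftrightarrow> i' \<in> {(Inr e, j, False)} \<union> (if 1 \<le> j then {(Inr e, j, True)} else {})"
        unfolding i' e using eF jJ by (cases s) (auto simp: I_iff)
    qed
    have val: "test_fun (Inr e, j, False) ?n x = Cs w y" "test_fun (Inr e, j, True) ?n x = Sn w y"
      using n(2) x(2) by (simp_all add: test_fun_def cycle_lift_def trig_def freq_def w)
    have "(\<Sum>i'\<in>?B. c i' * test_fun i' ?n x) = 0" using comp[OF n(1) _ x(1)] n(2) e by (simp add: block_edges_def cycle_edges_def)
    then show ?thesis unfolding B by (cases "1 \<le> j") (simp_all add: val)
  qed
  show ?thesis
    using i
  proof (cases rule: I_cases)
    case (single n j)
    have "?B = {i}"
    proof (rule set_eqI)
      fix i' :: test_index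
      obtain \<beta> j' s where i': "i' = (\<beta>, j', s)" by (cases i')
      show "i' \<in> ?B \<longleftrightarrow> i' \<in> {i}" unfolding i' single(1) using single(2,3) by (auto simp: I_iff)
    qed
    then show ?thesis using comp[of n "a n"] single len[of n] by (simp add: block_edges_def test_fun_def trig_def)
  next
    case (cos e j)
    have eF: "e \<in> F" using cos by simp
    interpret c: cycle N a b V "k e" "es e" "vs e" by (rule cycle[OF eF])
    have "a (es e 0) < b (es e 0)" using len c.es c.k by simp
    then show ?thesis using cyccase[of e j 0 "2 * real j * pi / circ e"] cos by (simp split: if_splits)
  next
    case (sin e j)
    have eF: "e \<in> F" using sin by simp
    interpret c: cycle N a b V "k e" "es e" "vs e" by (rule cycle[OF eF])
    have ab: "a (es e 0) < b (es e 0)" using len c.es c.k by simp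
    define w where "w = 2 * real j * pi / circ e"
    have w: "w > 0" unfolding w_def using circ_pos[OF eF] sin by (intro divide_pos_pos mult_pos_pos) auto
    \<comment> \<open>Within the first edge and with w y <= 1 < pi, so that the sine does not
      vanish.\<close>
    define y where "y = min (b (es e 0) - a (es e 0)) (1 / w)"
    have "w * y \<le> w * (1 / w)" using w by (intro mult_left_mono) (auto simp: y_def)
    then have "w * y < pi" using w pi_gt3 by simp
    moreover have y: "0 < y" "y \<le> b (es e 0) - a (es e 0)" using ab w by (auto simp: y_def)
    ultimately have S: "Sn w y > 0" using w by (intro Sn_pos) auto
    have "c (Inr e, j, False) = 0" using cyccase[of e j 0 w] sin ab by (simp add: w_def)
    then have "c (Inr e, j, True) * Sn w y = 0" using cyccase[of e j y w] sin y by (simp add: w_def)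
    then show ?thesis using S sin(1) by simp
  qed
qed

(* Endpoints outside P need no equation: test functions agree at the end of a cycle edge and at
   the start of the next one. *)
definition P :: "endpoint set" where
  "P = single \<times> UNIV \<union> (\<Union>e\<in>F. (\<lambda>n. (n, \<not> cycle_orient (k e) (es e) (vs e) n)) ` cycle_edges e)"

lemma P_endpoints: "P \<subseteq> endpoints N"
  using cycle.es[OF cycle] unfolding P_def endpoints_def single_def cycle_edges_def by auto

lemma card_cycle_edges: "e \<in> F \<Longrightarrow> card (cycle_edges e) = k e"
  unfolding cycle_edges_def using cycle.inj[OF cycle] by (simp add: card_image)

lemma card_P: "finite P" "card P \<le> 2 * card single + (\<Sum>e\<in>F. k e)"
proof -
  have fin: "finite (cycle_edges e)" for e by (simp add: cycle_edges_def)
  show "finite P" unfolding P_def using finite_single finite_F fin by auto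
  have "card P \<le> card (single \<times> (UNIV :: bool set)) + card (\<Union>e\<in>F. (\<lambda>n. (n, \<not> cycle_orient (k e) (es e) (vs e) n)) ` cycle_edges e)"
    unfolding P_def by (rule card_Un_le)
  also have "card (single \<times> (UNIV :: bool set)) = 2 * card single" by (simp add: card_cartesian_product)
  also have "card (\<Union>e\<in>F. (\<lambda>n. (n, \<not> cycle_orient (k e) (es e) (vs e) n)) ` cycle_edges e) \<le> (\<Sum>e\<in>F. card ((\<lambda>n. (n, \<not> cycle_orient (k e) (es e) (vs e) n)) ` cycle_edges e))"
    by (rule card_UN_le[OF finite_F])
  also have "\<dots> \<le> (\<Sum>e\<in>F. k e)"
  proof (intro sum_mono)
    fix e assume "e \<in> F"
    then show "card ((\<lambda>n. (n, \<not> cycle_orient (k e) (es e) (vs e) n)) ` cycle_edges e) \<le> k e"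
      using card_image_le[OF fin[of e], of "\<lambda>n. (n, \<not> cycle_orient (k e) (es e) (vs e) n)"] card_cycle_edges by simp
  qed
  finally show "card P \<le> 2 * card single + (\<Sum>e\<in>F. k e)" by simp
qed

lemma edges_split: "{..<N} = single \<union> (\<Union>e\<in>F. cycle_edges e)" "single \<inter> (\<Union>e\<in>F. cycle_edges e) = {}"
  using cycle.es[OF cycle] unfolding single_def cycle_edges_def by auto

lemma sum_edges: "(\<Sum>n<N. h n) = (\<Sum>n\<in>single. h n) + (\<Sum>e\<in>F. \<Sum>n\<in>cycle_edges e. h n)"
proof -
  have fin: "finite (cycle_edges e)" for e by (simp add: cycle_edges_def)
  have "(\<Sum>n<N. h n) = (\<Sum>n\<in>single. h n) + (\<Sum>n\<in>(\<Union>e\<in>F. cycle_edges e). h n)"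
    unfolding edges_split(1) using edges_split(2) finite_single finite_F fin by (intro sum.union_disjoint) auto
  also have "(\<Sum>n\<in>(\<Union>e\<in>F. cycle_edges e). h n) = (\<Sum>e\<in>F. \<Sum>n\<in>cycle_edges e. h n)"
    using finite_F fin disj by (intro sum.UNION_disjoint) (auto simp: cycle_edges_def)
  finally show ?thesis .
qed

lemma card_I: "card I = (\<Sum>n\<in>single. Suc (dir_number K n)) + (\<Sum>e\<in>F. Suc (2 * max_freq e))"
proof -
  have c1: "card I1 = (\<Sum>n\<in>single. Suc (dir_number K n))"
    unfolding I1_def using finite_single by (subst card_image) (auto simp: inj_on_def)
  have c2: "card I2 = (\<Sum>e\<in>F. Suc (max_freq e))"
    unfolding I2_def using finite_F by (subst card_image) (auto simp: inj_on_def)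
  have c3: "card I3 = (\<Sum>e\<in>F. max_freq e)"
    unfolding I3_def using finite_F by (subst card_image) (auto simp: inj_on_def)
  have fin: "finite I1" "finite I2" "finite I3" using finite_I by (auto simp: I_def)
  have "I1 \<inter> I2 = {}" "(I1 \<union> I2) \<inter> I3 = {}" by (auto simp: I1_def I2_def I3_def)
  then have "card I = card I1 + card I2 + card I3"
    unfolding I_def using fin by (simp add: card_Un_disjoint)
  then show ?thesis by (simp add: c1 c2 c3 sum.distrib[symmetric] mult_2)
qed

lemma test_fun_match:
  assumes P: "\<And>p. p \<in> P \<Longrightarrow> (\<Sum>i\<in>I. c i * end_val a b (test_fun i) p) = y (vert V p)" and n: "n < N"
  shows "(\<Sum>i\<in>I. c i * end_val a b (test_fun i) (n, s)) = y (vert V (n, s))"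
proof (cases "(n, s) \<in> P")
  case False
  then obtain e where e: "e \<in> F" "n \<in> cycle_edges e" using n by (auto simp: P_def single_def)
  interpret c: cycle N a b V "k e" "es e" "vs e" by (rule cycle[OF e(1)])
  obtain l where l: "l < k e" "n = es e l" using e(2) by (auto simp: cycle_edges_def)
  have s: "s = c.ori n" using False e by (auto simp: P_def)
  define l' where "l' = Suc l mod k e"
  have l': "l' < k e" using c.k by (simp add: l'_def)
  define n' where "n' = es e l'"
  have n': "n' \<in> cycle_edges e" using l' by (auto simp: n'_def cycle_edges_def)
  have "end_val a b (test_fun i) (n, s) = end_val a b (test_fun i) (n', \<not> c.ori n')" if i: "i \<in> I" for i
  proof (cases "fst i = Inr e")
    case True
    then have test_fun: "test_fun i = cycle_lift a b (k e) (es e) (vs e) (trig i)" by (auto simp: test_fun_def fun_eq_iff)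
    \<comment> \<open>The coordinate jumps only after the last edge, from \<open>circ e\<close> back
      to 0, where periodicity applies.\<close>
    have "trig i (cycle_pos a b (es e) (Suc l)) = trig i (cycle_pos a b (es e) l')"
    proof (cases "Suc l = k e")
      case True
      then show ?thesis using trig_period(1)[OF i \<open>fst i = Inr e\<close>] by (simp add: l'_def circ_def cycle_pos_def)
    next
      case False
      then show ?thesis using l(1) by (simp add: l'_def)
    qed
    then show ?thesis unfolding test_fun using c.end_val_finish[OF l(1)] c.end_val_start[OF l'] l(2) s by (simp add: n'_def)
  next
    case False
    have "n'' \<notin> block_edges (fst i)" if "n'' \<in> cycle_edges e" for n''
      using i False e disj that by (elim I_cases) (auto simp: block_edges_def single_def cycle_edges_def)
    then show ?thesis using test_fun_zero(1) e(2) n' by (simp add: end_val_def)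
  qed
  then have "(\<Sum>i\<in>I. c i * end_val a b (test_fun i) (n, s)) = (\<Sum>i\<in>I. c i * end_val a b (test_fun i) (n', \<not> c.ori n'))"
    by simp
  also have "\<dots> = y (vert V (n', \<not> c.ori n'))"
    using e(1) n' by (intro P) (auto simp: P_def)
  also have "vert V (n', \<not> c.ori n') = vert V (n, s)"
    using c.vert_start[OF l'] c.vert_finish[OF l(1)] s l(2) by (simp add: n'_def l'_def)
  finally show ?thesis .
qed (rule P)

text \<open>With D the sum of all \<open>dir_number\<close>, s = \<open>card single\<close> and f =
  \<open>card F\<close>: \<open>card I\<close> is at least D + s + f and \<open>card P\<close> at
  most N + s, so gluing gives at least D + f + \<open>card V\<close> - N, which is at least D +
  1.\<close>

lemma std_eig_count_ge:
  assumes rank: "N + 1 \<le> card F + card V"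
    and floor: "\<And>e. e \<in> F \<Longrightarrow> (\<Sum>n\<in>cycle_edges e. dir_number K n) \<le> 2 * max_freq e"
  shows "(\<Sum>n<N. dir_number K n) + 1 \<le> eig_count N a b (std_sol N a b V) (K\<^sup>2)"
proof -
  have "card I + card V \<le> eig_count N a b (std_sol N a b V) (K\<^sup>2) + card P"
  proof (rule glue[where g = test_fun and lam = "\<lambda>i. (freq i)\<^sup>2", OF eigenfamily_test_fun])
    show "c i = 0" if "\<And>n x. n < N \<Longrightarrow> x \<in> {a n..b n} \<Longrightarrow> (\<Sum>i\<in>I. c i * test_fun i n x) = 0" "i \<in> I" for c i
      using test_fun_independent[of c i] that by blast
    show "finite P" by (rule card_P(1))
    show "P \<subseteq> endpoints N" by (rule P_endpoints)
    show "(\<Sum>i\<in>I. c i * end_val a b (test_fun i) (n, s)) = y (vert V (n, s))"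
      if "\<And>p. p \<in> P \<Longrightarrow> (\<Sum>i\<in>I. c i * end_val a b (test_fun i) p) = y (vert V p)" "n < N" for c y n s
      using test_fun_match[of c y n s] that by blast
    show "(freq i)\<^sup>2 \<le> K\<^sup>2" if "i \<in> I" for i using freq_le freq_nonneg that by (intro power_mono) auto
  qed
  moreover have "(\<Sum>n<N. dir_number K n) + card single + card F \<le> card I"
  proof -
    have "(\<Sum>e\<in>F. \<Sum>n\<in>cycle_edges e. dir_number K n) \<le> (\<Sum>e\<in>F. 2 * max_freq e)" by (intro sum_mono floor)
    then show ?thesis unfolding card_I sum_edges by (simp add: sum.distrib sum_Suc)
  qed
  moreover have "N = card single + (\<Sum>e\<in>F. k e)"
    using sum_edges[of "\<lambda>_. 1 :: nat"] card_cycle_edges by simp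
  ultimately show ?thesis using rank card_P(2) by linarith
qed

end

section \<open>Comparison of the two counting functions\<close>

lemma (in mgraph) std_eig_count_gt_dir:
  assumes conn: "mg_connected N V" and ind: "only_independent_cycles N V"
    and even: "\<forall>S. is_cycle N V S \<longrightarrow> (\<forall>eh\<in>S. \<exists>\<nu> :: nat \<Rightarrow> int.
            (\<forall>e\<in>S. \<nu> e \<in> {-1, 1}) \<and>
            (\<exists>m :: int. (\<Sum>e\<in>S. of_int (\<nu> e) * edge_len a b e) / edge_len a b eh = 2 * of_int m))"
    and K: "0 \<le> K"
  shows "eig_count N a b (dir_sol N a b) (K\<^sup>2) + 1 \<le> eig_count N a b (std_sol N a b V) (K\<^sup>2)"
proof -
  obtain F :: "nat set" and k es vs where c: "finite F" "N + 1 \<le> card F + card V"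
     "\<And>e. e \<in> F \<Longrightarrow> cycle_data N V (k e) (es e) (vs e)"
     "\<And>e e'. e \<in> F \<Longrightarrow> e' \<in> F \<Longrightarrow> e \<noteq> e' \<Longrightarrow> es e ` {..<k e} \<inter> es e' ` {..<k e'} = {}"
    using cycle_basis[OF graph conn ind] by (elim exE conjE) blast
  define B where "B = (\<Sum>n<N. b n - a n)"
  \<comment> \<open>The total length \<open>B\<close> bounds every edge, so this \<open>m\<close>
    gives (K + 1) * (piece length) < 1 < pi on all edges.\<close>
  obtain m :: nat where m: "(K + 1) * B < real m" using reals_Archimedean2 by blast
  have B: "b n - a n \<le> B" "0 \<le> B" if "n < N" for n
    unfolding B_def using len that
    by (intro member_le_sum sum_nonneg; auto intro: less_imp_le)+
  have N: "0 < N" using graph by (simp add: metric_graph_def)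
  have "0 \<le> (K + 1) * B" using B(2)[OF N] K by (intro mult_nonneg_nonneg) auto
  then have m0: "0 < m" using m by (cases m) auto
  interpret subdivided N a b V K m
  proof
    fix n assume n: "n < N"
    have "(K + 1) * ((b n - a n) / real m) \<le> (K + 1) * (B / real m)"
      using B[OF n] K by (intro mult_left_mono divide_right_mono) auto
    also have "\<dots> < 1" using m m0 by (simp add: field_simps)
    finally show "(K + 1) * ((b n - a n) / real m) < pi" using pi_gt3 by simp
  qed (use K m0 in auto)
  interpret cactus N a b V K m F k es vs by unfold_locales (use c in auto)
  have "(\<Sum>n\<in>cycle_edges e. dir_number K n) \<le> 2 * max_freq e" if e: "e \<in> F" for e
  proof -
    interpret cy: cycle N a b V "k e" "es e" "vs e" by (rule cycle[OF e])
    have cyc: "is_cycle N V (cycle_edges e)" using c(3)[OF e] unfolding is_cycle_iff cycle_edges_def by blast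
    have "(\<Sum>n\<in>cycle_edges e. nat \<lfloor>K * (b n - a n) / pi\<rfloor>) \<le> 2 * nat \<lfloor>K * (\<Sum>n\<in>cycle_edges e. b n - a n) / (2 * pi)\<rfloor>"
    proof (rule sum_floor_le)
      show "finite (cycle_edges e)" by (simp add: cycle_edges_def)
      show "0 < b n - a n" if "n \<in> cycle_edges e" for n using that len cy.es by (auto simp: cycle_edges_def)
      show "\<exists>\<nu> :: nat \<Rightarrow> int. (\<forall>e\<in>cycle_edges e. \<nu> e \<in> {-1, 1}) \<and>
          (\<exists>m :: int. (\<Sum>e\<in>cycle_edges e. of_int (\<nu> e) * (b e - a e)) / (b h - a h) = 2 * of_int m)" if "h \<in> cycle_edges e" for h
        using even cyc that unfolding edge_len_def by blast
    qed (rule K)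
    then show ?thesis unfolding dir_number_def max_freq_def circ_def cy.circ_eq cycle_edges_def[symmetric] .
  qed
  then have "(\<Sum>n<N. dir_number K n) + 1 \<le> eig_count N a b (std_sol N a b V) (K\<^sup>2)"
    by (rule std_eig_count_ge[OF c(2)])
  then show ?thesis using dir_spectrum(2)[OF K] by linarith
qed

theorem mainTheorem13:
  fixes N :: nat and a b :: "nat \<Rightarrow> real" and V :: "endpoint set set"
  assumes "metric_graph N a b V"
    and "mg_connected N V"
    and "only_independent_cycles N V"
    and "\<forall>S. is_cycle N V S \<longrightarrow> (\<forall>eh\<in>S. \<exists>\<nu> :: nat \<Rightarrow> int.
            (\<forall>e\<in>S. \<nu> e \<in> {-1, 1}) \<and>
            (\<exists>m :: int. (\<Sum>e\<in>S. of_int (\<nu> e) * edge_len a b e) / edge_len a b eh = 2 * of_int m))"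
  shows "\<forall>n \<ge> 1. eigval N a b (std_sol N a b V) (Suc n) \<le> eigval N a b (dir_sol N a b) n"
proof (intro allI impI)
  fix n :: nat assume n: "1 \<le> n"
  interpret mgraph N a b V by unfold_locales (rule assms(1))
  have std: "eig_count N a b (std_sol N a b V) mu = 0" if "mu < 0" for mu
    by (rule eig_count_negative[OF that]) (auto simp: std_sol_def intro: boundary_form_std[unfolded std_sol_def])
  have dir: "eig_count N a b (dir_sol N a b) mu = 0" if "mu < 0" for mu
    by (rule eig_count_negative[OF that]) (auto simp: dir_sol_def intro: boundary_form_dir[unfolded dir_sol_def])
  show "eigval N a b (std_sol N a b V) (Suc n) \<le> eigval N a b (dir_sol N a b) n"
    unfolding eigval_def
  \<comment> \<open>Each threshold reaching \<open>n\<close> Dirichlet eigenvalues reaches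
    \<open>Suc n\<close> standard ones; the infimum of the larger set is smaller.\<close>
  proof (rule cInf_superset_mono)
    show "{mu. n \<le> eig_count N a b (dir_sol N a b) mu} \<noteq> {}"
      using dir_eig_count_unbounded[of n] by blast
    show "bdd_below {mu. Suc n \<le> eig_count N a b (std_sol N a b V) mu}"
    proof (rule bdd_belowI)
      fix mu assume "mu \<in> {mu. Suc n \<le> eig_count N a b (std_sol N a b V) mu}"
      then show "0 \<le> mu" using std[of mu] by (cases "mu < 0") auto
    qed
    show "{mu. n \<le> eig_count N a b (dir_sol N a b) mu} \<subseteq> {mu. Suc n \<le> eig_count N a b (std_sol N a b V) mu}"
    proof clarify
      fix mu assume mu: "n \<le> eig_count N a b (dir_sol N a b) mu"
      \<comment> \<open>Since n >= 1, the Dirichlet count is positive, so \<open>mu\<close> is the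
        square of \<open>sqrt mu\<close>.\<close>
      then have "0 \<le> mu" using dir[of mu] n by (cases "mu < 0") auto
      then show "Suc n \<le> eig_count N a b (std_sol N a b V) mu"
        using std_eig_count_gt_dir[OF assms(2-4), of "sqrt mu"] mu by simp
    qed
  qed
qed

end
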